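(* Let $u\in\mathcal{O}_L$ with $|u|\leq p^{-1}$, let $\pi=\varpi-[u]\in W(\mathcal{O}_L)_E$, and let $r\in[0,1]$. Then the function $H(u,r)$ on $W(\mathcal{O}_L)_E$ is a multiplicative seminorm bounded above by $\lambda$ (i.e. $H(u,r)(x)\leq\lambda(x)$ for all $x$). Moreover, for any $x\in W(\mathcal{O}_L)_E$ and any stable presentation $x_0,x_1,\dots$ of $x$ with respect to $u$, one has $H(u,r)(x)=\max_i\{(r/p)^i\lambda(x_i)\}$.
   Context: Fix a prime $p$ and a power $q$ of $p$. Let $L$ be a perfect field containing $\mathbb{F}_q$, complete for a multiplicative nonarchimedean norm $|\cdot|$, with valuation ring $\mathcal{O}_L$. Let $E$ be a complete discretely valued field with residue field containing $\mathbb{F}_q$, valuation ring $\mathcal{O}_E$ and uniformizer $\varpi$. Put $W(\mathcal{O}_L)_E:=W(\mathcal{O}_L)\otimes_{W(\mathbb{F}_q)}\mathcal{O}_E$; every element can be written uniquely as $\sum_{i\geq0}\varpi^i[\overline{x}_i]$ with $\overline{x}_i\in\mathcal{O}_L$ (here $[\cdot]$ is the Teichmüller lift). Define $\lambda(\sum_{i\ge0}\varpi^i[\overline{x}_i])=\max_i p^{-i}|\overline{x}_i|$. An element $x=\sum_i\varpi^i[\overline{x}_i]$ is \emph{stable} if either $\overline{x}_i=0$ for all $i$, or $|\overline{x}_0|>p^{-i}|\overline{x}_i|$ for all $i>0$. Given $u$ and $\pi$ as in the claim, a sequence $x_0,x_1,\dots$ of elements of $W(\mathcal{O}_L)_E$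 is a \emph{presentation} of $x$ with respect to $u$ if $x=\sum_{i\ge0}x_i\pi^i$ (this series always converges, $W(\mathcal{O}_L)_E$ being $(\varpi,[u])$-adically complete); it is a \emph{stable presentation} if every $x_i$ is stable. For $r\in[0,1]$, $H(u,r)$ is the quotient seminorm on $W(\mathcal{O}_L)_E\cong W(\mathcal{O}_L)_E[T]/(T-\pi)$ induced by the $(r/p)$-Gauss extension of $\lambda$ to $W(\mathcal{O}_L)_E[T]$, i.e. $H(u,r)(x)=\inf\{\max_i (r/p)^i\lambda(a_i): \sum_i a_i\pi^i=x,\ \sum_i a_iT^i\in W(\mathcal{O}_L)_E[T]\}$.
   Formalization: The residue field of E is taken equal to F_q (if it were larger, the expansions with coefficients in O_L, hence λ, would not exist), and W(O_L)_E is the ϖ-adically completed tensor product (no change for E of characteristic 0; needed for completeness in characteristic p). *)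

theory Defs
  imports
    Complex_Main
    "HOL-Computational_Algebra.Primes"
    "HOL-Library.Poly_Mapping"
    "HOL-Algebra.Ideal_Product"
    "HOL-Algebra.QuotRing"
    "HOL-Algebra.UnivPoly"
begin

section \<open>Valued fields\<close>

text \<open>Fields are types; their subrings are turned into records for HOL-Algebra.\<close>

definition subring_rec :: "'a::comm_ring_1 set \<Rightarrow> 'a ring" where
  "subring_rec A = \<lparr>carrier = A, mult = (*), one = 1, zero = 0, add = (+)\<rparr>"

definition nonarch_norm :: "('a::field \<Rightarrow> real) \<Rightarrow> bool" where
  "nonarch_norm nm \<longleftrightarrow>
     (\<forall>x. nm x \<ge> 0) \<and> (\<forall>x. nm x = 0 \<longleftrightarrow> x = 0) \<and>
     (\<forall>x y. nm (x * y) = nm x * nm y) \<and>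
     (\<forall>x y. nm (x + y) \<le> max (nm x) (nm y))"

definition norm_complete :: "('a::field \<Rightarrow> real) \<Rightarrow> bool" where
  "norm_complete nm \<longleftrightarrow>
     (\<forall>s :: nat \<Rightarrow> 'a.
        (\<forall>e>0. \<exists>N. \<forall>m\<ge>N. \<forall>n\<ge>N. nm (s m - s n) < e) \<longrightarrow>
        (\<exists>l. (\<lambda>n. nm (s n - l)) \<longlonglongrightarrow> 0))"

definition val_ring :: "('a::field \<Rightarrow> real) \<Rightarrow> 'a set" where
  "val_ring nm = {x. nm x \<le> 1}"

definition max_ideal :: "('a::field \<Rightarrow> real) \<Rightarrow> 'a set" where
  "max_ideal nm = {x. nm x < 1}"

definition residue_field :: "('a::field \<Rightarrow> real) \<Rightarrow> 'a set ring" where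
  "residue_field nm = subring_rec (val_ring nm) Quot max_ideal nm"

text \<open>A nonarchimedean norm is discrete and nontrivial iff it has a uniformizer, i.e. an element
  whose norm is less than 1 and generates the value group.\<close>

definition uniformizer :: "('a::field \<Rightarrow> real) \<Rightarrow> 'a \<Rightarrow> bool" where
  "uniformizer nm w \<longleftrightarrow> 0 < nm w \<and> nm w < 1 \<and> (\<forall>x. x \<noteq> 0 \<longrightarrow> (\<exists>k::int. nm x = nm w powi k))"


section \<open>Witt vectors\<close>

text \<open>Integer polynomials in the variables $X_0, X_1, \dots$ (indices \<open>Inl n\<close>) and
  $Y_0, Y_1, \dots$ (indices \<open>Inr n\<close>): a monomial is a finitely supported family of exponents,
  and the product of polynomials is the convolution product of \<^theory>\<open>HOL-Library.Poly_Mapping\<close>.\<close>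

type_synonym zpoly = "((nat + nat) \<Rightarrow>\<^sub>0 nat) \<Rightarrow>\<^sub>0 int"

definition zvar :: "nat + nat \<Rightarrow> zpoly" where
  "zvar v = Poly_Mapping.single (Poly_Mapping.single v 1) 1"

definition zpoly_eval :: "(nat + nat \<Rightarrow> 'a::comm_ring_1) \<Rightarrow> zpoly \<Rightarrow> 'a" where
  "zpoly_eval f P =
     (\<Sum>m\<in>Poly_Mapping.keys P.
        of_int (Poly_Mapping.lookup P m) *
        (\<Prod>v\<in>Poly_Mapping.keys m. f v ^ Poly_Mapping.lookup m v))"

definition ghost :: "nat \<Rightarrow> (nat \<Rightarrow> 'a::comm_ring_1) \<Rightarrow> nat \<Rightarrow> 'a" where
  "ghost p x n = (\<Sum>i\<le>n. of_nat p ^ i * x i ^ (p ^ (n - i)))"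

text \<open>By Witt's theorem, each of the following two families of integer polynomials exists, and it
  is unique because \<^typ>\<open>zpoly\<close> is torsion-free.\<close>

definition witt_sum_poly :: "nat \<Rightarrow> nat \<Rightarrow> zpoly" where
  "witt_sum_poly p =
     (THE S. \<forall>n. ghost p S n = ghost p (\<lambda>i. zvar (Inl i)) n + ghost p (\<lambda>i. zvar (Inr i)) n)"

definition witt_prod_poly :: "nat \<Rightarrow> nat \<Rightarrow> zpoly" where
  "witt_prod_poly p =
     (THE S. \<forall>n. ghost p S n = ghost p (\<lambda>i. zvar (Inl i)) n * ghost p (\<lambda>i. zvar (Inr i)) n)"

definition witt_ring :: "nat \<Rightarrow> 'a::comm_ring_1 set \<Rightarrow> (nat \<Rightarrow> 'a) ring" where
  "witt_ring p A =
     \<lparr>carrier = {x. \<forall>n. x n \<in> A},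
      mult = (\<lambda>x y n. zpoly_eval (case_sum x y) (witt_prod_poly p n)),
      one = (\<lambda>n. if n = 0 then 1 else 0),
      zero = (\<lambda>n. 0),
      add = (\<lambda>x y n. zpoly_eval (case_sum x y) (witt_sum_poly p n))\<rparr>"

definition teichmueller :: "'a::comm_ring_1 \<Rightarrow> nat \<Rightarrow> 'a" where
  "teichmueller a = (\<lambda>n. if n = 0 then a else 0)"


section \<open>Tensor products of commutative rings\<close>

text \<open>The integral monoid ring; its additive group is the free abelian group on the monoid.\<close>

definition monoid_ring :: "('m, 'x) monoid_scheme \<Rightarrow> ('m \<Rightarrow>\<^sub>0 int) ring" where
  "monoid_ring M =
     \<lparr>carrier = {f. Poly_Mapping.keys f \<subseteq> carrier M},
      mult = (\<lambda>f g. frag_extend (\<lambda>x. frag_extend (\<lambda>y. frag_of (x \<otimes>\<^bsub>M\<^esub> y)) g) f),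
      one = frag_of \<one>\<^bsub>M\<^esub>,
      zero = 0,
      add = (+)\<rparr>"

text \<open>\<open>tensor_ring A B C f g\<close> is $B \otimes_A C$ for ring homomorphisms $f : A \to B$ and
  $g : A \to C$, with $b \otimes c$ the class of \<open>frag_of (b, c)\<close>. The subgroup generated by the
  relations is closed under multiplication by the basis elements $(b, c)$, so the ideal
  they generate is no larger than this subgroup.\<close>

definition tensor_rels ::
  "('a, 'x) ring_scheme \<Rightarrow> ('b, 'y) ring_scheme \<Rightarrow> ('c, 'z) ring_scheme \<Rightarrow>
   ('a \<Rightarrow> 'b) \<Rightarrow> ('a \<Rightarrow> 'c) \<Rightarrow> (('b \<times> 'c) \<Rightarrow>\<^sub>0 int) set" where
  "tensor_rels A B C f g =
     {frag_of (b \<oplus>\<^bsub>B\<^esub> b', c) - frag_of (b, c) - frag_of (b', c) | b b' c.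
        b \<in> carrier B \<and> b' \<in> carrier B \<and> c \<in> carrier C} \<union>
     {frag_of (b, c \<oplus>\<^bsub>C\<^esub> c') - frag_of (b, c) - frag_of (b, c') | b c c'.
        b \<in> carrier B \<and> c \<in> carrier C \<and> c' \<in> carrier C} \<union>
     {frag_of (f a \<otimes>\<^bsub>B\<^esub> b, c) - frag_of (b, g a \<otimes>\<^bsub>C\<^esub> c) | a b c.
        a \<in> carrier A \<and> b \<in> carrier B \<and> c \<in> carrier C}"

definition tensor_ideal ::
  "('a, 'x) ring_scheme \<Rightarrow> ('b, 'y) ring_scheme \<Rightarrow> ('c, 'z) ring_scheme \<Rightarrow>
   ('a \<Rightarrow> 'b) \<Rightarrow> ('a \<Rightarrow> 'c) \<Rightarrow> (('b \<times> 'c) \<Rightarrow>\<^sub>0 int) set" where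
  "tensor_ideal A B C f g = Idl\<^bsub>monoid_ring (B \<times>\<times> C)\<^esub> (tensor_rels A B C f g)"

definition tensor_ring ::
  "('a, 'x) ring_scheme \<Rightarrow> ('b, 'y) ring_scheme \<Rightarrow> ('c, 'z) ring_scheme \<Rightarrow>
   ('a \<Rightarrow> 'b) \<Rightarrow> ('a \<Rightarrow> 'c) \<Rightarrow> (('b \<times> 'c) \<Rightarrow>\<^sub>0 int) set ring" where
  "tensor_ring A B C f g = monoid_ring (B \<times>\<times> C) Quot tensor_ideal A B C f g"

definition pure_tensor ::
  "('a, 'x) ring_scheme \<Rightarrow> ('b, 'y) ring_scheme \<Rightarrow> ('c, 'z) ring_scheme \<Rightarrow>
   ('a \<Rightarrow> 'b) \<Rightarrow> ('a \<Rightarrow> 'c) \<Rightarrow> 'b \<Rightarrow> 'c \<Rightarrow> (('b \<times> 'c) \<Rightarrow>\<^sub>0 int) set" where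
  "pure_tensor A B C f g b c =
     tensor_ideal A B C f g +>\<^bsub>monoid_ring (B \<times>\<times> C)\<^esub> frag_of (b, c)"


section \<open>Adic topologies\<close>

primrec ideal_pow :: "('a, 'x) ring_scheme \<Rightarrow> 'a set \<Rightarrow> nat \<Rightarrow> 'a set" where
  "ideal_pow R I 0 = carrier R"
| "ideal_pow R I (Suc n) = ideal_prod R I (ideal_pow R I n)"

text \<open>The inverse limit of the quotients $R/I^n$; a coset of $I^{n+1}$ maps to the unique coset
  of $I^n$ containing it.\<close>

definition adic_completion :: "('a, 'x) ring_scheme \<Rightarrow> 'a set \<Rightarrow> (nat \<Rightarrow> 'a set) ring" where
  "adic_completion R I =
     \<lparr>carrier = {s. \<forall>n. s n \<in> carrier (R Quot ideal_pow R I n) \<and> s (Suc n) \<subseteq> s n},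
      mult = (\<lambda>s t n. s n \<otimes>\<^bsub>R Quot ideal_pow R I n\<^esub> t n),
      one = (\<lambda>n. \<one>\<^bsub>R Quot ideal_pow R I n\<^esub>),
      zero = (\<lambda>n. \<zero>\<^bsub>R Quot ideal_pow R I n\<^esub>),
      add = (\<lambda>s t n. s n \<oplus>\<^bsub>R Quot ideal_pow R I n\<^esub> t n)\<rparr>"

definition to_completion :: "('a, 'x) ring_scheme \<Rightarrow> 'a set \<Rightarrow> 'a \<Rightarrow> nat \<Rightarrow> 'a set" where
  "to_completion R I a = (\<lambda>n. ideal_pow R I n +>\<^bsub>R\<^esub> a)"

definition adic_sums :: "('a, 'x) ring_scheme \<Rightarrow> 'a set \<Rightarrow> (nat \<Rightarrow> 'a) \<Rightarrow> 'a \<Rightarrow> bool" where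
  "adic_sums R I f x \<longleftrightarrow>
     (\<forall>k. \<exists>N. \<forall>n\<ge>N. x \<ominus>\<^bsub>R\<^esub> (\<Oplus>\<^bsub>R\<^esub> i\<in>{..<n}. f i) \<in> ideal_pow R I k)"

text \<open>Seminorms are nonarchimedean.\<close>

definition multiplicative_seminorm :: "('a, 'x) ring_scheme \<Rightarrow> ('a \<Rightarrow> real) \<Rightarrow> bool" where
  "multiplicative_seminorm R \<alpha> \<longleftrightarrow>
     (\<forall>x\<in>carrier R. \<alpha> x \<ge> 0) \<and> \<alpha> \<zero>\<^bsub>R\<^esub> = 0 \<and> \<alpha> \<one>\<^bsub>R\<^esub> = 1 \<and>
     (\<forall>x\<in>carrier R. \<forall>y\<in>carrier R. \<alpha> (x \<ominus>\<^bsub>R\<^esub> y) \<le> max (\<alpha> x) (\<alpha> y)) \<and>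
     (\<forall>x\<in>carrier R. \<forall>y\<in>carrier R. \<alpha> (x \<otimes>\<^bsub>R\<^esub> y) = \<alpha> x * \<alpha> y)"


section \<open>The ring $W(\mathcal{O}_L)_E$\<close>

text \<open>\<open>structE\<close> is the homomorphism $W(\mathbb{F}_q) \to \mathcal{O}_E$ that makes $\mathcal{O}_E$ a
  $W(\mathbb{F}_q)$-algebra, and \<open>unif\<close> is $\varpi$.\<close>

record ('l, 'e) witt_data =
  charp :: nat
  cardq :: nat
  absL :: "'l \<Rightarrow> real"
  absE :: "'e \<Rightarrow> real"
  unif :: 'e
  structE :: "(nat \<Rightarrow> 'l) \<Rightarrow> 'e"

definition OL :: "('l::field, 'e::field) witt_data \<Rightarrow> 'l set" where
  "OL D = val_ring (absL D)"

definition OE :: "('l::field, 'e::field) witt_data \<Rightarrow> 'e ring" where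
  "OE D = subring_rec (val_ring (absE D))"

definition Fq :: "('l::field, 'e::field) witt_data \<Rightarrow> 'l set" where
  "Fq D = {a. a ^ cardq D = a}"

text \<open>The residue field of $E$ is identified with $\mathbb{F}_q$ rather than with an extension
  $\kappa$ of it: modulo $\varpi$ the ring $W(\mathcal{O}_L)_E$ is
  $\mathcal{O}_L \otimes_{\mathbb{F}_q} \kappa$, and its elements are the classes of the Teichmueller
  lifts of $\mathcal{O}_L$, as the expansions $\sum_i \varpi^i [\overline{x}_i]$ require,
  only if $\kappa = \mathbb{F}_q$. The fields $E$ of characteristic 0 and of characteristic $p$ are
  both included.\<close>

definition witt_setup :: "('l::field, 'e::field) witt_data \<Rightarrow> bool" where
  "witt_setup D \<longleftrightarrow>
     prime (charp D) \<and> (\<exists>k>0. cardq D = charp D ^ k) \<and>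
     CHAR('l) = charp D \<and> surj (\<lambda>a::'l. a ^ charp D) \<and> card (Fq D) = cardq D \<and>
     nonarch_norm (absL D) \<and> norm_complete (absL D) \<and>
     nonarch_norm (absE D) \<and> norm_complete (absE D) \<and> uniformizer (absE D) (unif D) \<and>
     structE D \<in> ring_hom (witt_ring (charp D) (Fq D)) (OE D) \<and>
     (\<exists>j \<in> ring_iso (subring_rec (Fq D)) (residue_field (absE D)).
        \<forall>a \<in> carrier (witt_ring (charp D) (Fq D)).
          max_ideal (absE D) +>\<^bsub>OE D\<^esub> structE D a = j (a 0))"

type_synonym ('l, 'e) tensor_elt = "(((nat \<Rightarrow> 'l) \<times> 'e) \<Rightarrow>\<^sub>0 int) set"

definition tensorLE :: "('l::field, 'e::field) witt_data \<Rightarrow> ('l, 'e) tensor_elt ring" where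
  "tensorLE D =
     tensor_ring (witt_ring (charp D) (Fq D)) (witt_ring (charp D) (OL D)) (OE D)
       (\<lambda>a. a) (structE D)"

definition tensLE ::
  "('l::field, 'e::field) witt_data \<Rightarrow> (nat \<Rightarrow> 'l) \<Rightarrow> 'e \<Rightarrow> ('l, 'e) tensor_elt" where
  "tensLE D =
     pure_tensor (witt_ring (charp D) (Fq D)) (witt_ring (charp D) (OL D)) (OE D)
       (\<lambda>a. a) (structE D)"

definition unif_ideal :: "('l::field, 'e::field) witt_data \<Rightarrow> ('l, 'e) tensor_elt set" where
  "unif_ideal D = PIdl\<^bsub>tensorLE D\<^esub> (tensLE D \<one>\<^bsub>witt_ring (charp D) (OL D)\<^esub> (unif D))"

type_synonym ('l, 'e) WLE_elt = "nat \<Rightarrow> ('l, 'e) tensor_elt set"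

text \<open>The tensor product $W(\mathcal{O}_L) \otimes_{W(\mathbb{F}_q)} \mathcal{O}_E$ is taken to be
  $\varpi$-adically completed. For $E$ of characteristic 0 this changes nothing, as $\mathcal{O}_E$
  is then finite free over $W(\mathbb{F}_q)$; for $E$ of characteristic $p$ the series
  $\sum_i \varpi^i [\overline{x}_i]$ need not exist without it.\<close>

definition WLE :: "('l::field, 'e::field) witt_data \<Rightarrow> ('l, 'e) WLE_elt ring" where
  "WLE D = adic_completion (tensorLE D) (unif_ideal D)"

definition unifW :: "('l::field, 'e::field) witt_data \<Rightarrow> ('l, 'e) WLE_elt" where
  "unifW D =
     to_completion (tensorLE D) (unif_ideal D)
       (tensLE D \<one>\<^bsub>witt_ring (charp D) (OL D)\<^esub> (unif D))"

definition teichW :: "('l::field, 'e::field) witt_data \<Rightarrow> 'l \<Rightarrow> ('l, 'e) WLE_elt" where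
  "teichW D a = to_completion (tensorLE D) (unif_ideal D) (tensLE D (teichmueller a) \<one>\<^bsub>OE D\<^esub>)"


section \<open>Stable elements, presentations and $H(u,r)$\<close>

definition is_expansion ::
  "('l::field, 'e::field) witt_data \<Rightarrow> (nat \<Rightarrow> 'l) \<Rightarrow> ('l, 'e) WLE_elt \<Rightarrow> bool" where
  "is_expansion D c x \<longleftrightarrow>
     (\<forall>i. c i \<in> OL D) \<and>
     adic_sums (WLE D) (PIdl\<^bsub>WLE D\<^esub> (unifW D))
       (\<lambda>i. (unifW D [^]\<^bsub>WLE D\<^esub> i) \<otimes>\<^bsub>WLE D\<^esub> teichW D (c i)) x"

definition coeffs ::
  "('l::field, 'e::field) witt_data \<Rightarrow> ('l, 'e) WLE_elt \<Rightarrow> nat \<Rightarrow> 'l" where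
  "coeffs D x = (THE c. is_expansion D c x)"

text \<open>The supremum is a maximum because the terms are nonnegative and tend to 0.\<close>

definition lam ::
  "('l::field, 'e::field) witt_data \<Rightarrow> ('l, 'e) WLE_elt \<Rightarrow> real" where
  "lam D x = (SUP i. absL D (coeffs D x i) / real (charp D) ^ i)"

definition stable ::
  "('l::field, 'e::field) witt_data \<Rightarrow> ('l, 'e) WLE_elt \<Rightarrow> bool" where
  "stable D x \<longleftrightarrow>
     (\<forall>i. coeffs D x i = 0) \<or>
     (\<forall>i>0. absL D (coeffs D x 0) > absL D (coeffs D x i) / real (charp D) ^ i)"

definition piW ::
  "('l::field, 'e::field) witt_data \<Rightarrow> 'l \<Rightarrow> ('l, 'e) WLE_elt" where
  "piW D u = unifW D \<ominus>\<^bsub>WLE D\<^esub> teichW D u"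

definition presentation ::
  "('l::field, 'e::field) witt_data \<Rightarrow> 'l \<Rightarrow> ('l, 'e) WLE_elt \<Rightarrow>
   (nat \<Rightarrow> ('l, 'e) WLE_elt) \<Rightarrow> bool" where
  "presentation D u x xs \<longleftrightarrow>
     (\<forall>i. xs i \<in> carrier (WLE D)) \<and>
     adic_sums (WLE D) (Idl\<^bsub>WLE D\<^esub> {unifW D, teichW D u})
       (\<lambda>i. xs i \<otimes>\<^bsub>WLE D\<^esub> (piW D u [^]\<^bsub>WLE D\<^esub> i)) x"

definition stable_presentation ::
  "('l::field, 'e::field) witt_data \<Rightarrow> 'l \<Rightarrow> ('l, 'e) WLE_elt \<Rightarrow>
   (nat \<Rightarrow> ('l, 'e) WLE_elt) \<Rightarrow> bool" where
  "stable_presentation D u x xs \<longleftrightarrow> presentation D u x xs \<and> (\<forall>i. stable D (xs i))"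

text \<open>A polynomial over \<open>WLE D\<close> is its coefficient function, an element of
  \<open>carrier (UP (WLE D))\<close>; only finitely many coefficients are nonzero, so the supremum is a
  maximum.\<close>

definition gauss_norm ::
  "('l::field, 'e::field) witt_data \<Rightarrow> real \<Rightarrow> (nat \<Rightarrow> ('l, 'e) WLE_elt) \<Rightarrow> real" where
  "gauss_norm D s a = (SUP i. s ^ i * lam D (a i))"

definition H ::
  "('l::field, 'e::field) witt_data \<Rightarrow> 'l \<Rightarrow> real \<Rightarrow> ('l, 'e) WLE_elt \<Rightarrow> real" where
  "H D u r x =
     Inf {gauss_norm D (r / real (charp D)) a | a.
       a \<in> carrier (UP (WLE D)) \<and>
       (\<Oplus>\<^bsub>WLE D\<^esub> i\<in>{..deg (WLE D) a}. a i \<otimes>\<^bsub>WLE D\<^esub> (piW D u [^]\<^bsub>WLE D\<^esub> i)) = x}"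

end

theory Submission
  imports Defs
begin

text \<open>The Gauss norm $\lambda$ is multiplicative because the last index at which $p^{-i} |\overline{x}_i|$ attains
  its maximum (the peak of $x$) is additive under multiplication. The peak of $\pi = \varpi - [u]$ is 1, that of a
  nonzero stable element is 0; hence a stable element has the smallest norm in its class modulo $\pi$, and
  cancelling factors of $\pi$ one at a time gives $H(u,r)(\pi^n (y + \pi z)) \geq (r/p)^n \lambda(y)$ for $y$ stable.
  In a stable presentation the first term of maximal weight dominates all earlier ones, which yields the
  formula for $H(u,r)$. Iterating $[x_0] + \varpi x_1 \mapsto [x_0] + [u] x_1$ makes every element, modulo $\pi$,
  stable or as small as desired. So every $x$ with $H(u,r)(x) > 0$ has a leading term $\pi^n y$ with $y$ stable,
  and multiplicativity follows as products of stable elements are stable.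

  Unique Teichmueller expansions come from a form of flatness of $W(\mathcal{O}_L)$ over $W(\mathbb{F}_q)$: modulo
  $p^n$, the Teichmueller lifts of an $\mathbb{F}_q$-basis of $\mathcal{O}_L$ are a basis of $W(\mathcal{O}_L)$.\<close>

section \<open>Witt vectors\<close>

text \<open>The Witt addition polynomials are known only through their ghost components, so carries
  are never computed. They are controlled by Teichmueller factors, which act on expansions
  coefficientwise: an element whose first k coefficients are bounded by |a| is a multiple of [a]
  modulo the k-th power of the uniformizer, and a sum of two such multiples is again one. The bound
  |u| <= 1/p makes the replacement of the uniformizer by [u] harmless: the factor |u| pays for the
  shift of the weights p^-i by one index. In the limiting case |u| = 1/p both coefficients of pi
  have the same weight, which is why the last index of the maximum is recorded. The bound r <= 1
  enters when a factor pi is removed from a polynomial representation: the constant term is then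
  divided by pi, which multiplies its norm by p, and is moved to a coefficient of weight r/p. The
  tensor product is a quotient of a huge free group, in which even the cancellation of the
  uniformizer is not evident. Functionals with values in E, additive only up to a high power of the
  uniformizer, bound the order of an element from above, and this is carried over to the
  completion.\<close>

definition lin_ext :: "('k \<Rightarrow> 'a::comm_ring_1) \<Rightarrow> ('k \<Rightarrow>\<^sub>0 int) \<Rightarrow> 'a" where
  "lin_ext g P = (\<Sum>k\<in>Poly_Mapping.keys P. of_int (Poly_Mapping.lookup P k) * g k)"

lemma lin_ext_eq:
  assumes "finite S" "Poly_Mapping.keys P \<subseteq> S"
  shows "lin_ext g P = (\<Sum>k\<in>S. of_int (Poly_Mapping.lookup P k) * g k)"
  unfolding lin_ext_def by (rule sum.mono_neutral_left) (use assms in \<open>auto simp: in_keys_iff\<close>)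

lemma lin_ext_zero [simp]: "lin_ext g 0 = 0"
  by (simp add: lin_ext_def)

lemma lin_ext_frag_of [simp]: "lin_ext g (frag_of k) = g k"
  by (simp add: lin_ext_def)

lemma lin_ext_diff [simp]: "lin_ext g (P - Q) = lin_ext g P - lin_ext g Q"
proof -
  define S where "S = Poly_Mapping.keys P \<union> Poly_Mapping.keys Q"
  have "finite S" "Poly_Mapping.keys P \<subseteq> S" "Poly_Mapping.keys Q \<subseteq> S" "Poly_Mapping.keys (P - Q) \<subseteq> S"
    using keys_diff[of P Q] by (auto simp: S_def)
  then show ?thesis
    by (simp add: lin_ext_eq[of S] lookup_minus left_diff_distrib sum_subtractf)
qed

lemma lin_ext_minus [simp]: "lin_ext g (- P) = - lin_ext g P"
  using lin_ext_diff[of g 0 P] by simp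

lemma lin_ext_add [simp]: "lin_ext g (P + Q) = lin_ext g P + lin_ext g Q"
  using lin_ext_diff[of g P "- Q"] by simp

lemma frag_induct [case_names zero one diff]:
  assumes "P 0" "\<And>k. P (frag_of k)" "\<And>a b. P a \<Longrightarrow> P b \<Longrightarrow> P (a - b)"
  shows "P (c :: 'k \<Rightarrow>\<^sub>0 int)"
  by (rule frag_induction[of c UNIV]) (use assms in auto)

definition mp_mon :: "('v \<Rightarrow> 'a::comm_ring_1) \<Rightarrow> ('v \<Rightarrow>\<^sub>0 nat) \<Rightarrow> 'a" where
  "mp_mon f m = (\<Prod>v\<in>Poly_Mapping.keys m. f v ^ Poly_Mapping.lookup m v)"

text \<open>The variables have arbitrary type because identities over a ring are lifted to a
  polynomial ring with one variable for each ring element. Evaluation is built on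
  \<open>lin_ext\<close>, which later also extends a functional from pairs to the monoid
  ring.\<close>

type_synonym 'v mpoly = "('v \<Rightarrow>\<^sub>0 nat) \<Rightarrow>\<^sub>0 int"

definition mp_eval :: "('v \<Rightarrow> 'a::comm_ring_1) \<Rightarrow> 'v mpoly \<Rightarrow> 'a" where
  "mp_eval f = lin_ext (mp_mon f)"

definition mp_var :: "'v \<Rightarrow> 'v mpoly" where
  "mp_var v = frag_of (Poly_Mapping.single v 1)"

lemma mp_mon_eq:
  assumes "finite S" "Poly_Mapping.keys m \<subseteq> S"
  shows "mp_mon f m = (\<Prod>k\<in>S. f k ^ Poly_Mapping.lookup m k)"
  unfolding mp_mon_def by (rule prod.mono_neutral_left) (use assms in \<open>auto simp: in_keys_iff\<close>)

lemma mp_mon_add: "mp_mon f (a + b) = mp_mon f a * mp_mon f b"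
proof -
  define S where "S = Poly_Mapping.keys a \<union> Poly_Mapping.keys b"
  have "finite S" "Poly_Mapping.keys a \<subseteq> S" "Poly_Mapping.keys b \<subseteq> S" "Poly_Mapping.keys (a + b) \<subseteq> S"
    using Poly_Mapping.keys_add[of a b] by (auto simp: S_def)
  then show ?thesis
    by (simp add: mp_mon_eq[of S] lookup_add power_add prod.distrib)
qed

lemma zpoly_eval_eq: "zpoly_eval = mp_eval"
  by (rule ext, rule ext) (simp add: zpoly_eval_def mp_eval_def lin_ext_def mp_mon_def)

lemma zvar_eq: "zvar = mp_var"
  by (rule ext) (simp add: zvar_def mp_var_def)

lemma one_eq_frag_of: "(1 :: 'v mpoly) = frag_of 0"
  by simp

lemma frag_of_mult: "(frag_of a :: 'v mpoly) * frag_of b = frag_of (a + b)"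
  by (simp add: mult_single)

section \<open>Ring homomorphisms and the evaluation of polynomials\<close>

definition is_hom :: "('a::comm_ring_1 \<Rightarrow> 'b::comm_ring_1) \<Rightarrow> bool" where
  "is_hom h \<longleftrightarrow> h 1 = 1 \<and> (\<forall>x y. h (x - y) = h x - h y) \<and> (\<forall>x y. h (x * y) = h x * h y)"

lemma is_homD:
  assumes "is_hom h"
  shows "h 1 = 1" "h (x - y) = h x - h y" "h (x * y) = h x * h y"
    "h 0 = 0" "h (- x) = - h x" "h (x + y) = h x + h y"
proof -
  show *: "h 1 = 1" "h (x - y) = h x - h y" "h (x * y) = h x * h y" for x y
    using assms by (auto simp: is_hom_def)
  show 0: "h 0 = 0" using *(2)[of 0 0] by simp
  show m: "h (- x) = - h x" for x using *(2)[of 0 x] 0 by simp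
  show "h (x + y) = h x + h y" using *(2)[of x "- y"] m[of y] by simp
qed

lemma is_hom_sum: "is_hom h \<Longrightarrow> h (sum f S) = (\<Sum>i\<in>S. h (f i))"
  by (induction S rule: infinite_finite_induct) (simp_all add: is_homD)

lemma is_hom_prod: "is_hom h \<Longrightarrow> h (prod f S) = (\<Prod>i\<in>S. h (f i))"
  by (induction S rule: infinite_finite_induct) (simp_all add: is_homD)

lemma is_hom_power: "is_hom h \<Longrightarrow> h (x ^ n) = h x ^ n"
  by (induction n) (simp_all add: is_homD)

lemma is_hom_of_nat: "is_hom h \<Longrightarrow> h (of_nat n) = of_nat n"
  by (induction n) (simp_all add: is_homD)

lemma is_hom_of_int: "is_hom h \<Longrightarrow> h (of_int n) = of_int n"
  by (cases n) (simp_all add: is_homD is_hom_of_nat)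

lemma is_hom_mp_eval: "is_hom (mp_eval f)"
  unfolding is_hom_def
proof (intro conjI allI)
  show "mp_eval f 1 = 1"
    unfolding one_eq_frag_of mp_eval_def lin_ext_frag_of by (simp add: mp_mon_def)
  show "mp_eval f (x - y) = mp_eval f x - mp_eval f y" for x y
    by (simp add: mp_eval_def)
  show "mp_eval f (x * y) = mp_eval f x * mp_eval f y" for x y
  proof (induction x rule: frag_induct)
    case zero then show ?case by (simp add: mp_eval_def)
  next
    case (one k)
    show ?case
      by (induction y rule: frag_induct)
        (simp_all add: mp_eval_def frag_of_mult mp_mon_add right_diff_distrib)
  next
    case (diff a b)
    then show ?case by (simp add: mp_eval_def left_diff_distrib)
  qed
qed

lemma mp_eval_var [simp]: "mp_eval f (mp_var v) = f v"
  by (simp add: mp_eval_def mp_var_def mp_mon_def)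

lemma hom_mp_eval: "is_hom h \<Longrightarrow> h (mp_eval f P) = mp_eval (h \<circ> f) P"
  by (simp add: mp_eval_def lin_ext_def mp_mon_def is_hom_sum is_hom_prod is_homD is_hom_of_int is_hom_power)

lemma mpoly_torsion_free:
  assumes "n > 0" "(of_nat n :: 'v mpoly) * x = 0" shows "x = 0"
proof -
  have "of_nat n * x = frag_cmul (int n) x" for x :: "'v mpoly"
    by (induction n) (simp_all add: algebra_simps frag_cmul_distrib)
  then show ?thesis using assms by simp
qed

subsection \<open>Frobenius lifts and Dwork's lemma\<close>

lemma mp_mon_var: "mp_mon mp_var m = frag_of m"
proof -
  have pw: "mp_var v ^ k = frag_of (Poly_Mapping.single v k)" for v :: 'v and k
    by (induction k)
      (simp_all add: one_eq_frag_of[symmetric] mp_var_def frag_of_mult single_add[symmetric])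
  have fs: "finite S \<Longrightarrow> (\<Prod>v\<in>S. frag_of (g v)) = (frag_of (sum g S) :: 'v mpoly)" for S and g :: "'v \<Rightarrow> _"
    by (induction S rule: finite_induct) (simp_all add: frag_of_mult one_eq_frag_of[symmetric])
  have "sum (\<lambda>v. Poly_Mapping.single v (Poly_Mapping.lookup m v)) (Poly_Mapping.keys m) = m"
    by (rule poly_mapping_eqI)
      (simp add: lookup_sum lookup_single when_def sum.delta in_keys_iff)
  then show ?thesis by (simp add: mp_mon_def pw fs)
qed

definition frob :: "nat \<Rightarrow> 'v mpoly \<Rightarrow> 'v mpoly" where
  "frob p = mp_eval (\<lambda>v. mp_var v ^ p)"

lemma prime_dvd_add_power:
  fixes a b :: "'a::comm_ring_1"
  assumes "prime p"
  shows "of_nat p dvd (a + b) ^ p - (a ^ p + b ^ p)"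
proof -
  have p: "p > 0" using assms by (simp add: prime_gt_0_nat)
  have "(a + b) ^ p = (\<Sum>k\<le>p. of_nat (p choose k) * a ^ k * b ^ (p - k))"
    by (rule binomial_ring)
  also have "{..p} = insert 0 (insert p {0<..<p})" using p by auto
  finally have "(a + b) ^ p - (a ^ p + b ^ p) = (\<Sum>k\<in>{0<..<p}. of_nat (p choose k) * a ^ k * b ^ (p - k))"
    using p by simp
  moreover have "of_nat p dvd (of_nat (p choose k) * a ^ k * b ^ (p - k) :: 'a)" if "k \<in> {0<..<p}" for k
  proof -
    have "p dvd p choose k" using that assms by (intro dvd_choose_prime) auto
    then have "of_nat p dvd (of_nat (p choose k) :: 'a)" by (metis dvd_def of_nat_mult)
    then show ?thesis by (simp add: mult.assoc)
  qed
  ultimately show ?thesis by (auto intro!: dvd_sum)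
qed

text \<open>On a monomial, \<open>frob\<close> is the p-th power itself; both sides are additive
  modulo p, so additive generators suffice.\<close>

lemma frob_lift:
  assumes "prime p" shows "of_nat p dvd (x ^ p - frob p x)"
proof (induction x rule: frag_induct)
  case zero
  then show ?case using assms by (simp add: frob_def mp_eval_def prime_gt_0_nat zero_power)
next
  case (one k)
  have "frob p (frag_of k) = mp_mon (\<lambda>v. mp_var v ^ p) k" by (simp add: frob_def mp_eval_def)
  also have "\<dots> = mp_mon mp_var k ^ p"
    by (simp add: mp_mon_def prod_power_distrib power_mult[symmetric] mult.commute)
  finally show ?case by (simp add: mp_mon_var)
next
  case (diff a b)
  \<comment> \<open>Additivity modulo p is applied to a = (a - b) + b, which avoids treating the
    sign of (- b)^p separately for p = 2.\<close>
  have "(a - b) ^ p - frob p (a - b) = (a ^ p - frob p a) - (b ^ p - frob p b) - (((a - b) + b) ^ p - ((a - b) ^ p + b ^ p))"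
    by (simp add: frob_def is_homD[OF is_hom_mp_eval])
  then show ?case using diff prime_dvd_add_power[OF assms, of "a - b" b] by (metis dvd_diff)
qed

text \<open>In the factorization of a^p - b^p by a - b, the cofactor is congruent to p * b^(p-1),
  hence to 0, modulo p. This gains one more factor p.\<close>

lemma dvd_diff_power_Suc:
  fixes a b :: "'a::comm_ring_1"
  assumes "of_nat p ^ Suc m dvd a - b"
  shows "of_nat p ^ Suc (Suc m) dvd a ^ p - b ^ p"
proof -
  have 1: "of_nat p dvd a - b" using assms dvd_trans[OF dvd_triv_left[of "of_nat p"]] by (simp only: power_Suc)
  have "a - b dvd a ^ i - b ^ i" for i by (simp add: power_diff_sumr2)
  then have 2: "of_nat p dvd a ^ i - b ^ i" for i using 1 dvd_trans by blast
  have "(\<Sum>i<p. b ^ (p - Suc i) * a ^ i) = (\<Sum>i<p. b ^ (p - Suc i) * (a ^ i - b ^ i)) + of_nat p * b ^ (p - 1)"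
  proof -
    have "(\<Sum>i<p. b ^ (p - Suc i) * b ^ i) = (\<Sum>i<p. b ^ (p - 1))"
      by (rule sum.cong) (auto simp: power_add[symmetric])
    then show ?thesis by (simp add: right_diff_distrib sum_subtractf)
  qed
  moreover have "of_nat p dvd (\<Sum>i<p. b ^ (p - Suc i) * (a ^ i - b ^ i))"
    by (intro dvd_sum dvd_mult 2)
  ultimately have "of_nat p dvd (\<Sum>i<p. b ^ (p - Suc i) * a ^ i)" by simp
  then have "of_nat p ^ Suc m * of_nat p dvd (a - b) * (\<Sum>i<p. b ^ (p - Suc i) * a ^ i)"
    by (intro mult_dvd_mono assms)
  moreover have "a ^ p - b ^ p = (a - b) * (\<Sum>i<p. b ^ (p - Suc i) * a ^ i)"
    by (rule power_diff_sumr2)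
  ultimately show ?thesis by (simp add: mult.commute)
qed

lemma dvd_diff_power_pow:
  fixes a b :: "'a::comm_ring_1"
  assumes "of_nat p dvd a - b"
  shows "of_nat p ^ Suc k dvd a ^ (p ^ k) - b ^ (p ^ k)"
proof (induction k)
  case (Suc k)
  from dvd_diff_power_Suc[OF this] show ?case by (simp add: power_mult[symmetric] mult.commute)
qed (use assms in simp)

lemma ghost_Suc: "ghost p x (Suc n) = ghost p (\<lambda>i. x i ^ p) n + of_nat p ^ Suc n * x (Suc n)"
  by (auto simp: ghost_def Suc_diff_le power_mult[symmetric] intro!: sum.cong)

lemma ghost_0 [simp]: "ghost p x 0 = x 0"
  by (simp add: ghost_def)

text \<open>\<open>ghost_Suc\<close> splits off the last component and drives the inductions behind
  Dwork's lemma; this recursion splits off the first one and fits Teichmueller lifts and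
  Verschiebung.\<close>

lemma ghost_Suc': "ghost p x (Suc n) = x 0 ^ (p ^ Suc n) + of_nat p * ghost p (\<lambda>i. x (Suc i)) n"
  by (simp add: ghost_def sum.atMost_Suc_shift sum_distrib_left mult.assoc del: sum.atMost_Suc)

lemma ghost_cong: "(\<And>i. i \<le> n \<Longrightarrow> x i = y i) \<Longrightarrow> ghost p x n = ghost p y n"
  by (simp add: ghost_def)

lemma hom_ghost: "is_hom h \<Longrightarrow> h (ghost p x n) = ghost p (h \<circ> x) n"
  by (simp add: ghost_def is_hom_sum is_homD is_hom_power is_hom_of_nat)

text \<open>The term of index i carries p^i, and raising to the power p^(n-i) improves a congruence
  modulo p to one modulo p^(n-i+1).\<close>

lemma ghost_dvd:
  fixes x y :: "nat \<Rightarrow> 'a::comm_ring_1"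
  assumes "\<And>i. i \<le> n \<Longrightarrow> of_nat p dvd x i - y i"
  shows "of_nat p ^ Suc n dvd ghost p x n - ghost p y n"
proof -
  have "ghost p x n - ghost p y n = (\<Sum>i\<le>n. of_nat p ^ i * (x i ^ p ^ (n - i) - y i ^ p ^ (n - i)))"
    by (simp add: ghost_def sum_subtractf right_diff_distrib)
  moreover have "of_nat p ^ Suc n dvd of_nat p ^ i * (x i ^ p ^ (n - i) - y i ^ p ^ (n - i))" if "i \<le> n" for i
  proof -
    have "of_nat p ^ i * of_nat p ^ Suc (n - i) dvd of_nat p ^ i * (x i ^ p ^ (n - i) - y i ^ p ^ (n - i))"
      by (intro mult_dvd_mono dvd_diff_power_pow assms that dvd_refl)
    moreover have "of_nat p ^ i * of_nat p ^ Suc (n - i) = (of_nat p ^ Suc n :: 'a)"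
      using that by (simp add: power_add[symmetric] del: power_Suc)
    ultimately show ?thesis by simp
  qed
  ultimately show ?thesis by (auto intro!: dvd_sum simp del: power_Suc)
qed

definition torsion_free :: "nat \<Rightarrow> 'a::comm_ring_1 itself \<Rightarrow> bool" where
  "torsion_free p _ \<longleftrightarrow> (\<forall>x::'a. of_nat p * x = 0 \<longrightarrow> x = 0)"

lemma torsion_free_power:
  fixes x :: "'a::comm_ring_1"
  assumes "torsion_free p TYPE('a)" "of_nat p ^ n * x = of_nat p ^ n * y" shows "x = y"
proof -
  have "of_nat p ^ n * z = 0 \<Longrightarrow> z = 0" for z :: 'a
    using assms(1) by (induction n) (auto simp: torsion_free_def mult.assoc)
  from this[of "x - y"] show ?thesis using assms(2) by (simp add: right_diff_distrib)
qed

lemma ghost_inj_upto: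
  fixes x y :: "nat \<Rightarrow> 'a::comm_ring_1"
  assumes "torsion_free p TYPE('a)" "\<And>k. k \<le> n \<Longrightarrow> ghost p x k = ghost p y k"
  shows "k \<le> n \<Longrightarrow> x k = y k"
proof (induction k rule: less_induct)
  case (less k)
  show ?case
  proof (cases k)
    case 0 then show ?thesis using assms(2)[of 0] by simp
  next
    case (Suc m)
    have "ghost p (\<lambda>i. x i ^ p) m = ghost p (\<lambda>i. y i ^ p) m"
      using less Suc by (intro ghost_cong) auto
    then have "of_nat p ^ k * x k = of_nat p ^ k * y k"
      using assms(2)[of k] less.prems by (simp add: Suc ghost_Suc del: power_Suc)
    then show ?thesis using torsion_free_power assms(1) by blast
  qed
qed

lemma ghost_inj:
  fixes x y :: "nat \<Rightarrow> 'a::comm_ring_1"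
  assumes "torsion_free p TYPE('a)" "\<And>k. ghost p x k = ghost p y k"
  shows "x = y"
  using ghost_inj_upto[OF assms(1), of _ x y] assms(2) by blast

text \<open>A converse of \<open>ghost_dvd\<close>: once the lower components agree modulo p, their
  contribution to the k-th ghost component agrees modulo p^(k+1), and what remains is p^k times the
  difference of the k-th components.\<close>

lemma ghost_dvd_coeff:
  fixes x y :: "nat \<Rightarrow> 'a::comm_ring_1"
  assumes "torsion_free p TYPE('a)" "\<And>k. of_nat p ^ Suc k dvd ghost p x k - ghost p y k"
  shows "of_nat p dvd x k - y k"
proof (induction k rule: less_induct)
  case (less k)
  show ?case
  proof (cases k)
    case 0 then show ?thesis using assms(2)[of 0] by simp
  next
    case (Suc m)
    have "of_nat p ^ Suc (Suc m) dvd ghost p (\<lambda>i. x i ^ p) m - ghost p (\<lambda>i. y i ^ p) m"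
    proof -
      \<comment> \<open>Truncation gives vectors that agree modulo p at every index, so
        \<open>ghost_dvd\<close> applies at index m + 1 and yields the exponent m + 2; applied
        directly to the p-th powers at index m it would only be given congruences modulo p.\<close>
      define x' where "x' i = (if i \<le> m then x i else 0)" for i
      define y' where "y' i = (if i \<le> m then y i else 0)" for i
      have "of_nat p ^ Suc (Suc m) dvd ghost p x' (Suc m) - ghost p y' (Suc m)"
        by (rule ghost_dvd) (use less Suc in \<open>auto simp: x'_def y'_def\<close>)
      moreover have "ghost p x' (Suc m) = ghost p (\<lambda>i. x i ^ p) m"
        by (simp add: ghost_Suc x'_def cong: ghost_cong)
      moreover have "ghost p y' (Suc m) = ghost p (\<lambda>i. y i ^ p) m"
        by (simp add: ghost_Suc y'_def cong: ghost_cong)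
      ultimately show ?thesis by simp
    qed
    moreover have "of_nat p ^ k * (x k - y k) =
        (ghost p x k - ghost p y k) - (ghost p (\<lambda>i. x i ^ p) m - ghost p (\<lambda>i. y i ^ p) m)"
      by (simp add: Suc ghost_Suc algebra_simps)
    ultimately have "of_nat p ^ Suc k dvd of_nat p ^ k * (x k - y k)"
      using assms(2)[of k] by (simp only: Suc) (rule dvd_diff)
    then obtain c where "of_nat p ^ k * (x k - y k) = of_nat p ^ k * (of_nat p * c)"
      by (auto simp: dvd_def mult_ac)
    then show ?thesis using torsion_free_power[OF assms(1)] by (metis dvd_triv_left)
  qed
qed

text \<open>The components are found one by one: since x^p is congruent to s x, the congruence for g
  says that p^(n+1) divides what the known components leave over in g (n+1), and the quotient is the
  next component.\<close>

lemma dwork: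
  fixes s :: "'a::comm_ring_1 \<Rightarrow> 'a" and g :: "nat \<Rightarrow> 'a"
  assumes tf: "torsion_free p TYPE('a)" and hom: "is_hom s" and lift: "\<And>x. of_nat p dvd x ^ p - s x"
    and g: "\<And>n. of_nat p ^ Suc n dvd g (Suc n) - s (g n)"
  shows "\<exists>x. \<forall>n. ghost p x n = g n"
proof -
  have "\<exists>x. \<forall>k\<le>n. ghost p x k = g k" for n
  proof (induction n)
    case 0
    show ?case by (rule exI[of _ "\<lambda>_. g 0"]) simp
  next
    case (Suc n)
    then obtain x where x: "\<And>k. k \<le> n \<Longrightarrow> ghost p x k = g k" by blast
    have "of_nat p ^ Suc n dvd ghost p (\<lambda>i. x i ^ p) n - ghost p (s \<circ> x) n"
      by (rule ghost_dvd) (simp add: lift)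
    moreover have "ghost p (s \<circ> x) n = s (g n)"
      using hom_ghost[OF hom, of p x n] x[of n] by simp
    ultimately have "of_nat p ^ Suc n dvd (g (Suc n) - s (g n)) - (ghost p (\<lambda>i. x i ^ p) n - s (g n))"
      using g[of n] by (metis dvd_diff)
    then obtain c where c: "g (Suc n) - ghost p (\<lambda>i. x i ^ p) n = of_nat p ^ Suc n * c"
      by (auto simp: dvd_def)
    define y where "y = x(Suc n := c)"
    have "ghost p y k = g k" if "k \<le> Suc n" for k
    proof (cases "k = Suc n")
      case True
      have "ghost p (\<lambda>i. y i ^ p) n = ghost p (\<lambda>i. x i ^ p) n"
        by (rule ghost_cong) (simp add: y_def)
      then show ?thesis using c by (simp add: True ghost_Suc y_def algebra_simps)
    next
      case False
      then have "ghost p y k = ghost p x k" using that by (intro ghost_cong) (auto simp: y_def)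
      then show ?thesis using x False that by simp
    qed
    then show ?case by blast
  qed
  \<comment> \<open>The finite solutions are chosen independently for each n; uniqueness of
    components makes them agree, so the diagonal solves all equations at once.\<close>
  then obtain X where X: "\<And>n k. k \<le> n \<Longrightarrow> ghost p (X n) k = g k" using choice[of "\<lambda>n x. \<forall>k\<le>n. ghost p x k = g k"] by blast
  have diag: "X n k = X k k" if "k \<le> n" for n k
    by (rule ghost_inj_upto[OF tf, of k]) (use X that in auto)
  have "ghost p (\<lambda>k. X k k) n = ghost p (X n) n" for n
    by (intro ghost_cong) (rule diag[symmetric])
  then show ?thesis using X by (intro exI[of _ "\<lambda>k. X k k"]) simp
qed

subsection \<open>The ring of Witt vectors\<close>

definition wadd :: "nat \<Rightarrow> (nat \<Rightarrow> 'a::comm_ring_1) \<Rightarrow> (nat \<Rightarrow> 'a) \<Rightarrow> nat \<Rightarrow> 'a" where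
  "wadd p x y = mp_eval (case_sum x y) \<circ> witt_sum_poly p"

definition wmul :: "nat \<Rightarrow> (nat \<Rightarrow> 'a::comm_ring_1) \<Rightarrow> (nat \<Rightarrow> 'a) \<Rightarrow> nat \<Rightarrow> 'a" where
  "wmul p x y = mp_eval (case_sum x y) \<circ> witt_prod_poly p"

lemma mpoly_tf: "prime p \<Longrightarrow> torsion_free p TYPE('v mpoly)"
  using mpoly_torsion_free[of p] by (auto simp: torsion_free_def prime_gt_0_nat)

text \<open>Ghost vectors satisfy the congruence that \<open>dwork\<close> asks for. Since that
  congruence is stable under ring operations, ghost vectors over polynomial rings are closed under
  them.\<close>

lemma frob_ghost:
  assumes "prime p" shows "of_nat p ^ Suc n dvd ghost p x (Suc n) - frob p (ghost p x n)"
proof -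
  have h: "is_hom (frob p)" unfolding frob_def by (rule is_hom_mp_eval)
  have "of_nat p ^ Suc n dvd ghost p (\<lambda>i. x i ^ p) n - ghost p (frob p \<circ> x) n"
    by (rule ghost_dvd) (simp add: frob_lift[OF assms])
  then have "of_nat p ^ Suc n dvd ghost p (\<lambda>i. x i ^ p) n - ghost p (frob p \<circ> x) n + of_nat p ^ Suc n * x (Suc n)"
    by (intro dvd_add dvd_triv_left)
  then show ?thesis by (simp add: ghost_Suc hom_ghost[OF h] algebra_simps)
qed

text \<open>The sum and the product justify the descriptions of the Witt polynomials as unique
  solutions; the negative supplies the additive inverses, for which there is no defining
  polynomial.\<close>

lemma ex_ghost_combination:
  fixes x y :: "nat \<Rightarrow> 'v mpoly"
  assumes p: "prime p"
  shows "\<exists>z. \<forall>n. ghost p z n = ghost p x n + ghost p y n"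
    and "\<exists>z. \<forall>n. ghost p z n = ghost p x n * ghost p y n"
    and "\<exists>z. \<forall>n. ghost p z n = - ghost p x n"
proof -
  have h: "is_hom (frob p)" unfolding frob_def by (rule is_hom_mp_eval)
  note hs = is_homD[OF h]
  have d: "of_nat p ^ Suc n dvd ghost p x (Suc n) - frob p (ghost p x n)" for n and x :: "nat \<Rightarrow> 'v mpoly"
    by (rule frob_ghost[OF p])
  note dw = dwork[OF mpoly_tf[OF p] h frob_lift[OF p]]
  show "\<exists>z. \<forall>n. ghost p z n = ghost p x n + ghost p y n"
  proof (rule dw)
    fix n
    show "of_nat p ^ Suc n dvd ghost p x (Suc n) + ghost p y (Suc n) - frob p (ghost p x n + ghost p y n)"
      using dvd_add[OF d[of n x] d[of n y]] by (simp add: hs algebra_simps)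
  qed
  show "\<exists>z. \<forall>n. ghost p z n = ghost p x n * ghost p y n"
  proof (rule dw)
    fix n
    have "ghost p x (Suc n) * ghost p y (Suc n) - frob p (ghost p x n * ghost p y n) =
      (ghost p x (Suc n) - frob p (ghost p x n)) * ghost p y (Suc n) +
      frob p (ghost p x n) * (ghost p y (Suc n) - frob p (ghost p y n))"
      by (simp add: hs algebra_simps)
    then show "of_nat p ^ Suc n dvd ghost p x (Suc n) * ghost p y (Suc n) - frob p (ghost p x n * ghost p y n)"
      using d[of n x] d[of n y] by (metis dvd_add dvd_mult dvd_mult2)
  qed
  show "\<exists>z. \<forall>n. ghost p z n = - ghost p x n"
  proof (rule dw)
    fix n
    show "of_nat p ^ Suc n dvd - ghost p x (Suc n) - frob p (- ghost p x n)"
      using dvd_minus_iff[THEN iffD2, OF d[of n x]] by (simp add: hs)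
  qed
qed

lemma the_ghost:
  fixes g :: "nat \<Rightarrow> 'v mpoly"
  assumes p: "prime p" and "\<exists>z. \<forall>n. ghost p z n = g n"
  shows "ghost p (THE z. \<forall>n. ghost p z n = g n) n = g n"
proof -
  have "\<exists>!z. \<forall>n. ghost p z n = g n"
    by (rule ex_ex1I[OF assms(2)], rule ghost_inj[OF mpoly_tf[OF p]]) simp
  from theI'[OF this] show ?thesis by blast
qed

lemma ghost_wadd:
  assumes "prime p" shows "ghost p (wadd p x y) n = ghost p x n + ghost p y n"
proof -
  have h: "is_hom (mp_eval (case_sum x y))" by (rule is_hom_mp_eval)
  have "ghost p (witt_sum_poly p) n = ghost p (\<lambda>i. zvar (Inl i)) n + ghost p (\<lambda>i. zvar (Inr i)) n"
    unfolding witt_sum_poly_def by (intro the_ghost ex_ghost_combination assms)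
  then have "mp_eval (case_sum x y) (ghost p (witt_sum_poly p) n) =
    mp_eval (case_sum x y) (ghost p (\<lambda>i. zvar (Inl i)) n) + mp_eval (case_sum x y) (ghost p (\<lambda>i. zvar (Inr i)) n)"
    by (simp add: is_homD[OF h])
  then show ?thesis by (simp add: hom_ghost[OF h] wadd_def zvar_eq comp_def)
qed

lemma ghost_wmul:
  assumes "prime p" shows "ghost p (wmul p x y) n = ghost p x n * ghost p y n"
proof -
  have h: "is_hom (mp_eval (case_sum x y))" by (rule is_hom_mp_eval)
  have "ghost p (witt_prod_poly p) n = ghost p (\<lambda>i. zvar (Inl i)) n * ghost p (\<lambda>i. zvar (Inr i)) n"
    unfolding witt_prod_poly_def by (intro the_ghost ex_ghost_combination assms)
  then have "mp_eval (case_sum x y) (ghost p (witt_prod_poly p) n) =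
    mp_eval (case_sum x y) (ghost p (\<lambda>i. zvar (Inl i)) n) * mp_eval (case_sum x y) (ghost p (\<lambda>i. zvar (Inr i)) n)"
    by (simp add: is_homD[OF h])
  then show ?thesis by (simp add: hom_ghost[OF h] wmul_def zvar_eq comp_def)
qed

lemma hom_wadd: "is_hom h \<Longrightarrow> h \<circ> wadd p x y = wadd p (h \<circ> x) (h \<circ> y)"
  by (rule ext) (simp add: wadd_def hom_mp_eval comp_def sum.case_distrib[of h] cong: sum.case_cong)

lemma hom_wmul: "is_hom h \<Longrightarrow> h \<circ> wmul p x y = wmul p (h \<circ> x) (h \<circ> y)"
  by (rule ext) (simp add: wmul_def hom_mp_eval comp_def sum.case_distrib[of h] cong: sum.case_cong)

lemma ghost_teichmueller: "p > 0 \<Longrightarrow> ghost p (teichmueller a) n = a ^ (p ^ n)"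
  by (cases n) (simp_all add: ghost_Suc' teichmueller_def, simp add: ghost_def zero_power)

lemma ghost_zero: "p > 0 \<Longrightarrow> ghost p (\<lambda>n. 0) n = 0"
  by (simp add: ghost_def zero_power)

definition verschiebung :: "(nat \<Rightarrow> 'a::zero) \<Rightarrow> nat \<Rightarrow> 'a" where
  "verschiebung x = case_nat 0 x"

lemma ghost_verschiebung_0: "ghost p (verschiebung x) 0 = 0"
  by (simp add: verschiebung_def)

lemma ghost_verschiebung_Suc:
  "p > 0 \<Longrightarrow> ghost p (verschiebung x) (Suc n) = of_nat p * ghost p x n"
  by (simp add: ghost_Suc' verschiebung_def zero_power)

lemma hom_teichmueller: "is_hom h \<Longrightarrow> h \<circ> teichmueller a = teichmueller (h a)"
  by (rule ext) (simp add: teichmueller_def is_homD)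

lemma hom_verschiebung: "is_hom h \<Longrightarrow> h \<circ> verschiebung x = verschiebung (h \<circ> x)"
  by (rule ext) (simp add: verschiebung_def is_homD split: nat.split)

section \<open>Witt vectors over a subring\<close>

definition is_subring :: "'a::comm_ring_1 set \<Rightarrow> bool" where
  "is_subring A \<longleftrightarrow> 1 \<in> A \<and> (\<forall>x\<in>A. \<forall>y\<in>A. x - y \<in> A \<and> x * y \<in> A)"

lemma is_subringD:
  assumes "is_subring A"
  shows "1 \<in> A" "0 \<in> A" "x \<in> A \<Longrightarrow> y \<in> A \<Longrightarrow> x - y \<in> A" "x \<in> A \<Longrightarrow> - x \<in> A"
    "x \<in> A \<Longrightarrow> y \<in> A \<Longrightarrow> x + y \<in> A" "x \<in> A \<Longrightarrow> y \<in> A \<Longrightarrow> x * y \<in> A" "x \<in> A \<Longrightarrow> x ^ n \<in> A"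
proof -
  have 1: "1 \<in> A" "\<And>x y. x \<in> A \<Longrightarrow> y \<in> A \<Longrightarrow> x - y \<in> A" "\<And>x y. x \<in> A \<Longrightarrow> y \<in> A \<Longrightarrow> x * y \<in> A"
    using assms by (auto simp: is_subring_def)
  have 0: "0 \<in> A" using 1(2)[OF 1(1) 1(1)] by simp
  have m: "- x \<in> A" if "x \<in> A" for x using 1(2)[OF 0 that] by simp
  show "1 \<in> A" "0 \<in> A" "x \<in> A \<Longrightarrow> y \<in> A \<Longrightarrow> x - y \<in> A" "x \<in> A \<Longrightarrow> - x \<in> A"
    "x \<in> A \<Longrightarrow> y \<in> A \<Longrightarrow> x * y \<in> A" using 0 1 m by auto
  show "x \<in> A \<Longrightarrow> y \<in> A \<Longrightarrow> x + y \<in> A" using 1(2)[of x "- y"] m[of y] by simp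
  show "x \<in> A \<Longrightarrow> x ^ n \<in> A" by (induction n) (use 1 in auto)
qed

lemma subring_mp_eval:
  assumes A: "is_subring A" and f: "\<And>v. f v \<in> A" shows "mp_eval f P \<in> A"
proof (induction P rule: frag_induct)
  case (one k)
  have "finite S \<Longrightarrow> (\<Prod>v\<in>S. f v ^ g v) \<in> A" for S and g :: "_ \<Rightarrow> nat"
    by (induction S rule: finite_induct) (auto simp: is_subringD[OF A] f)
  then show ?case by (simp add: mp_eval_def mp_mon_def)
qed (simp_all add: mp_eval_def is_subringD[OF A])

lemma witt_ring_simps:
  "carrier (witt_ring p A) = {x. \<forall>n. x n \<in> A}"
  "mult (witt_ring p A) = wmul p" "add (witt_ring p A) = wadd p"
  "one (witt_ring p A) = teichmueller 1" "zero (witt_ring p A) = (\<lambda>n. 0)"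
  by (auto simp: witt_ring_def wmul_def wadd_def zpoly_eval_eq teichmueller_def fun_eq_iff)

lemma witt_closed:
  assumes A: "is_subring A" and x: "\<forall>n. x n \<in> A"
  shows "\<forall>n. y n \<in> A \<Longrightarrow> \<forall>n. wadd p x y n \<in> A" "\<forall>n. y n \<in> A \<Longrightarrow> \<forall>n. wmul p x y n \<in> A"
  using x by (auto simp: wadd_def wmul_def intro!: subring_mp_eval A split: sum.split)

lemma teichmueller_closed: "is_subring A \<Longrightarrow> a \<in> A \<Longrightarrow> \<forall>n. teichmueller a n \<in> A"
  by (auto simp: teichmueller_def is_subringD)

lemma verschiebung_closed: "is_subring A \<Longrightarrow> \<forall>n. x n \<in> A \<Longrightarrow> \<forall>n. verschiebung x n \<in> A"
  by (auto simp: verschiebung_def is_subringD split: nat.split)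

text \<open>Every Witt vector over the subring \<open>A\<close> is the image of one over a polynomial ring, where
  the ghost map is injective.\<close>

definition gen_hom :: "'a::comm_ring_1 set \<Rightarrow> 'a mpoly \<Rightarrow> 'a" where
  "gen_hom A = mp_eval (\<lambda>a. if a \<in> A then a else 0)"

lemma is_hom_gen: "is_hom (gen_hom A)"
  unfolding gen_hom_def by (rule is_hom_mp_eval)

lemma gen_lift: "\<forall>n. x n \<in> A \<Longrightarrow> \<exists>X. x = gen_hom A \<circ> X"
  by (rule exI[of _ "mp_var \<circ> x"], rule ext) (simp add: gen_hom_def)

definition perfect_subring :: "nat \<Rightarrow> 'a::comm_ring_1 set \<Rightarrow> bool" where
  "perfect_subring p A \<longleftrightarrow> is_subring A \<and> (\<forall>a\<in>A. \<exists>b\<in>A. b ^ p = a)"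

text \<open>In characteristic $p$ this is the Witt vector $p$; only its multiplication law is needed.\<close>

definition witt_p :: "nat \<Rightarrow> 'a::comm_ring_1" where
  "witt_p = verschiebung (teichmueller 1)"

lemma witt_p_closed: "is_subring A \<Longrightarrow> \<forall>n. witt_p n \<in> A"
  unfolding witt_p_def by (intro verschiebung_closed teichmueller_closed is_subringD)

lemma witt_p_0 [simp]: "witt_p 0 = 0"
  by (simp add: witt_p_def verschiebung_def)

context
  fixes p :: nat
  assumes p: "prime p"
begin

lemma wadd_0: "wadd p x y 0 = x 0 + y 0"
  using ghost_wadd[OF p, of x y 0] by simp

lemma wmul_0: "wmul p x y 0 = x 0 * y 0"
  using ghost_wmul[OF p, of x y 0] by simp

lemmas homs = hom_wadd hom_wmul hom_teichmueller hom_verschiebung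
lemmas ghosts = ghost_wadd[OF p] ghost_wmul[OF p] ghost_teichmueller[OF prime_gt_0_nat[OF p]]
  ghost_zero[OF prime_gt_0_nat[OF p]] ghost_verschiebung_0 ghost_verschiebung_Suc[OF prime_gt_0_nat[OF p]]

lemma lift_UNIV: "\<exists>X. x = gen_hom UNIV \<circ> X"
  by (rule gen_lift) simp

text \<open>The principle behind all ring laws below: an identity is checked on ghost components
  over a polynomial ring, where these determine a Witt vector, and is then transported by a
  homomorphism.\<close>

lemma witt_eqI:
  fixes X Y :: "nat \<Rightarrow> 'v mpoly"
  assumes "\<And>n. ghost p X n = ghost p Y n" shows "h \<circ> X = h \<circ> Y"
  using ghost_inj[OF mpoly_tf[OF p], of X Y] assms by simp

lemma wadd_assoc: "wadd p (wadd p x y) z = wadd p x (wadd p y z)"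
proof -
  obtain X Y Z where "x = gen_hom UNIV \<circ> X" "y = gen_hom UNIV \<circ> Y" "z = gen_hom UNIV \<circ> Z"
    using lift_UNIV by metis
  then show ?thesis
    by (simp add: homs[OF is_hom_gen, symmetric]) (rule witt_eqI, simp add: ghosts)
qed

lemma wadd_comm: "wadd p x y = wadd p y x"
proof -
  obtain X Y where "x = gen_hom UNIV \<circ> X" "y = gen_hom UNIV \<circ> Y"
    using lift_UNIV by metis
  then show ?thesis
    by (simp add: homs[OF is_hom_gen, symmetric]) (rule witt_eqI, simp add: ghosts)
qed

lemma wmul_assoc: "wmul p (wmul p x y) z = wmul p x (wmul p y z)"
proof -
  obtain X Y Z where "x = gen_hom UNIV \<circ> X" "y = gen_hom UNIV \<circ> Y" "z = gen_hom UNIV \<circ> Z"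
    using lift_UNIV by metis
  then show ?thesis
    by (simp add: homs[OF is_hom_gen, symmetric]) (rule witt_eqI, simp add: ghosts mult.assoc)
qed

lemma wmul_comm: "wmul p x y = wmul p y x"
proof -
  obtain X Y where "x = gen_hom UNIV \<circ> X" "y = gen_hom UNIV \<circ> Y"
    using lift_UNIV by metis
  then show ?thesis
    by (simp add: homs[OF is_hom_gen, symmetric]) (rule witt_eqI, simp add: ghosts)
qed

lemma wmul_wadd: "wmul p (wadd p x y) z = wadd p (wmul p x z) (wmul p y z)"
proof -
  obtain X Y Z where "x = gen_hom UNIV \<circ> X" "y = gen_hom UNIV \<circ> Y" "z = gen_hom UNIV \<circ> Z"
    using lift_UNIV by metis
  then show ?thesis
    by (simp add: homs[OF is_hom_gen, symmetric]) (rule witt_eqI, simp add: ghosts distrib_right)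
qed

lemma gen_zero: "(\<lambda>n. 0) = gen_hom A \<circ> (\<lambda>n. 0)"
  by (rule ext) (simp add: is_homD[OF is_hom_gen])

lemma wadd_zero: "wadd p (\<lambda>n. 0) x = x"
proof -
  obtain X where x: "x = gen_hom UNIV \<circ> X"
    using lift_UNIV by metis
  have "wadd p (gen_hom UNIV \<circ> (\<lambda>n. 0)) (gen_hom UNIV \<circ> X) = gen_hom UNIV \<circ> X"
    unfolding homs[OF is_hom_gen, symmetric] by (rule witt_eqI, simp add: ghosts)
  then show ?thesis by (simp only: x gen_zero[symmetric])
qed

lemma teichmueller_mult: "wmul p (teichmueller a) (teichmueller b) = teichmueller (a * b)"
proof -
  obtain a' b' where "a = gen_hom UNIV a'" "b = gen_hom UNIV b'"
    using lift_UNIV[of "\<lambda>_. a"] lift_UNIV[of "\<lambda>_. b"] by (metis comp_apply)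
  then show ?thesis
    by (simp add: homs[OF is_hom_gen, symmetric] is_homD[OF is_hom_gen, symmetric])
      (rule witt_eqI, simp add: ghosts power_mult_distrib)
qed

lemma wmul_one: "wmul p (teichmueller 1) x = x"
proof -
  obtain X where x: "x = gen_hom UNIV \<circ> X"
    using lift_UNIV by metis
  have 1: "teichmueller 1 = gen_hom UNIV \<circ> teichmueller 1"
    by (simp add: hom_teichmueller[OF is_hom_gen] is_homD[OF is_hom_gen])
  have "wmul p (gen_hom UNIV \<circ> teichmueller 1) (gen_hom UNIV \<circ> X) = gen_hom UNIV \<circ> X"
    unfolding homs(2)[OF is_hom_gen, symmetric] by (rule witt_eqI, simp add: ghosts)
  then show ?thesis by (simp only: x 1[symmetric])
qed

lemma teichmueller_verschiebung:
  "wadd p (teichmueller (x 0)) (verschiebung (\<lambda>n. x (Suc n))) = x"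
proof -
  obtain X where x: "x = gen_hom UNIV \<circ> X"
    using lift_UNIV by metis
  have *: "(\<lambda>n. (gen_hom UNIV \<circ> X) (Suc n)) = gen_hom UNIV \<circ> (\<lambda>n. X (Suc n))" by auto
  have "ghost p (wadd p (teichmueller (X 0)) (verschiebung (\<lambda>n. X (Suc n)))) n = ghost p X n" for n
  proof -
    have "ghost p (wadd p (teichmueller (X 0)) (verschiebung (\<lambda>n. X (Suc n)))) n =
      X 0 ^ p ^ n + ghost p (verschiebung (\<lambda>n. X (Suc n))) n"
      by (simp add: ghosts)
    also have "\<dots> = ghost p X n"
      by (cases n)
        (simp_all add: ghosts(6) ghost_Suc'[of p X] ghost_verschiebung_0[simplified] del: ghost_0 power_Suc,
         simp_all add: verschiebung_def)
    finally show ?thesis .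
  qed
  then show ?thesis unfolding x * comp_apply[of _ _ 0] homs[OF is_hom_gen, symmetric]
    by (rule witt_eqI)
qed

text \<open>Over the polynomial ring this is false, but the k-th ghost components of the two sides
  differ by p^(k+1) * X k for k > 0 and agree for k = 0. Hence the components agree modulo p, and p
  dies in the target ring.\<close>

lemma verschiebung_one_mult:
  fixes x :: "nat \<Rightarrow> 'a::comm_ring_1"
  assumes char: "of_nat p = (0::'a)"
  shows "wmul p (verschiebung (teichmueller 1)) x = verschiebung (\<lambda>n. x n ^ p)"
proof -
  obtain X where x: "x = gen_hom UNIV \<circ> X"
    using lift_UNIV by metis
  let ?h = "gen_hom UNIV :: 'a mpoly \<Rightarrow> 'a"
  note h = is_hom_gen[of "UNIV :: 'a set"]
  let ?a = "wmul p (verschiebung (teichmueller 1)) X" and ?b = "verschiebung (\<lambda>n. X n ^ p)"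
  have "of_nat p ^ Suc k dvd ghost p ?a k - ghost p ?b k" for k
  proof (cases k)
    case (Suc m)
    have "ghost p ?a (Suc m) - ghost p ?b (Suc m) =
        of_nat p * (ghost p X (Suc m) - ghost p (\<lambda>n. X n ^ p) m)"
      by (simp add: ghosts right_diff_distrib)
    also have "\<dots> = of_nat p ^ Suc (Suc m) * X (Suc m)"
      by (simp add: ghost_Suc)
    finally show ?thesis by (simp only: Suc dvd_triv_left)
  qed (simp add: wmul_0 verschiebung_def)
  then have d: "of_nat p dvd ?a k - ?b k" for k
    by (rule ghost_dvd_coeff[OF mpoly_tf[OF p]])
  have "?h (?a k - ?b k) = 0" for k
  proof -
    obtain c where "?a k - ?b k = of_nat p * c" using d by (rule dvdE)
    then show ?thesis by (simp only: is_homD(3)[OF h] is_hom_of_nat[OF h] char mult_zero_left)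
  qed
  then have "?h \<circ> ?a = ?h \<circ> ?b"
    by (simp only: is_homD(2)[OF h] fun_eq_iff comp_apply right_minus_eq simp_thms)
  moreover have "?h \<circ> (\<lambda>n. X n ^ p) = (\<lambda>n. x n ^ p)"
    by (simp add: x fun_eq_iff is_hom_power[OF h])
  ultimately show ?thesis
    by (simp add: homs[OF h] x is_homD[OF h])
qed

text \<open>The inverse is built over the polynomial ring and mapped down; since
  \<open>gen_hom A\<close> sends variables outside \<open>A\<close> to 0, its components stay in a
  subring \<open>A\<close>.\<close>

lemma ex_witt_neg:
  assumes "\<forall>n. x n \<in> A"
  shows "\<exists>Y. wadd p x (gen_hom A \<circ> Y) = (\<lambda>n. 0)"
proof -
  obtain X where x: "x = gen_hom A \<circ> X"
    using gen_lift[OF assms] by blast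
  obtain Y where Y: "\<And>n. ghost p Y n = - ghost p X n"
    using ex_ghost_combination(3)[OF p, of X] by blast
  have "wadd p x (gen_hom A \<circ> Y) = gen_hom A \<circ> wadd p X Y"
    by (simp add: x hom_wadd[OF is_hom_gen])
  also have "\<dots> = gen_hom A \<circ> (\<lambda>n. 0)"
    by (rule witt_eqI) (simp add: ghosts Y)
  finally show ?thesis by (auto simp: gen_zero[of A])
qed

lemma cring_witt_ring:
  assumes A: "is_subring A" shows "cring (witt_ring p A)"
proof (rule cringI)
  show "abelian_group (witt_ring p A)"
  proof (rule abelian_groupI)
    fix x assume "x \<in> carrier (witt_ring p A)"
    then obtain Y where Y: "wadd p x (gen_hom A \<circ> Y) = (\<lambda>n. 0)"
      using ex_witt_neg[of x A] by (auto simp: witt_ring_simps)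
    have "\<forall>n. (gen_hom A \<circ> Y) n \<in> A"
      by (auto simp: gen_hom_def intro!: subring_mp_eval A is_subringD)
    then show "\<exists>y\<in>carrier (witt_ring p A). y \<oplus>\<^bsub>witt_ring p A\<^esub> x = \<zero>\<^bsub>witt_ring p A\<^esub>"
      using Y by (intro bexI[of _ "gen_hom A \<circ> Y"]) (auto simp: wadd_comm witt_ring_simps)
  qed (use A in \<open>auto simp: witt_ring_simps wadd_assoc wadd_zero is_subringD witt_closed[rule_format] intro: wadd_comm\<close>)
  show "comm_monoid (witt_ring p A)"
    by (rule comm_monoidI)
      (use A in \<open>auto simp: witt_ring_simps wmul_assoc wmul_one is_subringD witt_closed[rule_format] teichmueller_closed intro: wmul_comm\<close>)
qed (auto simp: wmul_wadd witt_ring_simps)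

section \<open>Multiplication by p over perfect rings of characteristic p\<close>

lemma frobenius_inj:
  fixes x y :: "'a::field"
  assumes char: "of_nat p = (0::'a)" and "x ^ p = y ^ p" shows "x = y"
proof -
  have "((x - y) + y) ^ p = (x - y) ^ p + y ^ p"
    using prime_dvd_add_power[OF p, of "x - y" y] by (simp add: char)
  then show ?thesis using assms(2) by simp
qed

lemma witt_p_mult_Suc:
  fixes x :: "nat \<Rightarrow> 'a::comm_ring_1"
  assumes "of_nat p = (0::'a)" shows "wmul p witt_p x (Suc n) = x n ^ p"
  by (simp add: witt_p_def verschiebung_one_mult[OF assms], simp add: verschiebung_def)

lemma witt_p_cancel:
  fixes x y :: "nat \<Rightarrow> 'a::field"
  assumes char: "of_nat p = (0::'a)" and "wmul p witt_p x = wmul p witt_p y" shows "x = y"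
proof
  fix n
  have "x n ^ p = y n ^ p"
    using fun_cong[OF assms(2), of "Suc n"] by (simp add: witt_p_mult_Suc[OF char])
  then show "x n = y n" by (rule frobenius_inj[OF char])
qed

text \<open>Perfectness enters here: p shifts a vector and raises its components to the p-th power,
  so a shifted vector is p times the vector of p-th roots.\<close>

lemma ex_witt_p_mult:
  assumes A: "perfect_subring p A" and char: "of_nat p = (0::'a::comm_ring_1)"
    and x: "\<forall>n. x n \<in> (A :: 'a set)"
  shows "\<exists>y. (\<forall>n. y n \<in> A) \<and> wmul p witt_p y = verschiebung x"
proof -
  have "\<forall>n. \<exists>b. b \<in> A \<and> b ^ p = x n" using A x by (auto simp: perfect_subring_def)
  then obtain y where "\<And>n. y n \<in> A \<and> y n ^ p = x n" by metis
  then show ?thesis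
    by (intro exI[of _ y]) (auto simp: witt_p_def verschiebung_one_mult[OF char])
qed

lemma witt_decomp:
  assumes A: "perfect_subring p A" and char: "of_nat p = (0::'a::comm_ring_1)"
    and x: "\<forall>n. x n \<in> (A :: 'a set)"
  shows "\<exists>y. (\<forall>n. y n \<in> A) \<and> x = wadd p (teichmueller (x 0)) (wmul p witt_p y)"
proof -
  obtain y where "\<forall>n. y n \<in> A" "wmul p witt_p y = verschiebung (\<lambda>n. x (Suc n))"
    using ex_witt_p_mult[OF A char, of "\<lambda>n. x (Suc n)"] x by blast
  then show ?thesis
    using teichmueller_verschiebung[of x] by (intro exI[of _ y]) simp
qed

lemma witt_decomp_0:
  assumes A: "perfect_subring p A" and char: "of_nat p = (0::'a::comm_ring_1)"
    and x: "\<forall>n. x n \<in> (A :: 'a set)" and "x 0 = 0"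
  shows "\<exists>y. (\<forall>n. y n \<in> A) \<and> x = wmul p witt_p y"
proof -
  have "teichmueller (0::'a) = (\<lambda>n. 0)" by (auto simp: teichmueller_def)
  then show ?thesis using witt_decomp[OF A char x] assms(4) by (auto simp: wadd_zero)
qed

end

section \<open>Monoid rings and tensor products\<close>

lemma frag_extend_fun_diff: "frag_extend (\<lambda>x. g x - h x) f = frag_extend g f - frag_extend h f"
  by (induction f rule: frag_induct) (simp_all add: frag_extend_diff)

lemma frag_extend_fun_add: "frag_extend (\<lambda>x. g x + h x) f = frag_extend g f + frag_extend h f"
  by (induction f rule: frag_induct) (simp_all add: frag_extend_diff)

lemma frag_extend_fun_zero: "frag_extend (\<lambda>x. 0) f = 0"
  by (induction f rule: frag_induct) (simp_all add: frag_extend_diff)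

definition mr_mult :: "('m, 'x) monoid_scheme \<Rightarrow> ('m \<Rightarrow>\<^sub>0 int) \<Rightarrow> ('m \<Rightarrow>\<^sub>0 int) \<Rightarrow> ('m \<Rightarrow>\<^sub>0 int)" where
  "mr_mult M f g = frag_extend (\<lambda>x. frag_extend (\<lambda>y. frag_of (x \<otimes>\<^bsub>M\<^esub> y)) g) f"

lemma mr_mult_simps [simp]:
  "mr_mult M (frag_of x) (frag_of y) = frag_of (x \<otimes>\<^bsub>M\<^esub> y)"
  "mr_mult M (f - f') g = mr_mult M f g - mr_mult M f' g"
  "mr_mult M f (g - g') = mr_mult M f g - mr_mult M f g'"
  "mr_mult M 0 g = 0" "mr_mult M f 0 = 0"
  by (simp_all add: mr_mult_def frag_extend_diff frag_extend_fun_diff frag_extend_fun_zero)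

lemma mr_mult_add:
  "mr_mult M (f + f') g = mr_mult M f g + mr_mult M f' g"
  "mr_mult M f (g + g') = mr_mult M f g + mr_mult M f g'"
  by (simp_all add: mr_mult_def frag_extend_add frag_extend_fun_add)

lemma monoid_ring_simps [simp]:
  "carrier (monoid_ring M) = {f. Poly_Mapping.keys f \<subseteq> carrier M}"
  "mult (monoid_ring M) = mr_mult M" "one (monoid_ring M) = frag_of \<one>\<^bsub>M\<^esub>"
  "zero (monoid_ring M) = 0" "add (monoid_ring M) = (+)"
  by (simp_all add: monoid_ring_def mr_mult_def fun_eq_iff)

lemma mr_induct [consumes 1, case_names zero one diff]:
  assumes "Poly_Mapping.keys c \<subseteq> carrier M" "P 0" "\<And>x. x \<in> carrier M \<Longrightarrow> P (frag_of x)"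
    "\<And>a b. P a \<Longrightarrow> P b \<Longrightarrow> P (a - b)"
  shows "P c"
  by (rule frag_induction[OF assms(1)]) (use assms in auto)

lemma keys_add_subset:
  fixes a b :: "'m \<Rightarrow>\<^sub>0 int"
  assumes "Poly_Mapping.keys a \<subseteq> S" "Poly_Mapping.keys b \<subseteq> S"
  shows "Poly_Mapping.keys (a + b) \<subseteq> S" "Poly_Mapping.keys (a - b) \<subseteq> S"
  using assms keys_add[of a b] keys_diff[of a b] by auto

context comm_monoid
begin

abbreviation "MR \<equiv> monoid_ring G"

lemma mr_mult_closed:
  assumes "Poly_Mapping.keys f \<subseteq> carrier G" "Poly_Mapping.keys g \<subseteq> carrier G"
  shows "Poly_Mapping.keys (mr_mult G f g) \<subseteq> carrier G"
  using assms(1)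
proof (induction f rule: mr_induct)
  case (one x)
  from assms(2) show ?case
    by (induction g rule: mr_induct) (use one in \<open>simp_all add: keys_add_subset\<close>)
qed (simp_all add: keys_add_subset)

lemma mr_mult_comm:
  assumes "Poly_Mapping.keys f \<subseteq> carrier G" "Poly_Mapping.keys g \<subseteq> carrier G"
  shows "mr_mult G f g = mr_mult G g f"
  using assms(1)
proof (induction f rule: mr_induct)
  case (one x)
  from assms(2) show ?case
    by (induction g rule: mr_induct) (use one m_comm in auto)
qed auto

lemma mr_mult_assoc:
  assumes "Poly_Mapping.keys f \<subseteq> carrier G" "Poly_Mapping.keys g \<subseteq> carrier G" "Poly_Mapping.keys h \<subseteq> carrier G"
  shows "mr_mult G (mr_mult G f g) h = mr_mult G f (mr_mult G g h)"
  using assms(1)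
proof (induction f rule: mr_induct)
  case (one x)
  from assms(2) show ?case
  proof (induction g rule: mr_induct)
    case (one y)
    from assms(3) show ?case
      by (induction h rule: mr_induct) (use one \<open>x \<in> carrier G\<close> m_assoc in auto)
  qed auto
qed auto

lemma mr_mult_one: "Poly_Mapping.keys f \<subseteq> carrier G \<Longrightarrow> mr_mult G (frag_of \<one>) f = f"
  by (induction f rule: mr_induct) auto

lemma monoid_ring_cring: "cring MR"
proof (rule cringI)
  show "abelian_group MR"
  proof (rule abelian_groupI)
    fix f assume "f \<in> carrier MR"
    then show "\<exists>g\<in>carrier MR. g \<oplus>\<^bsub>MR\<^esub> f = \<zero>\<^bsub>MR\<^esub>"
      by (intro bexI[of _ "- f"]) auto
  qed (auto simp: keys_add_subset add.assoc add.commute)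
  show "comm_monoid MR"
    by (rule comm_monoidI) (auto simp: mr_mult_closed mr_mult_assoc mr_mult_one intro: mr_mult_comm)
qed (auto simp: mr_mult_add)

lemma monoid_ring_minus:
  assumes "f \<in> carrier MR" "g \<in> carrier MR" shows "f \<ominus>\<^bsub>MR\<^esub> g = f - g"
proof -
  interpret R: cring MR by (rule monoid_ring_cring)
  have "\<ominus>\<^bsub>MR\<^esub> g = - g" by (rule R.sum_zero_eq_neg[symmetric]) (use assms in auto)
  then show ?thesis by (simp add: R.minus_eq)
qed

end

subsection \<open>Tensor products\<close>

locale tensor =
  A: cring A + B: cring B + C: cring C
  for A :: "('a, 'x) ring_scheme" and B :: "('b, 'y) ring_scheme" and C :: "('c, 'z) ring_scheme" +
  fixes f :: "'a \<Rightarrow> 'b" and g :: "'a \<Rightarrow> 'c"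
  assumes f: "f \<in> ring_hom A B" and g: "g \<in> ring_hom A C"
begin

abbreviation "MM \<equiv> B \<times>\<times> C"
abbreviation "RR \<equiv> monoid_ring MM"
abbreviation "JJ \<equiv> tensor_ideal A B C f g"
abbreviation "TT \<equiv> tensor_ring A B C f g"
abbreviation "ten \<equiv> pure_tensor A B C f g"

lemma MM_comm_monoid: "comm_monoid MM"
  by (rule comm_monoidI) (auto simp: B.m_assoc C.m_assoc intro: B.m_comm C.m_comm)

sublocale M: comm_monoid MM by (rule MM_comm_monoid)

sublocale R: cring RR by (rule M.monoid_ring_cring)

lemma g_closed: "a \<in> carrier A \<Longrightarrow> g a \<in> carrier C"
  using g by (auto simp: ring_hom_def)

lemma f_closed: "a \<in> carrier A \<Longrightarrow> f a \<in> carrier B"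
  using f by (auto simp: ring_hom_def)

lemma rels_subset: "tensor_rels A B C f g \<subseteq> carrier RR"
proof
  fix h assume "h \<in> tensor_rels A B C f g"
  then have "Poly_Mapping.keys h \<subseteq> carrier B \<times> carrier C"
    unfolding tensor_rels_def
    by (elim UnE CollectE exE conjE; simp only:)
      (intro keys_add_subset(2); simp add: f_closed g_closed)+
  then show "h \<in> carrier RR" by simp
qed

lemma JJ_ideal: "ideal JJ RR"
  unfolding tensor_ideal_def by (rule R.genideal_ideal[OF rels_subset])

sublocale J: ideal JJ RR by (rule JJ_ideal)

lemma TT_cring: "cring TT"
  unfolding tensor_ring_def by (rule J.quotient_is_cring[OF R.is_cring])

lemma TT_hom: "(+>\<^bsub>RR\<^esub>) JJ \<in> ring_hom RR TT"
  unfolding tensor_ring_def by (rule J.rcos_ring_hom)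

lemma ten_eq: "ten b c = JJ +>\<^bsub>RR\<^esub> frag_of (b, c)"
  by (simp add: pure_tensor_def)

lemma frag_closed: "b \<in> carrier B \<Longrightarrow> c \<in> carrier C \<Longrightarrow> frag_of (b, c) \<in> carrier RR"
  by simp

lemma coset_eqI:
  assumes "x \<in> carrier RR" "y \<in> carrier RR" "x - y \<in> JJ"
  shows "JJ +>\<^bsub>RR\<^esub> x = JJ +>\<^bsub>RR\<^esub> y"
  using R.quotient_eq_iff_same_a_r_cos[OF JJ_ideal assms(1,2)] M.monoid_ring_minus[OF assms(1,2)] assms(3) by simp

lemma coset_eqD:
  assumes "x \<in> carrier RR" "y \<in> carrier RR" "JJ +>\<^bsub>RR\<^esub> x = JJ +>\<^bsub>RR\<^esub> y"
  shows "x - y \<in> JJ"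
  using R.quotient_eq_iff_same_a_r_cos[OF JJ_ideal assms(1,2)] M.monoid_ring_minus[OF assms(1,2)] assms(3) by simp

lemma rel_in_JJ: "x \<in> tensor_rels A B C f g \<Longrightarrow> x \<in> JJ"
  unfolding tensor_ideal_def using R.genideal_self[OF rels_subset] by blast

lemma rels_in_JJ:
  "b \<in> carrier B \<Longrightarrow> b' \<in> carrier B \<Longrightarrow> c \<in> carrier C \<Longrightarrow>
    frag_of (b \<oplus>\<^bsub>B\<^esub> b', c) - frag_of (b, c) - frag_of (b', c) \<in> JJ"
  "b \<in> carrier B \<Longrightarrow> c \<in> carrier C \<Longrightarrow> c' \<in> carrier C \<Longrightarrow>
    frag_of (b, c \<oplus>\<^bsub>C\<^esub> c') - frag_of (b, c) - frag_of (b, c') \<in> JJ"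
  "a \<in> carrier A \<Longrightarrow> b \<in> carrier B \<Longrightarrow> c \<in> carrier C \<Longrightarrow>
    frag_of (f a \<otimes>\<^bsub>B\<^esub> b, c) - frag_of (b, g a \<otimes>\<^bsub>C\<^esub> c) \<in> JJ"
  by (rule rel_in_JJ, unfold tensor_rels_def, blast)+

lemma ten_closed: "b \<in> carrier B \<Longrightarrow> c \<in> carrier C \<Longrightarrow> ten b c \<in> carrier TT"
  unfolding ten_eq using ring_hom_closed[OF TT_hom] frag_closed by blast

lemma ten_add_left:
  assumes "b \<in> carrier B" "b' \<in> carrier B" "c \<in> carrier C"
  shows "ten (b \<oplus>\<^bsub>B\<^esub> b') c = ten b c \<oplus>\<^bsub>TT\<^esub> ten b' c"
proof -
  have "ten (b \<oplus>\<^bsub>B\<^esub> b') c = JJ +>\<^bsub>RR\<^esub> (frag_of (b, c) + frag_of (b', c))"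
    unfolding ten_eq
    by (rule coset_eqI)
      (use assms keys_add_subset(1)[of "frag_of (b, c)" "carrier MM" "frag_of (b', c)"]
        in \<open>simp_all add: diff_diff_eq[symmetric] rels_in_JJ\<close>)
  then show ?thesis using ring_hom_add[OF TT_hom, of "frag_of (b, c)" "frag_of (b', c)"] assms by (simp add: ten_eq)
qed

lemma ten_add_right:
  assumes "b \<in> carrier B" "c' \<in> carrier C" "c \<in> carrier C"
  shows "ten b (c \<oplus>\<^bsub>C\<^esub> c') = ten b c \<oplus>\<^bsub>TT\<^esub> ten b c'"
proof -
  have "ten b (c \<oplus>\<^bsub>C\<^esub> c') = JJ +>\<^bsub>RR\<^esub> (frag_of (b, c) + frag_of (b, c'))"
    unfolding ten_eq
    by (rule coset_eqI)
      (use assms keys_add_subset(1)[of "frag_of (b, c)" "carrier MM" "frag_of (b, c')"]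
        in \<open>simp_all add: diff_diff_eq[symmetric] rels_in_JJ\<close>)
  then show ?thesis using ring_hom_add[OF TT_hom, of "frag_of (b, c)" "frag_of (b, c')"] assms by (simp add: ten_eq)
qed

lemma ten_balance:
  assumes "a \<in> carrier A" "b \<in> carrier B" "c \<in> carrier C"
  shows "ten (f a \<otimes>\<^bsub>B\<^esub> b) c = ten b (g a \<otimes>\<^bsub>C\<^esub> c)"
  unfolding ten_eq
  by (rule coset_eqI) (use assms f_closed g_closed in \<open>simp_all add: rels_in_JJ\<close>)

lemma ten_mult:
  assumes "b \<in> carrier B" "c \<in> carrier C" "b' \<in> carrier B" "c' \<in> carrier C"
  shows "ten b c \<otimes>\<^bsub>TT\<^esub> ten b' c' = ten (b \<otimes>\<^bsub>B\<^esub> b') (c \<otimes>\<^bsub>C\<^esub> c')"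
  unfolding ten_eq using ring_hom_mult[OF TT_hom, of "frag_of (b, c)" "frag_of (b', c')"] assms by simp

lemma ten_one: "\<one>\<^bsub>TT\<^esub> = ten \<one>\<^bsub>B\<^esub> \<one>\<^bsub>C\<^esub>"
  unfolding ten_eq using ring_hom_one[OF TT_hom] by simp

lemma ten_rep:
  assumes "x \<in> carrier TT"
  obtains h where "h \<in> carrier RR" "x = JJ +>\<^bsub>RR\<^esub> h"
  using assms by (auto simp: tensor_ring_def FactRing_def A_RCOSETS_def' simp del: monoid_ring_simps)

text \<open>Elements are cosets of integer combinations of pairs, and closure under differences
  covers negative multiples.\<close>

lemma ten_induct [consumes 1, case_names ten diff]:
  assumes "x \<in> carrier TT" and "\<And>b c. b \<in> carrier B \<Longrightarrow> c \<in> carrier C \<Longrightarrow> P (ten b c)"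
    and "\<And>x y. x \<in> carrier TT \<Longrightarrow> y \<in> carrier TT \<Longrightarrow> P x \<Longrightarrow> P y \<Longrightarrow> P (x \<ominus>\<^bsub>TT\<^esub> y)"
  shows "P x"
proof -
  interpret T: cring TT by (rule TT_cring)
  interpret h: ring_hom_cring RR TT "(+>\<^bsub>RR\<^esub>) JJ"
    by (intro ring_hom_cringI ring_hom_ringI2 R.ring_axioms T.ring_axioms R.is_cring T.is_cring TT_hom)
  obtain h where h: "h \<in> carrier RR" "x = JJ +>\<^bsub>RR\<^esub> h" using assms(1) by (rule ten_rep)
  have "Poly_Mapping.keys h \<subseteq> carrier MM" using h by simp
  then have "Poly_Mapping.keys h \<subseteq> carrier MM \<and> P (JJ +>\<^bsub>RR\<^esub> h)"
  proof (induction h rule: mr_induct)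
    case zero
    \<comment> \<open>The rule has no case for zero, so zero is presented as a difference of two
      equal pure tensors.\<close>
    have "\<zero>\<^bsub>TT\<^esub> = ten \<zero>\<^bsub>B\<^esub> \<zero>\<^bsub>C\<^esub> \<ominus>\<^bsub>TT\<^esub> ten \<zero>\<^bsub>B\<^esub> \<zero>\<^bsub>C\<^esub>"
      using ten_closed[of "\<zero>\<^bsub>B\<^esub>" "\<zero>\<^bsub>C\<^esub>"] by (simp add: T.minus_eq T.r_neg)
    then have "P \<zero>\<^bsub>TT\<^esub>" using assms(2,3) ten_closed by simp
    then show ?case using h.hom_zero by simp
  next
    case (one x)
    then show ?case using assms(2) by (cases x) (simp add: ten_eq)
  next
    case (diff a b)
    then have "JJ +>\<^bsub>RR\<^esub> (a - b) = (JJ +>\<^bsub>RR\<^esub> a) \<ominus>\<^bsub>TT\<^esub> (JJ +>\<^bsub>RR\<^esub> b)"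
      using h.hom_add[of a "\<ominus>\<^bsub>RR\<^esub> b"] h.hom_a_inv[of b] M.monoid_ring_minus[of a b] R.a_inv_closed[of b]
      by (simp add: R.minus_eq T.minus_eq)
    then show ?case using diff assms(3) ring_hom_closed[OF TT_hom] by (simp add: keys_add_subset(2))
  qed
  then show ?thesis using h by simp
qed

text \<open>An additive map that is balanced up to the ideal \<open>N\<close> kills the tensor relations modulo \<open>N\<close>. It need
  not be multiplicative, so instead of its kernel one considers the largest ideal of the monoid ring that it
  maps into \<open>N\<close>.\<close>

lemma additive_map_JJ:
  fixes \<psi> :: "'b \<times> 'c \<Rightarrow> 'e::comm_ring_1"
  assumes N: "0 \<in> N" "\<And>x y. x \<in> N \<Longrightarrow> y \<in> N \<Longrightarrow> x - y \<in> N"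
    and add_left: "\<And>b b' c. b \<in> carrier B \<Longrightarrow> b' \<in> carrier B \<Longrightarrow> c \<in> carrier C \<Longrightarrow>
      \<psi> (b \<oplus>\<^bsub>B\<^esub> b', c) - \<psi> (b, c) - \<psi> (b', c) \<in> N"
    and add_right: "\<And>b c c'. b \<in> carrier B \<Longrightarrow> c \<in> carrier C \<Longrightarrow> c' \<in> carrier C \<Longrightarrow>
      \<psi> (b, c \<oplus>\<^bsub>C\<^esub> c') - \<psi> (b, c) - \<psi> (b, c') \<in> N"
    and bal: "\<And>a b c. a \<in> carrier A \<Longrightarrow> b \<in> carrier B \<Longrightarrow> c \<in> carrier C \<Longrightarrow>
      \<psi> (f a \<otimes>\<^bsub>B\<^esub> b, c) - \<psi> (b, g a \<otimes>\<^bsub>C\<^esub> c) \<in> N"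
    and x: "x \<in> JJ"
  shows "lin_ext \<psi> x \<in> N"
proof -
  define K where "K = {h \<in> carrier RR. \<forall>m\<in>carrier MM. lin_ext \<psi> (mr_mult MM (frag_of m) h) \<in> N}"
  have Nm: "- y \<in> N" if "y \<in> N" for y using N(2)[OF N(1) that] by simp
  have Na: "y + z \<in> N" if "y \<in> N" "z \<in> N" for y z using N(2)[OF that(1) Nm[OF that(2)]] by simp
  have "ideal K RR"
  proof (rule idealI)
    show "subgroup K (add_monoid RR)"
    proof (rule R.add.subgroupI)
      show "K \<subseteq> carrier RR" by (auto simp: K_def)
      show "K \<noteq> {}" using N(1) by (auto simp: K_def intro!: exI[of _ 0])
      fix h assume h: "h \<in> K"
      then have "\<ominus>\<^bsub>RR\<^esub> h = - h" using M.monoid_ring_minus[of 0 h] R.minus_eq[of 0 h] by (auto simp: K_def)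
      then show "\<ominus>\<^bsub>RR\<^esub> h \<in> K" using h Nm mr_mult_simps(3)[of MM _ 0 h] by (auto simp: K_def)
      fix h' assume h': "h' \<in> K"
      then have "h \<oplus>\<^bsub>RR\<^esub> h' \<in> carrier RR" using h by (intro R.a_closed) (auto simp: K_def)
      then show "h \<oplus>\<^bsub>RR\<^esub> h' \<in> K" using h h' Na by (auto simp: K_def mr_mult_add)
    qed
    have mult: "k \<otimes>\<^bsub>RR\<^esub> h \<in> K" if h: "h \<in> K" and k: "k \<in> carrier RR" for h k
    proof -
      have hc: "Poly_Mapping.keys h \<subseteq> carrier MM" using h by (simp add: K_def)
      have "lin_ext \<psi> (mr_mult MM (frag_of m) (mr_mult MM k h)) \<in> N" if m: "m \<in> carrier MM" for m
      proof -
        have "Poly_Mapping.keys k \<subseteq> carrier MM" using k by simp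
        then show ?thesis
        proof (induction k rule: mr_induct)
          case (one m')
          have eq: "mr_mult MM (frag_of m) (mr_mult MM (frag_of m') h) = mr_mult MM (frag_of (m \<otimes>\<^bsub>MM\<^esub> m')) h"
            using M.mr_mult_assoc[of "frag_of m" "frag_of m'" h] m one hc by (simp del: mult_DirProd)
          have "lin_ext \<psi> (mr_mult MM (frag_of (m \<otimes>\<^bsub>MM\<^esub> m')) h) \<in> N"
            using h M.m_closed[OF m one] unfolding K_def by blast
          then show ?case unfolding eq .
        qed (use N in auto)
      qed
      then show ?thesis using M.mr_mult_closed[of k h] k hc by (simp add: K_def)
    qed
    show "k \<otimes>\<^bsub>RR\<^esub> h \<in> K" if "h \<in> K" "k \<in> carrier RR" for h k using mult that .
    show "h \<otimes>\<^bsub>RR\<^esub> k \<in> K" if "h \<in> K" "k \<in> carrier RR" for h k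
      using mult[OF that] that R.m_comm[of h k] by (auto simp: K_def)
  qed (rule R.ring_axioms)
  moreover have "tensor_rels A B C f g \<subseteq> K"
  proof
    fix h assume h: "h \<in> tensor_rels A B C f g"
    have "lin_ext \<psi> (mr_mult MM (frag_of m) h) \<in> N" if m: "m \<in> carrier MM" for m
    proof -
      \<comment> \<open>A pair times a tensor relation is again a tensor relation, with entries
        multiplied by \<open>b0\<close> and \<open>c0\<close>; this is why the hypotheses on
        \<open>\<psi>\<close> suffice.\<close>
      obtain b0 c0 where m0: "m = (b0, c0)" "b0 \<in> carrier B" "c0 \<in> carrier C" using m by auto
      from h consider
        (l) b b' c where "h = frag_of (b \<oplus>\<^bsub>B\<^esub> b', c) - frag_of (b, c) - frag_of (b', c)"
          "b \<in> carrier B" "b' \<in> carrier B" "c \<in> carrier C"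
      | (r) b c c' where "h = frag_of (b, c \<oplus>\<^bsub>C\<^esub> c') - frag_of (b, c) - frag_of (b, c')"
          "b \<in> carrier B" "c \<in> carrier C" "c' \<in> carrier C"
      | (b) a b c where "h = frag_of (f a \<otimes>\<^bsub>B\<^esub> b, c) - frag_of (b, g a \<otimes>\<^bsub>C\<^esub> c)"
          "a \<in> carrier A" "b \<in> carrier B" "c \<in> carrier C"
        unfolding tensor_rels_def by blast
      then show ?thesis
      proof cases
        case l
        then show ?thesis using add_left[of "b0 \<otimes>\<^bsub>B\<^esub> b" "b0 \<otimes>\<^bsub>B\<^esub> b'" "c0 \<otimes>\<^bsub>C\<^esub> c"] m0 by (simp add: B.r_distr)
      next
        case r
        then show ?thesis using add_right[of "b0 \<otimes>\<^bsub>B\<^esub> b" "c0 \<otimes>\<^bsub>C\<^esub> c" "c0 \<otimes>\<^bsub>C\<^esub> c'"] m0 by (simp add: C.r_distr)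
      next
        case b
        then show ?thesis using bal[of a "b0 \<otimes>\<^bsub>B\<^esub> b" "c0 \<otimes>\<^bsub>C\<^esub> c"] m0 f_closed g_closed
          by (simp add: B.m_lcomm C.m_lcomm)
      qed
    qed
    then show "h \<in> K" using h rels_subset by (auto simp: K_def)
  qed
  ultimately have "JJ \<subseteq> K" unfolding tensor_ideal_def by (rule R.genideal_minimal)
  \<comment> \<open>Taking the unit pair as the multiplier in the definition of \<open>K\<close>
    recovers the value at \<open>x\<close> itself.\<close>
  then have "lin_ext \<psi> (mr_mult MM (frag_of \<one>\<^bsub>MM\<^esub>) x) \<in> N" "x \<in> carrier RR"
    using x M.one_closed unfolding K_def by auto
  then show ?thesis using M.mr_mult_one[of x] by simp
qed

end

section \<open>Teichmueller coordinates\<close>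

text \<open>\<open>A\<close> stands for the valuation ring of L and \<open>B\<close> for the finite
  field. \<open>inv_B\<close> makes \<open>B\<close> a field, so that \<open>A\<close> has a basis
  over it. The Witt ring \<open>K\<close> is a parameter so that the ring notation refers to
  it.\<close>

locale witt_pair =
  fixes p :: nat and A B :: "'l::field set" and K (structure)
  assumes K_def: "K = witt_ring p A"
    and p: "prime p" and char: "of_nat p = (0::'l)"
    and A: "perfect_subring p A" and B: "perfect_subring p B" and BA: "B \<subseteq> A"
    and inv_B: "a \<in> B \<Longrightarrow> inverse a \<in> B"
begin

abbreviation "WB \<equiv> {x. \<forall>n. x n \<in> B}"
abbreviation "pw \<equiv> (witt_p :: nat \<Rightarrow> 'l)"

lemma subrings: "is_subring A" "is_subring B"
  using A B by (auto simp: perfect_subring_def)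

sublocale K: cring K
  unfolding K_def by (rule cring_witt_ring[OF p subrings(1)])

lemma WB_cring: "cring (witt_ring p B)"
  by (rule cring_witt_ring[OF p subrings(2)])

lemma carr: "carrier K = {x. \<forall>n. x n \<in> A}"
  by (simp add: K_def witt_ring_simps)

lemma WB_sub: "x \<in> WB \<Longrightarrow> x \<in> carrier K"
  using BA by (auto simp: carr)

lemma zero_K: "\<zero> = (\<lambda>n. 0)" and one_K: "\<one> = teichmueller 1"
  by (simp_all add: K_def witt_ring_simps)

lemma add_0: "(x \<oplus> y) 0 = x 0 + y 0" and mult_0: "(x \<otimes> y) 0 = x 0 * y 0"
  by (simp_all add: K_def witt_ring_simps wadd_0[OF p] wmul_0[OF p])

lemma WB_closed:
  assumes "x \<in> WB"
  shows "y \<in> WB \<Longrightarrow> x \<oplus> y \<in> WB" "y \<in> WB \<Longrightarrow> x \<otimes> y \<in> WB"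
  using witt_closed[OF subrings(2), of x y] assms by (auto simp: K_def witt_ring_simps)

lemma WB_neg: "x \<in> WB \<Longrightarrow> \<ominus> x \<in> WB"
proof -
  assume x: "x \<in> WB"
  interpret KB: cring "witt_ring p B" by (rule WB_cring)
  have xb: "x \<in> carrier (witt_ring p B)" using x by (simp add: K_def witt_ring_simps)
  define y where "y = \<ominus>\<^bsub>witt_ring p B\<^esub> x"
  have y: "y \<in> WB" using KB.a_inv_closed[OF xb] by (simp add: y_def K_def witt_ring_simps)
  have "x \<oplus> y = \<zero>"
    using KB.r_neg[OF xb] by (simp add: y_def K_def witt_ring_simps)
  then have "y = \<ominus> x" using K.minus_equality[of y x] x y WB_sub K.a_comm by metis
  then show ?thesis using y by simp
qed

lemma t_closed: "a \<in> A \<Longrightarrow> teichmueller a \<in> carrier K"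
  using teichmueller_closed[OF subrings(1)] by (simp add: carr)

lemma t_WB: "a \<in> B \<Longrightarrow> teichmueller a \<in> WB"
  using teichmueller_closed[OF subrings(2)] by simp

lemma t_zero: "teichmueller 0 = \<zero>"
  by (auto simp: zero_K teichmueller_def)

lemma zero_WB: "\<zero> \<in> WB" and one_WB: "\<one> \<in> WB"
  using t_WB[of 0] t_WB[of 1] is_subringD[OF subrings(2)] by (simp_all add: t_zero one_K)

lemma pw_WB: "pw \<in> WB"
  using witt_p_closed[OF subrings(2)] by simp

lemma pw_closed [simp]: "pw \<in> carrier K"
  using pw_WB WB_sub by blast

lemma pw_cancel: "pw \<otimes> x = pw \<otimes> y \<Longrightarrow> x = y"
  using witt_p_cancel[OF p char, of x y] by (simp add: K_def witt_ring_simps)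

lemma pw_divides:
  assumes "x \<in> carrier K" "x 0 = 0" shows "\<exists>y\<in>carrier K. x = pw \<otimes> y"
  using witt_decomp_0[OF p A char, of x] assms by (auto simp: carr K_def witt_ring_simps)

lemma pw_divides_WB:
  assumes "x \<in> WB" "x 0 = 0" shows "\<exists>y\<in>WB. x = pw \<otimes> y"
  using witt_decomp_0[OF p B char, of x] assms by (auto simp: K_def witt_ring_simps)

lemma pw_mult_0: "(pw \<otimes> x) 0 = 0"
  by (simp add: mult_0 witt_p_0)

lemma K_decomp:
  assumes "x \<in> carrier K" shows "\<exists>y\<in>carrier K. x = teichmueller (x 0) \<oplus> pw \<otimes> y"
  using witt_decomp[OF p A char, of x] assms by (auto simp: carr K_def witt_ring_simps)

lemma minus_0:
  assumes "x \<in> carrier K" "y \<in> carrier K" shows "(x \<ominus> y) 0 = x 0 - y 0"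
proof -
  have "(x \<ominus> y) \<oplus> y = x" using assms by (simp add: K.minus_eq K.a_assoc K.l_neg)
  then have "(x \<ominus> y) 0 + y 0 = x 0" by (metis add_0)
  then show ?thesis by (simp add: algebra_simps)
qed

subsection \<open>A basis modulo $p$\<close>

definition indep :: "'l set \<Rightarrow> bool" where
  "indep S \<longleftrightarrow> S \<subseteq> A \<and> (\<forall>F a. finite F \<longrightarrow> F \<subseteq> S \<longrightarrow> (\<forall>s\<in>F. a s \<in> B) \<longrightarrow>
     (\<Sum>s\<in>F. a s * s) = 0 \<longrightarrow> (\<forall>s\<in>F. a s = 0))"

lemma indepD:
  assumes "indep S" "finite F" "F \<subseteq> S" "\<And>s. s \<in> F \<Longrightarrow> a s \<in> B" "(\<Sum>s\<in>F. a s * s) = 0" "s \<in> F"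
  shows "a s = 0"
  using assms by (auto simp: indep_def)

definition spans :: "'l set \<Rightarrow> bool" where
  "spans S \<longleftrightarrow> (\<forall>x\<in>A. \<exists>F a. finite F \<and> F \<subseteq> S \<and> (\<forall>s. a s \<in> B) \<and> (\<forall>s. s \<notin> F \<longrightarrow> a s = 0) \<and> x = (\<Sum>s\<in>F. a s * s))"

text \<open>Zorn's lemma is applied to the independent sets that contain \<open>c\<close>: with
  \<open>c\<close> in the basis, the coordinate at \<open>c\<close> takes the value 1 there.\<close>

lemma ex_basis:
  assumes c: "c \<in> A" "c \<noteq> 0" shows "\<exists>S. indep S \<and> c \<in> S \<and> spans S"
proof -
  define X where "X = {S. indep S \<and> c \<in> S}"
  have "indep {c}"
    unfolding indep_def
  proof (intro conjI allI impI ballI)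
    fix F a s
    assume "F \<subseteq> {c}" "(\<Sum>s\<in>F. a s * s) = 0" "s \<in> F"
    then have "F = {c}" "s = c" by auto
    then show "a s = 0" using \<open>(\<Sum>s\<in>F. a s * s) = 0\<close> c by simp
  qed (use c in auto)
  then have ne: "X \<noteq> {}" by (auto simp: X_def)
  have "\<Union>Y \<in> X" if Y: "Y \<noteq> {}" "subset.chain X Y" for Y
  proof -
    have YX: "Y \<subseteq> X" using Y by (simp add: subset.chain_def)
    have "indep (\<Union>Y)"
      unfolding indep_def
    proof (intro conjI allI impI)
      show "\<Union>Y \<subseteq> A" using YX by (auto simp: X_def indep_def)
      fix F a
      assume F: "finite F" "F \<subseteq> \<Union>Y" and a: "\<forall>s\<in>F. a s \<in> B" "(\<Sum>s\<in>F. a s * s) = 0"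
      obtain S where "S \<in> Y" "F \<subseteq> S" using finite_subset_Union_chain[OF F Y] .
      then show "\<forall>s\<in>F. a s = 0" using YX F a by (auto simp: X_def indep_def)
    qed
    moreover have "c \<in> \<Union>Y" using Y YX by (auto simp: X_def)
    ultimately show ?thesis by (simp add: X_def)
  qed
  then obtain S where S: "S \<in> X" and max: "\<And>T. T \<in> X \<Longrightarrow> S \<subseteq> T \<Longrightarrow> T = S"
    using subset_Zorn_nonempty[OF ne] by metis
  have ind: "indep S" and cS: "c \<in> S" using S by (auto simp: X_def)
  note Bs = is_subringD[OF subrings(2)]
  have "\<exists>F a. finite F \<and> F \<subseteq> S \<and> (\<forall>s. a s \<in> B) \<and> (\<forall>s. s \<notin> F \<longrightarrow> a s = 0) \<and> x = (\<Sum>s\<in>F. a s * s)"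
    if x: "x \<in> A" for x
  proof (cases "x \<in> S")
    case True
    then show ?thesis using Bs by (intro exI[of _ "{x}"] exI[of _ "\<lambda>s. if s = x then 1 else 0"]) auto
  next
    case False
    have nind: "\<not> indep (insert x S)"
      using max[of "insert x S"] False cS by (auto simp: X_def)
    have "insert x S \<subseteq> A" using x ind by (simp add: indep_def)
    then obtain F a where F: "finite F" "F \<subseteq> insert x S" "\<forall>s\<in>F. a s \<in> B" "(\<Sum>s\<in>F. a s * s) = 0" "\<exists>s\<in>F. a s \<noteq> 0"
      using nind unfolding indep_def by (simp only: simp_thms de_Morgan_conj not_all not_imp) auto
    \<comment> \<open>A nontrivial relation without \<open>x\<close> would be a relation inside the
      independent set \<open>S\<close>; hence the relation can be solved for
      \<open>x\<close>.\<close>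
    have xF: "x \<in> F" "a x \<noteq> 0"
    proof -
      have *: False if "\<forall>s\<in>F - {x}. a s * s = a s * s" "x \<notin> F \<or> a x = 0"
      proof -
        have "(\<Sum>s\<in>F - {x}. a s * s) = 0"
          using F that(2) by (cases "x \<in> F") (simp_all add: sum.remove)
        moreover have "F - {x} \<subseteq> S" using F by auto
        ultimately have "\<forall>s\<in>F - {x}. a s = 0" using indepD[OF ind, of "F - {x}" a] F by simp
        then show False using F(5) that(2) by auto
      qed
      then show "x \<in> F" "a x \<noteq> 0" by auto
    qed
    define b where "b s = (if s \<in> F - {x} then - (a s * inverse (a x)) else 0)" for s
    have "a x * x + (\<Sum>s\<in>F - {x}. a s * s) = 0" using F xF by (simp add: sum.remove)
    then have "x = - (inverse (a x) * (\<Sum>s\<in>F - {x}. a s * s))" using xF by (simp add: field_simps eq_neg_iff_add_eq_0)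
    also have "\<dots> = (\<Sum>s\<in>F - {x}. b s * s)"
      by (simp add: b_def sum_distrib_left sum_negf[symmetric] mult_ac)
    finally have "x = (\<Sum>s\<in>F - {x}. b s * s)" .
    moreover have "b s \<in> B" for s using F xF Bs inv_B by (auto simp: b_def)
    ultimately show ?thesis using F by (intro exI[of _ "F - {x}"] exI[of _ b]) (auto simp: b_def)
  qed
  then show ?thesis using ind cS by (auto simp: spans_def)
qed

subsection \<open>Coordinates modulo a power of $p$\<close>

definition comb :: "'l set \<Rightarrow> ('l \<Rightarrow> nat \<Rightarrow> 'l) \<Rightarrow> nat \<Rightarrow> 'l" where
  "comb F \<beta> = (\<Oplus>s\<in>F. \<beta> s \<otimes> teichmueller s)"

lemma comb_fun: "F \<subseteq> A \<Longrightarrow> (\<And>s. \<beta> s \<in> WB) \<Longrightarrow> (\<lambda>s. \<beta> s \<otimes> teichmueller s) \<in> F \<rightarrow> carrier K"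
  using t_closed WB_sub by (intro funcsetI K.m_closed) auto

lemma comb_closed: "F \<subseteq> A \<Longrightarrow> (\<And>s. \<beta> s \<in> WB) \<Longrightarrow> comb F \<beta> \<in> carrier K"
  unfolding comb_def by (intro K.finsum_closed comb_fun)

lemma comb_0:
  assumes "finite F" "F \<subseteq> A" "\<And>s. \<beta> s \<in> WB" shows "comb F \<beta> 0 = (\<Sum>s\<in>F. \<beta> s 0 * s)"
  using assms(1,2)
proof (induction F rule: finite_induct)
  case empty
  then show ?case by (simp add: comb_def zero_K)
next
  case (insert x F)
  have "comb (insert x F) \<beta> = \<beta> x \<otimes> teichmueller x \<oplus> comb F \<beta>"
    unfolding comb_def using insert comb_fun[of "insert x F" \<beta>] assms(3) by (intro K.finsum_insert) auto
  then show ?case using insert by (simp add: add_0 mult_0) (simp add: teichmueller_def)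
qed

lemma comb_add:
  assumes "F \<subseteq> A" "\<And>s. \<beta> s \<in> WB" "\<And>s. \<gamma> s \<in> WB"
  shows "comb F (\<lambda>s. \<beta> s \<oplus> \<gamma> s) = comb F \<beta> \<oplus> comb F \<gamma>"
proof -
  have "comb F (\<lambda>s. \<beta> s \<oplus> \<gamma> s) = (\<Oplus>s\<in>F. \<beta> s \<otimes> teichmueller s \<oplus> \<gamma> s \<otimes> teichmueller s)"
    unfolding comb_def
  proof (rule K.finsum_cong'[OF refl])
    show "(\<lambda>s. \<beta> s \<otimes> teichmueller s \<oplus> \<gamma> s \<otimes> teichmueller s) \<in> F \<rightarrow> carrier K"
      using assms t_closed WB_sub by (intro funcsetI K.a_closed K.m_closed) auto
    fix s assume "s \<in> F"
    then show "(\<beta> s \<oplus> \<gamma> s) \<otimes> teichmueller s = \<beta> s \<otimes> teichmueller s \<oplus> \<gamma> s \<otimes> teichmueller s"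
      using assms WB_sub[OF assms(2)] WB_sub[OF assms(3)] t_closed by (intro K.l_distr) auto
  qed
  also have "\<dots> = comb F \<beta> \<oplus> comb F \<gamma>"
    unfolding comb_def by (intro K.finsum_addf comb_fun assms)
  finally show ?thesis .
qed

lemma comb_smult:
  assumes "finite F" "F \<subseteq> A" "\<And>s. \<beta> s \<in> WB" "b \<in> carrier K"
  shows "comb F (\<lambda>s. b \<otimes> \<beta> s) = b \<otimes> comb F \<beta>"
proof -
  have "b \<otimes> comb F \<beta> = (\<Oplus>s\<in>F. b \<otimes> (\<beta> s \<otimes> teichmueller s))"
    unfolding comb_def by (intro K.finsum_rdistr assms comb_fun)
  also have "\<dots> = comb F (\<lambda>s. b \<otimes> \<beta> s)"
    unfolding comb_def
  proof (rule K.finsum_cong'[OF refl])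
    fix s assume s: "s \<in> F"
    have c: "b \<in> carrier K" "\<beta> s \<in> carrier K" "teichmueller s \<in> carrier K"
      using assms s WB_sub[OF assms(3)] t_closed by auto
    show "b \<otimes> (\<beta> s \<otimes> teichmueller s) = b \<otimes> \<beta> s \<otimes> teichmueller s"
      by (rule K.m_assoc[OF c, symmetric])
  qed (use assms WB_sub[OF assms(3)] t_closed in \<open>auto intro!: K.m_closed\<close>)
  finally show ?thesis by simp
qed

lemma comb_extend:
  assumes "finite G" "G \<subseteq> A" "F \<subseteq> G" "\<And>s. \<beta> s \<in> WB" "\<And>s. s \<notin> F \<Longrightarrow> \<beta> s = \<zero>"
  shows "comb G \<beta> = comb F \<beta>"
  unfolding comb_def
proof (rule K.add.finprod_mono_neutral_cong_right[OF assms(1,3)])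
  show "\<beta> s \<otimes> teichmueller s = \<zero>" if "s \<in> G - F" for s
    using that assms t_closed by (auto intro: K.l_null)
  show "(\<lambda>s. \<beta> s \<otimes> teichmueller s) \<in> G \<rightarrow> carrier K" using comb_fun[OF assms(2,4)] by simp
qed simp

text \<open>The finite sum of \<beta> s times [s] represents \<open>x\<close> modulo p^n. An exact
  expansion would involve infinitely many basis elements; truncation keeps the support finite at the
  price of coefficients that are unique only modulo p^n.\<close>

definition isrep :: "'l set \<Rightarrow> nat \<Rightarrow> (nat \<Rightarrow> 'l) \<Rightarrow> ('l \<Rightarrow> nat \<Rightarrow> 'l) \<Rightarrow> bool" where
  "isrep S n x \<beta> \<longleftrightarrow> (\<exists>F z. finite F \<and> F \<subseteq> S \<and> (\<forall>s. \<beta> s \<in> WB) \<and> (\<forall>s. s \<notin> F \<longrightarrow> \<beta> s = \<zero>) \<and>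
     z \<in> carrier K \<and> x = comb F \<beta> \<oplus> pw [^] n \<otimes> z)"

lemma isrepE:
  assumes "isrep S n x \<beta>"
  obtains F z where "finite F" "F \<subseteq> S" "\<And>s. \<beta> s \<in> WB" "\<And>s. s \<notin> F \<Longrightarrow> \<beta> s = \<zero>"
    "z \<in> carrier K" "x = comb F \<beta> \<oplus> pw [^] n \<otimes> z"
  using assms unfolding isrep_def by blast

lemma isrepI:
  assumes "finite F" "F \<subseteq> S" "\<And>s. \<beta> s \<in> WB" "\<And>s. s \<notin> F \<Longrightarrow> \<beta> s = \<zero>"
    "z \<in> carrier K" "x = comb F \<beta> \<oplus> pw [^] n \<otimes> z"
  shows "isrep S n x \<beta>"
  unfolding isrep_def using assms by blast

lemma isrep_add:
  assumes S: "S \<subseteq> A" and x: "isrep S n x \<beta>" and y: "isrep S n y \<gamma>"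
  shows "isrep S n (x \<oplus> y) (\<lambda>s. \<beta> s \<oplus> \<gamma> s)"
proof -
  obtain F z where F: "finite F" "F \<subseteq> S" "\<And>s. \<beta> s \<in> WB" "\<And>s. s \<notin> F \<Longrightarrow> \<beta> s = \<zero>"
    "z \<in> carrier K" "x = comb F \<beta> \<oplus> pw [^] n \<otimes> z" using x by (rule isrepE) blast
  obtain G v where G: "finite G" "G \<subseteq> S" "\<And>s. \<gamma> s \<in> WB" "\<And>s. s \<notin> G \<Longrightarrow> \<gamma> s = \<zero>"
    "v \<in> carrier K" "y = comb G \<gamma> \<oplus> pw [^] n \<otimes> v" using y by (rule isrepE) blast
  have FG: "F \<union> G \<subseteq> A" using F G S by auto
  have e: "comb (F \<union> G) \<beta> = comb F \<beta>" "comb (F \<union> G) \<gamma> = comb G \<gamma>"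
    using F G FG by (intro comb_extend; auto)+
  have c: "comb F \<beta> \<in> carrier K" "comb G \<gamma> \<in> carrier K" "pw [^] n \<in> carrier K"
    using comb_closed F G S by auto
  have eq: "x \<oplus> y = comb (F \<union> G) (\<lambda>s. \<beta> s \<oplus> \<gamma> s) \<oplus> pw [^] n \<otimes> (z \<oplus> v)"
    unfolding comb_add[of "F \<union> G" \<beta> \<gamma>, OF FG F(3) G(3)] e F(6) G(6) using c F(5) G(5) by algebra
  show ?thesis
    by (rule isrepI[of "F \<union> G", OF _ _ _ _ _ eq]) (use F G WB_closed(1) in auto)
qed

lemma isrep_smult:
  assumes S: "S \<subseteq> A" and x: "isrep S n x \<beta>" and b: "b \<in> WB"
  shows "isrep S n (b \<otimes> x) (\<lambda>s. b \<otimes> \<beta> s)"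
proof -
  obtain F z where F: "finite F" "F \<subseteq> S" "\<And>s. \<beta> s \<in> WB" "\<And>s. s \<notin> F \<Longrightarrow> \<beta> s = \<zero>"
    "z \<in> carrier K" "x = comb F \<beta> \<oplus> pw [^] n \<otimes> z" using x by (rule isrepE) blast
  have FA: "F \<subseteq> A" using F S by auto
  have c: "comb F \<beta> \<in> carrier K" "pw [^] n \<in> carrier K" "b \<in> carrier K"
    using comb_closed[of F \<beta>, OF FA F(3)] WB_sub[OF b] by auto
  have eq: "b \<otimes> x = comb F (\<lambda>s. b \<otimes> \<beta> s) \<oplus> pw [^] n \<otimes> (b \<otimes> z)"
    unfolding comb_smult[of F \<beta> b, OF F(1) FA F(3) c(3)] F(6) using c F(5) by algebra
  show ?thesis
    by (rule isrepI[of F, OF _ _ _ _ _ eq]) (use F b c WB_closed(2)[OF b] in auto)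
qed

text \<open>Successive approximation: expand the first component in the basis, lift the
  coefficients, and continue with the difference divided by p.\<close>

lemma ex_isrep:
  assumes S: "S \<subseteq> A" "spans S" and x: "x \<in> carrier K"
  shows "\<exists>\<beta>. isrep S n x \<beta>"
  using x
proof (induction n arbitrary: x)
  case 0
  show ?case
    by (intro exI[of _ "\<lambda>_. \<zero>"] isrepI[of "{}" _ _ x]) (use 0 zero_WB in \<open>auto simp: comb_def\<close>)
next
  case (Suc n)
  have "x 0 \<in> A" using Suc.prems by (simp add: carr)
  from S(2)[unfolded spans_def, rule_format, OF this] obtain F a where F: "finite F" "F \<subseteq> S" "\<And>s. a s \<in> B" "\<And>s. s \<notin> F \<Longrightarrow> a s = 0" "x 0 = (\<Sum>s\<in>F. a s * s)"
    by (elim exE conjE) auto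
  have FA: "F \<subseteq> A" using F S by auto
  \<comment> \<open>Any lifts of the coefficients would serve; Teichmueller lifts preserve zero and
    hence the support.\<close>
  define \<alpha> where "\<alpha> s = teichmueller (a s)" for s
  have \<alpha>: "\<alpha> s \<in> WB" for s using t_WB[OF F(3)] by (simp add: \<alpha>_def)
  define v where "v = comb F \<alpha>"
  have v: "v \<in> carrier K" "v 0 = x 0"
    using comb_closed[of F \<alpha>, OF FA \<alpha>] comb_0[of F \<alpha>, OF F(1) FA \<alpha>] F(5) by (auto simp: v_def \<alpha>_def teichmueller_def)
  have "(x \<ominus> v) 0 = 0" using minus_0[OF Suc.prems v(1)] v(2) by simp
  then obtain y where y: "y \<in> carrier K" "x \<ominus> v = pw \<otimes> y"
    using pw_divides[of "x \<ominus> v"] Suc.prems v by auto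
  obtain \<gamma> where "isrep S n y \<gamma>" using Suc.IH[OF y(1)] by blast
  then obtain G z where G: "finite G" "G \<subseteq> S" "\<And>s. \<gamma> s \<in> WB" "\<And>s. s \<notin> G \<Longrightarrow> \<gamma> s = \<zero>"
    "z \<in> carrier K" "y = comb G \<gamma> \<oplus> pw [^] n \<otimes> z" by (rule isrepE) blast
  have GA: "G \<subseteq> A" using G S by auto
  have c: "comb G \<gamma> \<in> carrier K" "pw [^] n \<in> carrier K" using comb_closed[of G \<gamma>, OF GA G(3)] by auto
  have p1: "isrep S (Suc n) v \<alpha>"
    by (rule isrepI[of F _ _ "\<zero>"]) (use F v \<alpha> t_zero in \<open>auto simp: v_def \<alpha>_def\<close>)
  have "pw \<otimes> y = comb G (\<lambda>s. pw \<otimes> \<gamma> s) \<oplus> (pw [^] n \<otimes> pw) \<otimes> z"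
    unfolding comb_smult[of G \<gamma> pw, OF G(1) GA G(3) pw_closed] G(6) using c G(5) pw_closed by algebra
  then have eq: "pw \<otimes> y = comb G (\<lambda>s. pw \<otimes> \<gamma> s) \<oplus> pw [^] Suc n \<otimes> z" by simp
  have p2: "isrep S (Suc n) (pw \<otimes> y) (\<lambda>s. pw \<otimes> \<gamma> s)"
    by (rule isrepI[OF G(1,2) _ _ G(5) eq]) (use G WB_closed(2)[OF pw_WB] in auto)
  have "x = v \<oplus> (x \<ominus> v)" using Suc.prems v(1) by algebra
  then have "x = v \<oplus> pw \<otimes> y" by (simp only: y(2))
  then show ?case using isrep_add[OF S(1) p1 p2] by auto
qed

text \<open>Modulo p the hypothesis is a linear relation over \<open>B\<close> between basis
  elements, so every coefficient is divisible by p; cancelling p lowers n.\<close>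

lemma comb_divisible:
  fixes n :: nat
  assumes S: "indep S" and F: "finite F" "F \<subseteq> S" and \<beta>: "\<And>s. \<beta> s \<in> WB"
    and "z \<in> carrier K" "comb F \<beta> = pw [^] n \<otimes> z" "s \<in> F"
  shows "\<exists>y\<in>WB. \<beta> s = pw [^] n \<otimes> y"
  using assms(4-)
proof (induction n arbitrary: \<beta>)
  case 0
  then show ?case using WB_sub[OF 0(1)] by (intro bexI[of _ "\<beta> s"]) auto
next
  case (Suc n)
  have FA: "F \<subseteq> A" using F S by (auto simp: indep_def)
  have c: "pw [^] n \<in> carrier K" by simp
  have eq: "comb F \<beta> = pw \<otimes> (pw [^] n \<otimes> z)"
    using Suc.prems(2,3) c by (simp add: K.m_ac)
  then have "(\<Sum>s\<in>F. \<beta> s 0 * s) = 0" using comb_0[of F \<beta>, OF F(1) FA Suc.prems(1)] pw_mult_0 by simp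
  then have b0: "\<beta> s 0 = 0" if "s \<in> F" for s
    using indepD[OF S F, of "\<lambda>s. \<beta> s 0" s] Suc.prems(1) that by simp
  have "\<forall>s. \<exists>y. y \<in> WB \<and> (s \<in> F \<longrightarrow> \<beta> s = pw \<otimes> y)"
    using pw_divides_WB[OF Suc.prems(1)] b0 zero_WB by meson
  then obtain \<gamma> where \<gamma>: "\<And>s. \<gamma> s \<in> WB" "\<And>s. s \<in> F \<Longrightarrow> \<beta> s = pw \<otimes> \<gamma> s" by metis
  have "comb F \<beta> = comb F (\<lambda>s. pw \<otimes> \<gamma> s)"
    unfolding comb_def
    by (rule K.finsum_cong'[OF refl comb_fun[OF FA]]) (use \<gamma> WB_closed(2)[OF pw_WB] in auto)
  then have "pw \<otimes> comb F \<gamma> = pw \<otimes> (pw [^] n \<otimes> z)"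
    using eq comb_smult[of F \<gamma> pw, OF F(1) FA \<gamma>(1) pw_closed] by simp
  then have "comb F \<gamma> = pw [^] n \<otimes> z" by (rule pw_cancel)
  from Suc.IH[OF \<gamma>(1) Suc.prems(2) this Suc.prems(4)]
  obtain y where y: "y \<in> WB" "\<gamma> s = pw [^] n \<otimes> y" by blast
  have "\<beta> s = pw [^] Suc n \<otimes> y"
    using \<gamma>(2)[OF Suc.prems(4)] y(2) WB_sub[OF y(1)] c by (simp add: K.m_ac)
  then show ?case using y by blast
qed

lemma isrep_unique:
  assumes S: "indep S" and x: "isrep S n x \<beta>" "isrep S n x \<gamma>"
  shows "\<exists>y\<in>WB. \<beta> s = \<gamma> s \<oplus> pw [^] n \<otimes> y"
proof -
  have SA: "S \<subseteq> A" using S by (simp add: indep_def)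
  \<comment> \<open>The difference of the two representations is formed as a sum with a multiple by
    -1, so that the closure lemmas for \<open>isrep\<close> apply.\<close>
  have m1: "\<ominus> \<one> \<in> WB" using WB_neg[OF one_WB] .
  define \<delta> where "\<delta> s = \<beta> s \<oplus> (\<ominus> \<one>) \<otimes> \<gamma> s" for s
  have xc: "x \<in> carrier K" and bg: "\<beta> s \<in> WB" "\<gamma> s \<in> WB"
  proof -
    obtain F z where "finite F" "F \<subseteq> S" "\<And>s. \<beta> s \<in> WB" "z \<in> carrier K"
      "x = comb F \<beta> \<oplus> pw [^] n \<otimes> z" using x(1) by (rule isrepE) blast
    then show "x \<in> carrier K" "\<beta> s \<in> WB" using comb_closed[of F \<beta>] SA by auto
    show "\<gamma> s \<in> WB" using x(2) by (rule isrepE) blast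
  qed
  have "isrep S n (x \<oplus> (\<ominus> \<one>) \<otimes> x) \<delta>"
    unfolding \<delta>_def by (intro isrep_add isrep_smult SA x m1)
  moreover have "x \<oplus> (\<ominus> \<one>) \<otimes> x = \<zero>"
    using xc by (simp add: K.l_minus K.r_neg)
  ultimately have "isrep S n \<zero> \<delta>" by (simp only:)
  then obtain F z where F: "finite F" "F \<subseteq> S" "\<And>s. \<delta> s \<in> WB" "\<And>s. s \<notin> F \<Longrightarrow> \<delta> s = \<zero>"
    "z \<in> carrier K" "\<zero> = comb F \<delta> \<oplus> pw [^] n \<otimes> z"
    by (rule isrepE) blast
  have c: "comb F \<delta> \<in> carrier K" "pw [^] n \<in> carrier K" using comb_closed F SA by auto
  have "comb F \<delta> = (comb F \<delta> \<oplus> pw [^] n \<otimes> z) \<oplus> pw [^] n \<otimes> (\<ominus> z)"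
    using c F(5) by algebra
  also have "comb F \<delta> \<oplus> pw [^] n \<otimes> z = \<zero>" by (rule F(6)[symmetric])
  finally have eq: "comb F \<delta> = pw [^] n \<otimes> (\<ominus> z)" using F(5) c by simp
  have "\<exists>y\<in>WB. \<delta> s = pw [^] n \<otimes> y"
  proof (cases "s \<in> F")
    case True
    then show ?thesis using comb_divisible[OF S F(1,2,3) _ eq] F(5) by simp
  next
    case False
    then show ?thesis using F(4) zero_WB c by (intro bexI[of _ "\<zero>"]) auto
  qed
  then obtain y where y: "y \<in> WB" "\<delta> s = pw [^] n \<otimes> y" by blast
  have "\<beta> s = \<gamma> s \<oplus> (\<beta> s \<oplus> (\<ominus> \<one>) \<otimes> \<gamma> s)"
    using WB_sub[OF bg(1)] WB_sub[OF bg(2)] by algebra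
  then have "\<beta> s = \<gamma> s \<oplus> pw [^] n \<otimes> y" using y(2) by (simp add: \<delta>_def)
  then show ?thesis using y(1) by blast
qed

text \<open>The coordinate at \<open>c\<close> of an arbitrarily chosen representation. The choice
  spoils exact linearity, but uniqueness modulo p^n restores it up to multiples of p^n, and later
  all values are compared only modulo such an error.\<close>

lemma ex_coordinate:
  fixes n :: nat
  assumes c: "c \<in> A" "c \<noteq> 0"
  shows "\<exists>\<phi>. (\<forall>x\<in>carrier K. \<phi> x \<in> WB) \<and>
    (\<forall>x\<in>carrier K. \<forall>y\<in>carrier K. \<exists>z\<in>WB. \<phi> (x \<oplus> y) = (\<phi> x \<oplus> \<phi> y) \<oplus> pw [^] n \<otimes> z) \<and>
    (\<forall>b\<in>WB. \<forall>x\<in>carrier K. \<exists>z\<in>WB. \<phi> (b \<otimes> x) = (b \<otimes> \<phi> x) \<oplus> pw [^] n \<otimes> z) \<and>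
    (\<exists>z\<in>WB. \<phi> (teichmueller c) = \<one> \<oplus> pw [^] n \<otimes> z)"
proof -
  obtain S where S: "indep S" "c \<in> S" "spans S" using ex_basis[OF c] by blast
  have SA: "S \<subseteq> A" using S by (simp add: indep_def)
  obtain r where r: "\<And>x. x \<in> carrier K \<Longrightarrow> isrep S n x (r x)"
    using ex_isrep[OF SA S(3), of _ n] by metis
  define \<phi> where "\<phi> x = r x c" for x
  have 1: "\<phi> x \<in> WB" if "x \<in> carrier K" for x
    using r[OF that] unfolding \<phi>_def by (rule isrepE) blast
  have 2: "\<exists>z\<in>WB. \<phi> (x \<oplus> y) = (\<phi> x \<oplus> \<phi> y) \<oplus> pw [^] n \<otimes> z"
    if "x \<in> carrier K" "y \<in> carrier K" for x y
    unfolding \<phi>_def using that by (intro isrep_unique[OF S(1) r isrep_add[OF SA r r]]) auto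
  have 3: "\<exists>z\<in>WB. \<phi> (b \<otimes> x) = (b \<otimes> \<phi> x) \<oplus> pw [^] n \<otimes> z"
    if "b \<in> WB" "x \<in> carrier K" for b x
    unfolding \<phi>_def using that WB_sub[OF that(1)] by (intro isrep_unique[OF S(1) r isrep_smult[OF SA r]]) auto
  define \<epsilon> where "\<epsilon> s = (if s = c then \<one> else \<zero>)" for s
  have tc: "teichmueller c \<in> carrier K" using c t_closed by simp
  have "comb {c} \<epsilon> = teichmueller c"
    unfolding comb_def using tc by (simp add: \<epsilon>_def K.finsum_insert)
  then have "isrep S n (teichmueller c) \<epsilon>"
    by (intro isrepI[of "{c}" _ _ "\<zero>"]) (use S zero_WB one_WB tc in \<open>auto simp: \<epsilon>_def\<close>)
  then have "\<exists>z\<in>WB. \<phi> (teichmueller c) = \<epsilon> c \<oplus> pw [^] n \<otimes> z"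
    unfolding \<phi>_def by (intro isrep_unique[OF S(1) r[OF tc]])
  then have 4: "\<exists>z\<in>WB. \<phi> (teichmueller c) = \<one> \<oplus> pw [^] n \<otimes> z"
    by (simp add: \<epsilon>_def)
  show ?thesis using 1 2 3 4 by (intro exI[of _ \<phi>]) blast
qed

end

section \<open>Completions at a principal ideal\<close>

context cring
begin

lemma mem_cgenideal: "x \<in> PIdl a \<longleftrightarrow> (\<exists>y\<in>carrier R. x = y \<otimes> a)"
  by (auto simp: cgenideal_def)

lemma ideal_pow_cgenideal:
  assumes w: "w \<in> carrier R" shows "ideal_pow R (PIdl w) n = PIdl (w [^] n)"
proof (induction n)
  case 0
  show ?case by (auto simp: mem_cgenideal)
next
  case (Suc n)
  have "ideal_prod R (PIdl w) (PIdl (w [^] n)) = PIdl (w [^] Suc n)"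
  proof (rule equalityI; rule subsetI)
    fix x assume "x \<in> ideal_prod R (PIdl w) (PIdl (w [^] n))"
    then show "x \<in> PIdl (w [^] Suc n)"
    proof induction
      case (prod i j)
      then obtain a b where ab: "a \<in> carrier R" "i = a \<otimes> w" "b \<in> carrier R" "j = b \<otimes> w [^] n"
        by (auto simp: mem_cgenideal)
      have "(a \<otimes> w) \<otimes> (b \<otimes> w [^] n) = (a \<otimes> b) \<otimes> (w [^] n \<otimes> w)"
        using ab w by (simp add: m_ac)
      then show ?case using ab by (auto simp: mem_cgenideal)
    next
      case (sum s t)
      then show ?case using cgenideal_ideal[of "w [^] Suc n"] w
        by (meson additive_subgroup.a_closed ideal.axioms(1) nat_pow_closed)
    qed
  next
    fix x assume "x \<in> PIdl (w [^] Suc n)"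
    then obtain a where a: "a \<in> carrier R" "x = a \<otimes> w [^] Suc n" by (auto simp: mem_cgenideal)
    have "x = (a \<otimes> w) \<otimes> (\<one> \<otimes> w [^] n)" using a w by (simp add: m_ac)
    moreover have "a \<otimes> w \<in> PIdl w" "\<one> \<otimes> w [^] n \<in> PIdl (w [^] n)"
      using a by (auto simp: mem_cgenideal)
    ultimately show "x \<in> ideal_prod R (PIdl w) (PIdl (w [^] n))"
      by (simp only: ideal_prod.prod)
  qed
  then show ?case using Suc by simp
qed

end

text \<open>\<open>w_cancel\<close> follows if \<open>w\<close> is a nonzerodivisor but asks for
  less: cancellation only modulo powers of \<open>w\<close>. This makes \<open>w\<close> cancellable
  in the completion, where elements are known only modulo such powers.\<close>

locale adic_ring = cring +
  fixes w
  assumes w_closed [simp, intro]: "w \<in> carrier R"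
    and w_cancel: "x \<in> carrier R \<Longrightarrow> w \<otimes> x \<in> PIdl (w [^] Suc n) \<Longrightarrow> x \<in> PIdl (w [^] n)"
begin

definition "I n = PIdl (w [^] (n::nat))"

lemma mem_I: "x \<in> I n \<longleftrightarrow> (\<exists>y\<in>carrier R. x = y \<otimes> w [^] n)"
  by (simp add: I_def mem_cgenideal)

lemma I_cancel: "x \<in> carrier R \<Longrightarrow> w \<otimes> x \<in> I (Suc n) \<Longrightarrow> x \<in> I n"
  unfolding I_def by (rule w_cancel)

abbreviation "Q \<equiv> \<lambda>n. R Quot I n"
abbreviation "C \<equiv> adic_completion R (PIdl w)"
abbreviation "of_R \<equiv> to_completion R (PIdl w)"

lemma I_ideal: "ideal (I n) R"
  by (simp add: I_def cgenideal_ideal)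

lemma Q_cring: "cring (Q n)"
  using ideal.quotient_is_cring[OF I_ideal is_cring] .

lemma Q_simps:
  assumes "a \<in> carrier R" "b \<in> carrier R"
  shows "(I n +> a) \<oplus>\<^bsub>Q n\<^esub> (I n +> b) = I n +> (a \<oplus> b)"
    "(I n +> a) \<otimes>\<^bsub>Q n\<^esub> (I n +> b) = I n +> (a \<otimes> b)"
    "I n +> a \<in> carrier (Q n)"
    "\<one>\<^bsub>Q n\<^esub> = I n +> \<one>" "\<zero>\<^bsub>Q n\<^esub> = I n +> \<zero>"
proof -
  interpret ideal "I n" R by (rule I_ideal)
  show "(I n +> a) \<oplus>\<^bsub>Q n\<^esub> (I n +> b) = I n +> (a \<oplus> b)"
    "(I n +> a) \<otimes>\<^bsub>Q n\<^esub> (I n +> b) = I n +> (a \<otimes> b)" "I n +> a \<in> carrier (Q n)"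
    using rcos_ring_hom assms by (auto simp: ring_hom_def)
  show "\<one>\<^bsub>Q n\<^esub> = I n +> \<one>" "\<zero>\<^bsub>Q n\<^esub> = I n +> \<zero>"
    using a_coset_add_zero[OF a_subset] by (simp_all add: FactRing_def)
qed

lemma coset_eq_iff:
  assumes "a \<in> carrier R" "b \<in> carrier R"
  shows "I n +> a = I n +> b \<longleftrightarrow> a \<ominus> b \<in> I n"
proof -
  interpret ideal "I n" R by (rule I_ideal)
  show ?thesis using quotient_eq_iff_same_a_r_cos[OF I_ideal assms] by simp
qed

lemma coset_zero_iff: "a \<in> carrier R \<Longrightarrow> I n +> a = I n +> \<zero> \<longleftrightarrow> a \<in> I n"
  using coset_eq_iff[of a \<zero> n] by (simp add: minus_eq)

lemma I_mono: "I (Suc n) \<subseteq> I n"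
proof
  fix x assume "x \<in> I (Suc n)"
  then obtain y where "y \<in> carrier R" "x = (y \<otimes> w) \<otimes> w [^] n" by (auto simp: mem_I m_ac nat_pow_Suc)
  then show "x \<in> I n" by (auto simp: mem_I)
qed

lemma coset_mono: "I (Suc n) +> a \<subseteq> I n +> a"
  using I_mono by (auto simp: a_r_coset_def')

lemma coset_self: "a \<in> carrier R \<Longrightarrow> a \<in> I n +> a"
  using abelian_subgroup.a_rcos_self[OF abelian_subgroupI3[OF ideal.axioms(1)[OF I_ideal] is_abelian_group]] .

lemma coset_mem:
  assumes "X \<in> carrier (Q n)" "a \<in> X" shows "a \<in> carrier R" "X = I n +> a"
proof -
  obtain b where b: "b \<in> carrier R" "X = I n +> b"
    using assms(1) by (auto simp: FactRing_simps)
  interpret ideal "I n" R by (rule I_ideal)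
  show "a \<in> carrier R" using assms(2) b a_r_coset_subset_G[OF a_subset b(1)] by auto
  show "X = I n +> a" using b assms(2) a_repr_independence[OF _ b(1) a_subgroup] by blast
qed

lemma C_carrier: "s \<in> carrier C \<longleftrightarrow> (\<forall>n. s n \<in> carrier (Q n) \<and> s (Suc n) \<subseteq> s n)"
  by (simp add: adic_completion_def ideal_pow_cgenideal I_def[symmetric])

lemma C_simps:
  "mult C = (\<lambda>s t n. s n \<otimes>\<^bsub>Q n\<^esub> t n)" "one C = (\<lambda>n. I n +> \<one>)" "zero C = (\<lambda>n. I n +> \<zero>)"
  "add C = (\<lambda>s t n. s n \<oplus>\<^bsub>Q n\<^esub> t n)" "of_R a = (\<lambda>n. I n +> a)"
  by (simp_all add: adic_completion_def ideal_pow_cgenideal I_def[symmetric] to_completion_def Q_simps[of \<zero> \<zero>])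

text \<open>A common representative at two consecutive levels is all that compatibility asks for, so
  closure under the operations reduces to computations with one representative.\<close>

lemma C_rep:
  assumes "s \<in> carrier C"
  obtains a where "a \<in> carrier R" "s (Suc n) = I (Suc n) +> a" "s n = I n +> a"
proof -
  have s: "s (Suc n) \<in> carrier (Q (Suc n))" "s n \<in> carrier (Q n)" "s (Suc n) \<subseteq> s n"
    using assms by (auto simp: C_carrier)
  obtain a where a: "a \<in> carrier R" "s (Suc n) = I (Suc n) +> a"
    using s(1) by (auto simp: FactRing_simps)
  then have "a \<in> s n" using coset_self s(3) by auto
  with s(2) a show ?thesis using that coset_mem by blast
qed

lemma C_closedI:
  assumes "\<And>n. \<exists>a\<in>carrier R. s (Suc n) = I (Suc n) +> a \<and> s n = I n +> a"
  shows "s \<in> carrier C"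
  unfolding C_carrier
proof (intro allI conjI)
  fix n
  obtain a where "a \<in> carrier R" "s (Suc n) = I (Suc n) +> a" "s n = I n +> a"
    using assms by blast
  then show "s n \<in> carrier (Q n)" "s (Suc n) \<subseteq> s n"
    using Q_simps(3) coset_mono by auto
qed

lemma C_closed:
  assumes "s \<in> carrier C" "t \<in> carrier C"
  shows "s \<oplus>\<^bsub>C\<^esub> t \<in> carrier C" "s \<otimes>\<^bsub>C\<^esub> t \<in> carrier C"
proof -
  have "\<exists>a\<in>carrier R. (s \<oplus>\<^bsub>C\<^esub> t) (Suc n) = I (Suc n) +> a \<and> (s \<oplus>\<^bsub>C\<^esub> t) n = I n +> a"
    "\<exists>a\<in>carrier R. (s \<otimes>\<^bsub>C\<^esub> t) (Suc n) = I (Suc n) +> a \<and> (s \<otimes>\<^bsub>C\<^esub> t) n = I n +> a" for n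
  proof -
    obtain a where a: "a \<in> carrier R" "s (Suc n) = I (Suc n) +> a" "s n = I n +> a"
      using assms(1) by (rule C_rep)
    obtain b where b: "b \<in> carrier R" "t (Suc n) = I (Suc n) +> b" "t n = I n +> b"
      using assms(2) by (rule C_rep)
    show "\<exists>a\<in>carrier R. (s \<oplus>\<^bsub>C\<^esub> t) (Suc n) = I (Suc n) +> a \<and> (s \<oplus>\<^bsub>C\<^esub> t) n = I n +> a"
      using a b by (intro bexI[of _ "a \<oplus> b"]) (simp_all add: C_simps Q_simps)
    show "\<exists>a\<in>carrier R. (s \<otimes>\<^bsub>C\<^esub> t) (Suc n) = I (Suc n) +> a \<and> (s \<otimes>\<^bsub>C\<^esub> t) n = I n +> a"
      using a b by (intro bexI[of _ "a \<otimes> b"]) (simp_all add: C_simps Q_simps)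
  qed
  then show "s \<oplus>\<^bsub>C\<^esub> t \<in> carrier C" "s \<otimes>\<^bsub>C\<^esub> t \<in> carrier C" by - (rule C_closedI, blast)+
qed

lemma of_R_closed: "a \<in> carrier R \<Longrightarrow> of_R a \<in> carrier C"
  by (rule C_closedI) (auto simp: C_simps)

lemma C_cring: "cring C"
proof (rule cringI)
  have zo: "\<zero>\<^bsub>C\<^esub> \<in> carrier C" "\<one>\<^bsub>C\<^esub> \<in> carrier C"
    using of_R_closed[of \<zero>] of_R_closed[of \<one>] by (simp_all add: C_simps)
  have c: "s \<in> carrier C \<Longrightarrow> s n \<in> carrier (Q n)" for s n by (simp add: C_carrier)
  note Qa = cring.cring_simprules[OF Q_cring]
  have z: "I n +> \<zero> = \<zero>\<^bsub>Q n\<^esub>" "I n +> \<one> = \<one>\<^bsub>Q n\<^esub>" for n by (simp_all add: Q_simps[of \<zero> \<zero>])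
  show "abelian_group C"
  proof (rule abelian_groupI)
    fix s assume s: "s \<in> carrier C"
    define t where "t = (\<lambda>n. \<ominus>\<^bsub>Q n\<^esub> s n)"
    have "t \<in> carrier C"
    proof (rule C_closedI)
      fix n
      obtain a where a: "a \<in> carrier R" "s (Suc n) = I (Suc n) +> a" "s n = I n +> a"
        using s by (rule C_rep)
      have "\<ominus>\<^bsub>Q m\<^esub> (I m +> a) = I m +> (\<ominus> a)" for m
        using ring_hom_cring.hom_a_inv[OF ideal.rcos_ring_hom_cring[OF I_ideal is_cring] a(1)] by simp
      then show "\<exists>a\<in>carrier R. t (Suc n) = I (Suc n) +> a \<and> t n = I n +> a"
        using a by (intro bexI[of _ "\<ominus> a"]) (simp_all add: t_def)
    qed
    moreover have "t \<oplus>\<^bsub>C\<^esub> s = \<zero>\<^bsub>C\<^esub>"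
      unfolding C_simps t_def z by (rule ext) (use s in \<open>simp add: Qa c\<close>)
    ultimately show "\<exists>t\<in>carrier C. t \<oplus>\<^bsub>C\<^esub> s = \<zero>\<^bsub>C\<^esub>" by blast
  next
    fix s t u assume *: "s \<in> carrier C" "t \<in> carrier C" "u \<in> carrier C"
    show "s \<oplus>\<^bsub>C\<^esub> t \<oplus>\<^bsub>C\<^esub> u = s \<oplus>\<^bsub>C\<^esub> (t \<oplus>\<^bsub>C\<^esub> u)"
      unfolding C_simps by (rule ext) (simp add: Qa c *)
  next
    fix s t assume *: "s \<in> carrier C" "t \<in> carrier C"
    show "s \<oplus>\<^bsub>C\<^esub> t = t \<oplus>\<^bsub>C\<^esub> s"
      unfolding C_simps by (rule ext) (simp add: Qa c *)
  next
    fix s assume *: "s \<in> carrier C"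
    show "\<zero>\<^bsub>C\<^esub> \<oplus>\<^bsub>C\<^esub> s = s"
      unfolding C_simps z by (rule ext) (simp add: Qa c * monoid.r_one[OF ring.is_monoid[OF cring.axioms(1)[OF Q_cring]]])
  qed (use zo C_closed in auto)
  show "comm_monoid C"
  proof (rule comm_monoidI)
    fix s t u assume *: "s \<in> carrier C" "t \<in> carrier C" "u \<in> carrier C"
    show "s \<otimes>\<^bsub>C\<^esub> t \<otimes>\<^bsub>C\<^esub> u = s \<otimes>\<^bsub>C\<^esub> (t \<otimes>\<^bsub>C\<^esub> u)"
      unfolding C_simps by (rule ext) (simp add: Qa c *)
  next
    fix s t assume *: "s \<in> carrier C" "t \<in> carrier C"
    show "s \<otimes>\<^bsub>C\<^esub> t = t \<otimes>\<^bsub>C\<^esub> s"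
      unfolding C_simps by (rule ext) (simp add: Qa c *)
  next
    fix s assume *: "s \<in> carrier C"
    show "\<one>\<^bsub>C\<^esub> \<otimes>\<^bsub>C\<^esub> s = s"
      unfolding C_simps z by (rule ext) (simp add: Qa c * monoid.r_one[OF ring.is_monoid[OF cring.axioms(1)[OF Q_cring]]])
  qed (use zo C_closed in auto)
  fix s t u assume *: "s \<in> carrier C" "t \<in> carrier C" "u \<in> carrier C"
  show "(s \<oplus>\<^bsub>C\<^esub> t) \<otimes>\<^bsub>C\<^esub> u = s \<otimes>\<^bsub>C\<^esub> u \<oplus>\<^bsub>C\<^esub> t \<otimes>\<^bsub>C\<^esub> u"
    unfolding C_simps by (rule ext) (simp add: Qa c *)
qed

lemma of_R_hom: "of_R \<in> ring_hom R C"
  by (rule ring_hom_memI) (auto simp: of_R_closed, auto simp: C_simps Q_simps)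

lemma of_R_hom_cring: "ring_hom_cring R C of_R"
  using of_R_hom C_cring is_cring by (intro ring_hom_cringI ring_hom_ringI2 cring.axioms(1))

lemma of_R_pow: "of_R (w [^] n) = of_R w [^]\<^bsub>C\<^esub> (n::nat)"
  by (rule ring_hom_cring.hom_pow[OF of_R_hom_cring w_closed])

text \<open>Vanishing at level 1 makes every representative divisible by \<open>w\<close>; the
  quotients, chosen level by level, form a compatible family by \<open>w_cancel\<close>.\<close>

lemma C_divisible:
  assumes s: "s \<in> carrier C" and "s 1 = I 1 +> \<zero>"
  shows "\<exists>z\<in>carrier C. s = of_R w \<otimes>\<^bsub>C\<^esub> z"
proof -
  have sub: "s (Suc n) \<subseteq> s n" for n using s by (simp add: C_carrier)
  have s1: "s (Suc n) \<subseteq> s 1" for n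
    by (induction n) (use sub in \<open>auto\<close>)
  have "\<exists>a. a \<in> carrier R \<and> s (Suc n) = I (Suc n) +> (w \<otimes> a)" for n
  proof -
    obtain b where b: "b \<in> carrier R" "s (Suc n) = I (Suc n) +> b" "s n = I n +> b"
      using s by (rule C_rep)
    then have "b \<in> I 1 +> \<zero>" using coset_self[OF b(1), of "Suc n"] s1[of n] assms(2) by auto
    then have "b \<in> I 1"
      using coset_mem[of "I 1 +> \<zero>" 1 b] coset_zero_iff[of b 1] b(1) Q_simps(3)[of \<zero> \<zero>] by auto
    then obtain a where "a \<in> carrier R" "b = a \<otimes> w [^] (1::nat)" by (auto simp: mem_I)
    then show ?thesis using b by (auto simp: m_comm)
  qed
  then obtain a where a: "\<And>n. a n \<in> carrier R" "\<And>n. s (Suc n) = I (Suc n) +> (w \<otimes> a n)" by metis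
  \<comment> \<open>The index drops by one: \<open>w \<otimes> a n\<close> is prescribed modulo
    w^(n+1), which determines \<open>a n\<close> only modulo w^n.\<close>
  define z where "z = (\<lambda>n. I n +> a n)"
  have eq: "I n +> a n = I n +> a (Suc n)" for n
  proof -
    have "w \<otimes> a (Suc n) \<in> s (Suc n)"
      using coset_self[of "w \<otimes> a (Suc n)" "Suc (Suc n)"] a(1) a(2)[of "Suc n"] sub[of "Suc n"]
      by (simp) blast
    then have "I (Suc n) +> (w \<otimes> a n) = I (Suc n) +> (w \<otimes> a (Suc n))"
      using coset_mem(2)[of "s (Suc n)" "Suc n" "w \<otimes> a (Suc n)"] s a(2)[of n] unfolding C_carrier by metis
    then have "w \<otimes> a n \<ominus> w \<otimes> a (Suc n) \<in> I (Suc n)"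
      using coset_eq_iff a by (simp)
    moreover have "w \<otimes> a n \<ominus> w \<otimes> a (Suc n) = w \<otimes> (a n \<ominus> a (Suc n))"
      using a by (simp add: minus_eq r_distr r_minus)
    ultimately have "a n \<ominus> a (Suc n) \<in> I n"
      using I_cancel a by (simp)
    then show ?thesis using coset_eq_iff a by simp
  qed
  have "z \<in> carrier C"
    by (rule C_closedI) (use a(1) eq in \<open>auto simp: z_def\<close>)
  moreover have "s = of_R w \<otimes>\<^bsub>C\<^esub> z"
  proof
    fix n
    have "w \<otimes> a n \<in> s n"
      using coset_self[of "w \<otimes> a n" "Suc n"] a(1) a(2)[of n] sub[of n]
      by (simp) blast
    then have "s n = I n +> (w \<otimes> a n)"
      using coset_mem(2)[of "s n" n "w \<otimes> a n"] s by (simp add: C_carrier)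
    then show "s n = (of_R w \<otimes>\<^bsub>C\<^esub> z) n"
      using a by (simp add: C_simps z_def Q_simps)
  qed
  ultimately show ?thesis by blast
qed

text \<open>The product at level n + 1 decides the factor at level n, again with the loss of one
  level.\<close>

lemma C_w_cancel:
  assumes z: "z \<in> carrier C" and "of_R w \<otimes>\<^bsub>C\<^esub> z = \<zero>\<^bsub>C\<^esub>" shows "z = \<zero>\<^bsub>C\<^esub>"
proof
  fix n
  obtain a where a: "a \<in> carrier R" "z (Suc n) = I (Suc n) +> a" "z n = I n +> a"
    using z by (rule C_rep)
  have "I (Suc n) +> (w \<otimes> a) = I (Suc n) +> \<zero>"
    using fun_cong[OF assms(2), of "Suc n"] a by (simp add: C_simps Q_simps)
  then have "a \<in> I n" using coset_zero_iff I_cancel a by (simp)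
  then show "z n = \<zero>\<^bsub>C\<^esub> n" using a coset_zero_iff by (simp add: C_simps)
qed

lemma C_separated:
  fixes s :: "nat \<Rightarrow> 'a set"
  assumes "\<And>n::nat. \<exists>y\<in>carrier C. s = of_R w [^]\<^bsub>C\<^esub> n \<otimes>\<^bsub>C\<^esub> y" shows "s = \<zero>\<^bsub>C\<^esub>"
proof
  fix n
  obtain y where y: "y \<in> carrier C" "s = of_R w [^]\<^bsub>C\<^esub> (n::nat) \<otimes>\<^bsub>C\<^esub> y" using assms[of n] by (elim bexE)
  obtain a where a: "a \<in> carrier R" "y (Suc n) = I (Suc n) +> a" "y n = I n +> a"
    using y(1) by (rule C_rep)
  have "s n = I n +> (w [^] n \<otimes> a)"
    unfolding y(2) of_R_pow[symmetric] using a by (simp add: C_simps Q_simps)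
  moreover have "w [^] n \<otimes> a \<in> I n" using a by (auto simp: mem_I m_comm)
  ultimately show "s n = \<zero>\<^bsub>C\<^esub> n" using coset_zero_iff a by (simp add: C_simps)
qed

end

section \<open>Nonarchimedean norms\<close>

lemma nonarch_normD:
  fixes nm :: "'a::field \<Rightarrow> real"
  assumes "nonarch_norm nm"
  shows "nm x \<ge> 0" "nm x = 0 \<longleftrightarrow> x = 0" "nm 0 = 0" "nm 1 = 1" "nm (x * y) = nm x * nm y"
    "nm (- x) = nm x" "nm (x + y) \<le> max (nm x) (nm y)" "nm (x - y) \<le> max (nm x) (nm y)"
    "nm (x ^ n) = nm x ^ n" "nm (x / y) = nm x / nm y"
proof -
  show 1: "nm x \<ge> 0" "nm x = 0 \<longleftrightarrow> x = 0" "nm 0 = 0" "nm (x * y) = nm x * nm y"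
    "nm (x + y) \<le> max (nm x) (nm y)" for x y
    using assms by (auto simp: nonarch_norm_def)
  have "nm 1 = nm 1 * nm 1" using 1(4)[of 1 1] by simp
  then show 2: "nm 1 = 1" using 1(2)[of 1] by simp
  have "nm (- 1) * nm (- 1) = 1" using 1(4)[of "-1" "-1"] 2 by simp
  then have "nm (- 1) = 1" using 1(1)[of "-1"] by (simp add: square_eq_1_iff)
  then show 3: "nm (- x) = nm x" for x using 1(4)[of "-1" x] by simp
  show "nm (x - y) \<le> max (nm x) (nm y)" using 1(5)[of x "- y"] 3[of y] by simp
  show "nm (x ^ n) = nm x ^ n" by (induction n) (simp_all add: 1 2)
  show "nm (x / y) = nm x / nm y"
  proof (cases "y = 0")
    case True
    then show ?thesis using 1(3) by simp
  next
    case False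
    have "nm (x / y) * nm y = nm x" using False by (simp only: 1(4)[symmetric]) simp
    then show ?thesis using False 1(2)[of y] by (simp add: field_simps)
  qed
qed

section \<open>Rings with Teichmueller expansions\<close>

text \<open>The axioms say that reduction modulo the regular element \<open>w\<close> is the unit
  ball of \<open>nm\<close>, with \<open>t\<close> a multiplicative section, and that the
  \<open>w\<close>-adic topology is separated. The real number \<open>p\<close> is the base of the
  weights in the norm.\<close>

locale expansion_ring = cring +
  fixes w :: 'a and t :: "'l::field \<Rightarrow> 'a" and nm :: "'l \<Rightarrow> real" and p :: real
  assumes nm: "nonarch_norm nm"
    and p_gt_1: "p > 1"
    and w_closed [simp, intro]: "w \<in> carrier R"
    and t_closed [simp, intro]: "nm a \<le> 1 \<Longrightarrow> t a \<in> carrier R"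
    and t_mult: "nm a \<le> 1 \<Longrightarrow> nm b \<le> 1 \<Longrightarrow> t (a * b) = t a \<otimes> t b"
    and t_one [simp]: "t 1 = \<one>"
    and t_zero [simp]: "t 0 = \<zero>"
    and t_add: "nm a \<le> 1 \<Longrightarrow> nm b \<le> 1 \<Longrightarrow> \<exists>y\<in>carrier R. t a \<oplus> t b = t (a + b) \<oplus> w \<otimes> y"
    and ex_decomp: "x \<in> carrier R \<Longrightarrow> \<exists>a y. nm a \<le> 1 \<and> y \<in> carrier R \<and> x = t a \<oplus> w \<otimes> y"
    and t_inj_mod: "nm a \<le> 1 \<Longrightarrow> nm b \<le> 1 \<Longrightarrow> y \<in> carrier R \<Longrightarrow> t a = t b \<oplus> w \<otimes> y \<Longrightarrow> a = b"
    and w_cancel0: "x \<in> carrier R \<Longrightarrow> w \<otimes> x = \<zero> \<Longrightarrow> x = \<zero>"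
    and separated: "(\<And>n::nat. \<exists>y\<in>carrier R. x = w [^] n \<otimes> y) \<Longrightarrow> x = \<zero>"
begin

lemmas nm_norm = nonarch_normD[OF nm]

lemma nm_simps [simp]:
  "nm x \<ge> 0" "nm x = 0 \<longleftrightarrow> x = 0" "nm 0 = 0" "nm 1 = 1" "nm (x * y) = nm x * nm y"
  by (rule nm_norm)+

lemma nm_pos: "nm x > 0 \<longleftrightarrow> x \<noteq> 0"
  using nm_simps(1)[of x] nm_simps(2)[of x] by linarith

lemma nm_add_eq: "nm y < nm x \<Longrightarrow> nm (x + y) = nm x"
  using nm_norm(7)[of x y] nm_norm(8)[of "x + y" y] by auto

lemma w_pow_closed [simp, intro]: "w [^] (n::nat) \<in> carrier R"
  by simp

lemma w_cancel: "x \<in> carrier R \<Longrightarrow> y \<in> carrier R \<Longrightarrow> w \<otimes> x = w \<otimes> y \<Longrightarrow> x = y"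
proof -
  assume *: "x \<in> carrier R" "y \<in> carrier R" "w \<otimes> x = w \<otimes> y"
  have "w \<otimes> (x \<ominus> y) = w \<otimes> x \<ominus> w \<otimes> y" using *(1,2) w_closed by algebra
  also have "\<dots> = \<zero>" using * by (simp add: r_neg minus_eq)
  finally have "x \<ominus> y = \<zero>" using w_cancel0 * by simp
  moreover have "x = (x \<ominus> y) \<oplus> y" using *(1,2) by algebra
  ultimately show "x = y" using * by simp
qed

subsection \<open>Coefficients\<close>

text \<open>With \<open>tl\<close>, the first Teichmueller coefficient and the rest divided by
  \<open>w\<close>. Coefficients are obtained by iterating the two, so that proofs are inductions on
  the index and no limits occur; the link with convergent sums comes at the end.\<close>

definition hd :: "'a \<Rightarrow> 'l" where
  "hd x = (SOME a. nm a \<le> 1 \<and> (\<exists>y\<in>carrier R. x = t a \<oplus> w \<otimes> y))"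

definition tl :: "'a \<Rightarrow> 'a" where
  "tl x = (SOME y. y \<in> carrier R \<and> x = t (hd x) \<oplus> w \<otimes> y)"

lemma hd_tl:
  assumes "x \<in> carrier R"
  shows "nm (hd x) \<le> 1" "tl x \<in> carrier R" "x = t (hd x) \<oplus> w \<otimes> tl x"
proof -
  have "\<exists>a. nm a \<le> 1 \<and> (\<exists>y\<in>carrier R. x = t a \<oplus> w \<otimes> y)" using ex_decomp[OF assms] by blast
  from someI_ex[OF this, folded hd_def]
  have *: "nm (hd x) \<le> 1" "\<exists>y. y \<in> carrier R \<and> x = t (hd x) \<oplus> w \<otimes> y" by auto
  show "nm (hd x) \<le> 1" by (rule *)
  from someI_ex[OF *(2), folded tl_def]
  show "tl x \<in> carrier R" "x = t (hd x) \<oplus> w \<otimes> tl x" by auto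
qed

lemma hd_tl_unique:
  assumes a: "nm a \<le> 1" and y: "y \<in> carrier R" and x: "x = t a \<oplus> w \<otimes> y"
  shows "hd x = a" "tl x = y"
proof -
  have xc: "x \<in> carrier R" using a y x by simp
  note h = hd_tl[OF xc]
  have c: "t a \<in> carrier R" "t (hd x) \<in> carrier R" using a h by auto
  have "t a = (t a \<oplus> w \<otimes> y) \<ominus> w \<otimes> y" using c y w_closed by algebra
  also have "\<dots> = (t (hd x) \<oplus> w \<otimes> tl x) \<ominus> w \<otimes> y" by (simp only: x[symmetric] h(3)[symmetric])
  also have "\<dots> = t (hd x) \<oplus> w \<otimes> (tl x \<ominus> y)" using c y w_closed h(2) by algebra
  finally have "t a = t (hd x) \<oplus> w \<otimes> (tl x \<ominus> y)" .
  then show 1: "hd x = a" using t_inj_mod[of a "hd x" "tl x \<ominus> y"] a h y by simp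
  have "t (hd x) \<oplus> w \<otimes> tl x = t a \<oplus> w \<otimes> y" by (simp only: x[symmetric] h(3)[symmetric])
  then have "t a \<oplus> w \<otimes> tl x = t a \<oplus> w \<otimes> y" by (simp only: 1)
  then have "w \<otimes> tl x = w \<otimes> y" using c y h(2) by simp
  then show "tl x = y" using w_cancel h(2) y by blast
qed

primrec co :: "'a \<Rightarrow> nat \<Rightarrow> 'l" where
  "co x 0 = hd x" |
  "co x (Suc n) = co (tl x) n"

lemma co_le_1: "x \<in> carrier R \<Longrightarrow> nm (co x n) \<le> 1"
  by (induction n arbitrary: x) (simp_all add: hd_tl)

lemma co_step:
  assumes a: "nm a \<le> 1" and y: "y \<in> carrier R"
  shows "co (t a \<oplus> w \<otimes> y) 0 = a" "co (t a \<oplus> w \<otimes> y) (Suc n) = co y n"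
  using hd_tl_unique[OF a y refl] by auto

lemma co_w_mult:
  assumes "x \<in> carrier R" shows "co (w \<otimes> x) 0 = 0" "co (w \<otimes> x) (Suc n) = co x n"
  using co_step[of 0 x] assms by simp_all

lemma co_t:
  assumes "nm a \<le> 1" shows "co (t a) n = (if n = 0 then a else 0)"
proof -
  have z: "co \<zero> n = 0" for n
    by (induction n) (use hd_tl_unique[of 0 "\<zero>" "\<zero>"] in auto)
  have "t a = t a \<oplus> w \<otimes> \<zero>" using assms by simp
  then show ?thesis using co_step[OF assms zero_closed] z by (cases n) auto
qed

lemma co_zero [simp]: "co \<zero> n = 0"
  using co_t[of 0 n] by simp

lemma hd_add:
  assumes "x \<in> carrier R" "y \<in> carrier R" shows "hd (x \<oplus> y) = hd x + hd y"
proof -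
  note h = hd_tl[OF assms(1)] hd_tl[OF assms(2)]
  obtain z where z: "z \<in> carrier R" "t (hd x) \<oplus> t (hd y) = t (hd x + hd y) \<oplus> w \<otimes> z"
    using t_add h by blast
  have l: "nm (hd x + hd y) \<le> 1" using nm_norm(7)[of "hd x" "hd y"] h by linarith
  have c: "t (hd x) \<in> carrier R" "t (hd y) \<in> carrier R" "t (hd x + hd y) \<in> carrier R" using h l by auto
  have "x \<oplus> y = (t (hd x) \<oplus> w \<otimes> tl x) \<oplus> (t (hd y) \<oplus> w \<otimes> tl y)" by (simp only: h(3,6)[symmetric])
  also have "\<dots> = (t (hd x) \<oplus> t (hd y)) \<oplus> w \<otimes> (tl x \<oplus> tl y)" using c h(2,5) w_closed by algebra
  also have "\<dots> = t (hd x + hd y) \<oplus> w \<otimes> (z \<oplus> (tl x \<oplus> tl y))" unfolding z(2) using c h(2,5) z(1) w_closed by algebra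
  finally show ?thesis by (rule hd_tl_unique(1)[OF l, rotated]) (use h(2,5) z(1) in simp)
qed

text \<open>Multiplicativity of \<open>t\<close> means that no carries arise, in contrast to
  addition. All bounds on carries rest on this.\<close>

lemma co_t_mult:
  assumes "nm a \<le> 1" "x \<in> carrier R" shows "co (t a \<otimes> x) n = a * co x n"
  using assms(2)
proof (induction n arbitrary: x)
  have eq: "t a \<otimes> x = t (a * hd x) \<oplus> w \<otimes> (t a \<otimes> tl x)" "nm (a * hd x) \<le> 1" "t a \<otimes> tl x \<in> carrier R"
    if x: "x \<in> carrier R" for x
  proof -
    note h = hd_tl[OF x]
    have c: "t a \<in> carrier R" "t (hd x) \<in> carrier R" using assms h by auto
    have "t a \<otimes> x = t a \<otimes> (t (hd x) \<oplus> w \<otimes> tl x)" by (simp add: h(3)[symmetric])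
    also have "\<dots> = t a \<otimes> t (hd x) \<oplus> w \<otimes> (t a \<otimes> tl x)" using c h(2) w_closed by algebra
    finally show "t a \<otimes> x = t (a * hd x) \<oplus> w \<otimes> (t a \<otimes> tl x)" using t_mult assms h by simp
    show "nm (a * hd x) \<le> 1" using assms h by (simp add: mult_le_one)
    show "t a \<otimes> tl x \<in> carrier R" using c h by simp
  qed
  {
    case 0
    then show ?case using eq[of x] co_step by simp
  next
    case (Suc n)
    then show ?case using eq[of x] co_step hd_tl(2)[of x] by simp
  }
qed

lemma co_add_w_pow:
  assumes "x \<in> carrier R" "z \<in> carrier R" "i < k"
  shows "co (x \<oplus> w [^] k \<otimes> z) i = co x i"
  using assms
proof (induction k arbitrary: x i)
  case (Suc k)
  note h = hd_tl[OF Suc.prems(1)] and hh = hd_tl(1,2)[OF Suc.prems(1)]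
  have c: "t (hd x) \<in> carrier R" "w [^] k \<in> carrier R" using hh by auto
  have "x \<oplus> w [^] Suc k \<otimes> z = (t (hd x) \<oplus> w \<otimes> tl x) \<oplus> (w [^] k \<otimes> w) \<otimes> z" by (simp add: h(3)[symmetric])
  also have "\<dots> = t (hd x) \<oplus> w \<otimes> (tl x \<oplus> w [^] k \<otimes> z)"
    using c h(2) Suc.prems(2) w_closed by algebra
  finally have eq: "x \<oplus> w [^] Suc k \<otimes> z = t (hd x) \<oplus> w \<otimes> (tl x \<oplus> w [^] k \<otimes> z)" .
  show ?case
  proof (cases i)
    case 0
    then show ?thesis unfolding eq using co_step(1)[of "hd x" "tl x \<oplus> w [^] k \<otimes> z"] hh Suc.prems by simp
  next
    case (Suc j)
    then show ?thesis unfolding eq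
      using co_step(2)[of "hd x" "tl x \<oplus> w [^] k \<otimes> z" j] hh Suc.prems Suc.IH[of "tl x" j] by simp
  qed
qed simp

text \<open>A sum of two elements whose first \<open>k\<close> coefficients have norm at most \<open>nm a\<close> is, modulo
  \<open>w [^] k\<close>, a multiple of \<open>t a\<close>. This bounds the coefficients of sums without any knowledge of the
  carry polynomials.\<close>

lemma ex_scaled:
  assumes "x \<in> carrier R" "nm a \<le> 1" "\<And>i. i < k \<Longrightarrow> nm (co x i) \<le> nm a"
  shows "\<exists>y\<in>carrier R. \<exists>z\<in>carrier R. x = t a \<otimes> y \<oplus> w [^] k \<otimes> z"
  using assms
proof (induction k arbitrary: x)
  case 0
  then show ?case by (intro bexI[of _ "\<zero>"] bexI[of _ x]) simp_all
next
  case (Suc k)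
  note h = hd_tl[OF Suc.prems(1)] and hh = hd_tl(1,2)[OF Suc.prems(1)]
  have "nm (co (tl x) i) \<le> nm a" if "i < k" for i using Suc.prems(3)[of "Suc i"] that by simp
  with Suc.IH[of "tl x"] hh Suc.prems(2) obtain y z where
    yz: "y \<in> carrier R" "z \<in> carrier R" "tl x = t a \<otimes> y \<oplus> w [^] k \<otimes> z" by blast
  \<comment> \<open>If \<open>a\<close> is 0 then so is \<open>hd x\<close>, and \<open>b\<close> is
    0 by the convention for division.\<close>
  define b where "b = hd x / a"
  have le: "nm (hd x) \<le> nm a" using Suc.prems(3)[of 0] by simp
  have b: "nm b \<le> 1" "a * b = hd x"
  proof -
    have "a = 0 \<Longrightarrow> hd x = 0" using le nm_simps(1)[of "hd x"] nm_simps(2)[of "hd x"] by simp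
    moreover have "nm a > 0" if "a \<noteq> 0" using nm_simps(1)[of a] nm_simps(2)[of a] that by linarith
    ultimately show "nm b \<le> 1" "a * b = hd x"
      using le by (cases "a = 0"; simp add: b_def nm_norm(10) divide_le_eq_1)+
  qed
  have c: "t a \<in> carrier R" "t b \<in> carrier R" "w [^] k \<in> carrier R" using b Suc.prems by auto
  have "x = t a \<otimes> t b \<oplus> w \<otimes> (t a \<otimes> y \<oplus> w [^] k \<otimes> z)"
  proof -
    have "t a \<otimes> t b = t (hd x)" using t_mult[OF Suc.prems(2) b(1)] b(2) by simp
    then show ?thesis by (simp add: h(3)[symmetric] yz(3)[symmetric])
  qed
  also have "\<dots> = t a \<otimes> (t b \<oplus> w \<otimes> y) \<oplus> (w [^] k \<otimes> w) \<otimes> z"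
    using c yz(1,2) w_closed by algebra
  finally show ?case using c yz by (intro bexI[of _ "t b \<oplus> w \<otimes> y"] bexI[of _ z]) simp_all
qed

text \<open>Covers closed and open balls alike, so that one estimate of carries gives both the weak
  and the strict inequalities about peaks.\<close>

definition down_closed :: "'l set \<Rightarrow> bool" where
  "down_closed J \<longleftrightarrow> 0 \<in> J \<and> (\<forall>a\<in>J. \<forall>b. nm b \<le> nm a \<longrightarrow> b \<in> J)"

lemma down_closedI:
  "c \<ge> 0 \<Longrightarrow> down_closed {a. nm a \<le> c}" "c > 0 \<Longrightarrow> down_closed {a. nm a < c}"
  by (auto simp: down_closed_def)

definition coideal :: "nat \<Rightarrow> 'l set \<Rightarrow> 'a set" where
  "coideal k J = {x\<in>carrier R. \<forall>i<k. co x i \<in> J}"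

lemma coideal_scaled:
  assumes J: "down_closed J" and a: "a \<in> J" "nm a \<le> 1" and y: "y \<in> carrier R" "z \<in> carrier R"
  shows "t a \<otimes> y \<oplus> w [^] k \<otimes> z \<in> coideal k J"
  unfolding coideal_def
proof (intro CollectI conjI allI impI)
  show "t a \<otimes> y \<oplus> w [^] k \<otimes> z \<in> carrier R" using a y by simp
  fix i assume "i < k"
  then have "co (t a \<otimes> y \<oplus> w [^] k \<otimes> z) i = a * co y i"
    using co_add_w_pow[of "t a \<otimes> y" z i k] co_t_mult a y by simp
  moreover have "nm (a * co y i) \<le> nm a"
    using co_le_1[OF y(1)] by (simp add: mult_left_le)
  ultimately show "co (t a \<otimes> y \<oplus> w [^] k \<otimes> z) i \<in> J" using J a by (auto simp: down_closed_def)
qed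

lemma ex_max_nm:
  assumes "finite S" "S \<noteq> {}" shows "\<exists>a\<in>S. \<forall>b\<in>S. nm b \<le> nm a"
proof -
  have "Max (nm ` S) \<in> nm ` S" using assms by simp
  then obtain a where "a \<in> S" "nm a = Max (nm ` S)" by auto
  then show ?thesis using assms by (intro bexI[of _ a]) auto
qed

text \<open>Let a be a coefficient of largest norm among the first k of both summands. Both are
  multiples of [a] modulo w^k, hence so is the sum.\<close>

lemma coideal_add:
  assumes J: "down_closed J" and "x \<in> coideal k J" "y \<in> coideal k J"
  shows "x \<oplus> y \<in> coideal k J"
proof -
  \<comment> \<open>The element 0 is inserted so that a maximum exists also for k = 0.\<close>
  define S where "S = insert 0 (co x ` {..<k} \<union> co y ` {..<k})"
  have S: "S \<subseteq> J" "\<And>a. a \<in> S \<Longrightarrow> nm a \<le> 1"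
    using assms co_le_1 by (auto simp: S_def coideal_def down_closed_def)
  obtain a where a: "a \<in> S" "\<And>b. b \<in> S \<Longrightarrow> nm b \<le> nm a"
    using ex_max_nm[of S] unfolding S_def by (metis finite_UnI finite_imageI finite_insert finite_lessThan insert_not_empty)
  have xy: "x \<in> carrier R" "y \<in> carrier R" using assms by (auto simp: coideal_def)
  obtain x' z where x: "x' \<in> carrier R" "z \<in> carrier R" "x = t a \<otimes> x' \<oplus> w [^] k \<otimes> z"
    using ex_scaled[of x a k] a S xy by (auto simp: S_def)
  obtain y' z' where y: "y' \<in> carrier R" "z' \<in> carrier R" "y = t a \<otimes> y' \<oplus> w [^] k \<otimes> z'"
    using ex_scaled[of y a k] a S xy by (auto simp: S_def)
  have c: "t a \<in> carrier R" "w [^] k \<in> carrier R" using S a by auto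
  have "x \<oplus> y = t a \<otimes> (x' \<oplus> y') \<oplus> w [^] k \<otimes> (z \<oplus> z')"
    unfolding x(3) y(3) using c x(1,2) y(1,2) by algebra
  then show ?thesis using coideal_scaled[OF J, of a "x' \<oplus> y'" "z \<oplus> z'" k] a S x y by auto
qed

text \<open>Carries only move to higher indices, so the first k coefficients of a product involve
  only products of coefficients with index sum below k.\<close>

lemma coideal_prod:
  assumes J: "down_closed J" and "x \<in> carrier R" "y \<in> carrier R"
    and "\<And>i j. i + j < k \<Longrightarrow> co x i * co y j \<in> J"
  shows "x \<otimes> y \<in> coideal k J"
  using assms(2,4)
proof (induction k arbitrary: x)
  case 0
  then show ?case using assms(3) by (simp add: coideal_def)
next
  case (Suc k)
  note h = hd_tl[OF Suc.prems(1)] and hh = hd_tl(1,2)[OF Suc.prems(1)]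
  have c: "t (hd x) \<in> carrier R" using hh by simp
  have "x \<otimes> y = (t (hd x) \<oplus> w \<otimes> tl x) \<otimes> y" by (simp add: h(3)[symmetric])
  also have "\<dots> = t (hd x) \<otimes> y \<oplus> w \<otimes> (tl x \<otimes> y)" using c h(2) assms(3) w_closed by algebra
  finally have eq: "x \<otimes> y = t (hd x) \<otimes> y \<oplus> w \<otimes> (tl x \<otimes> y)" .
  have "co (t (hd x) \<otimes> y) i \<in> J" if "i < Suc k" for i
    using Suc.prems(2)[of 0 i] that co_t_mult[OF h(1) assms(3)] by simp
  then have 1: "t (hd x) \<otimes> y \<in> coideal (Suc k) J" using c assms(3) by (simp add: coideal_def)
  have "tl x \<otimes> y \<in> coideal k J"
    using Suc.IH[OF h(2)] Suc.prems(2)[of "Suc _"] by simp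
  then have "co (w \<otimes> (tl x \<otimes> y)) i \<in> J" if "i < Suc k" for i
    using that J co_w_mult[of "tl x \<otimes> y"] by (cases i) (auto simp: coideal_def down_closed_def)
  then have "w \<otimes> (tl x \<otimes> y) \<in> coideal (Suc k) J" using hh assms(3) by (simp add: coideal_def)
  with 1 show ?case unfolding eq by (rule coideal_add[OF J])
qed

text \<open>The added term meets only the coefficient of its own index, where residues add exactly;
  its carries go to higher indices.\<close>

lemma co_add_w_pow_t:
  assumes "x \<in> carrier R" "nm a \<le> 1"
  shows "co (x \<oplus> w [^] n \<otimes> t a) n = co x n + a"
  using assms(1)
proof (induction n arbitrary: x)
  case 0
  have "hd (t a) = a" using co_t[OF assms(2), of 0] by simp
  then show ?case using hd_add[of x "t a"] 0 assms by simp
next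
  case (Suc n)
  note h = hd_tl[OF Suc.prems(1)] and hh = hd_tl(1,2)[OF Suc.prems(1)]
  have c: "t (hd x) \<in> carrier R" "w [^] n \<in> carrier R" "t a \<in> carrier R" using hh assms by auto
  have "x \<oplus> w [^] Suc n \<otimes> t a = (t (hd x) \<oplus> w \<otimes> tl x) \<oplus> (w [^] n \<otimes> w) \<otimes> t a" by (simp add: h(3)[symmetric])
  also have "\<dots> = t (hd x) \<oplus> w \<otimes> (tl x \<oplus> w [^] n \<otimes> t a)"
    using c h(2) w_closed by algebra
  finally show ?case using co_step(2)[of "hd x" "tl x \<oplus> w [^] n \<otimes> t a" n] hh c Suc.IH[of "tl x"] by simp
qed

lemma ex_remove_term:
  assumes "x \<in> carrier R"
  shows "\<exists>y\<in>carrier R. x = y \<oplus> w [^] n \<otimes> t (co x n) \<and> (\<forall>i. co y i = (if i = n then 0 else co x i))"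
  using assms
proof (induction n arbitrary: x)
  case 0
  note h = hd_tl[OF 0] and hh = hd_tl(1,2)[OF 0]
  have "x = w \<otimes> tl x \<oplus> w [^] (0::nat) \<otimes> t (co x 0)" using h(1,2) by (simp add: a_comm h(3)[symmetric])
  moreover have "co (w \<otimes> tl x) i = (if i = 0 then 0 else co x i)" for i
    using co_w_mult[OF h(2)] by (cases i) auto
  ultimately show ?case using hh by (intro bexI[of _ "w \<otimes> tl x"]) auto
next
  case (Suc n)
  note h = hd_tl[OF Suc.prems(1)] and hh = hd_tl(1,2)[OF Suc.prems(1)]
  obtain y where y: "y \<in> carrier R" "tl x = y \<oplus> w [^] n \<otimes> t (co (tl x) n)"
    "\<And>i. co y i = (if i = n then 0 else co (tl x) i)" using Suc.IH[OF h(2)] by blast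
  let ?a = "t (co (tl x) n)"
  have c: "t (hd x) \<in> carrier R" "w [^] n \<in> carrier R" "?a \<in> carrier R" using hh co_le_1 by auto
  have "x = t (hd x) \<oplus> w \<otimes> (y \<oplus> w [^] n \<otimes> ?a)" by (simp add: h(3)[symmetric] y(2)[symmetric])
  also have "\<dots> = (t (hd x) \<oplus> w \<otimes> y) \<oplus> (w [^] n \<otimes> w) \<otimes> ?a" using c y(1) w_closed by algebra
  finally have "x = (t (hd x) \<oplus> w \<otimes> y) \<oplus> w [^] Suc n \<otimes> t (co x (Suc n))" by simp
  moreover have "co (t (hd x) \<oplus> w \<otimes> y) i = (if i = Suc n then 0 else co x i)" for i
    using co_step[OF h(1) y(1)] y(3) by (cases i) auto
  ultimately show ?case using c y(1) by (intro bexI[of _ "t (hd x) \<oplus> w \<otimes> y"]) auto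
qed

lemma co_eq_zero:
  assumes "x \<in> carrier R" "\<And>i. co x i = 0" shows "x = \<zero>"
proof (rule separated)
  fix n :: nat
  show "\<exists>y\<in>carrier R. x = w [^] n \<otimes> y"
    using ex_scaled[of x 0 n] assms by auto
qed

subsection \<open>The Gauss norm\<close>

text \<open>\<open>n\<close> is the last index at which the maximum \<open>M\<close> of $p^{-i} |x_i|$ is attained; it is additive
  under multiplication.\<close>

definition peak :: "nat \<Rightarrow> real \<Rightarrow> 'a \<Rightarrow> bool" where
  "peak n M x \<longleftrightarrow> x \<in> carrier R \<and> M > 0 \<and> nm (co x n) = p ^ n * M \<and>
     (\<forall>i<n. nm (co x i) \<le> p ^ i * M) \<and> (\<forall>i>n. nm (co x i) < p ^ i * M)"

lemma peakD:
  assumes "peak n M x"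
  shows "x \<in> carrier R" "M > 0" "nm (co x n) = p ^ n * M" "nm (co x i) \<le> p ^ i * M"
    "i > n \<Longrightarrow> nm (co x i) < p ^ i * M"
  using assms unfolding peak_def by (auto, cases i n rule: linorder_cases, auto)

lemma p_pow_le: "i \<le> j \<Longrightarrow> p ^ i \<le> p ^ j"
  using p_gt_1 by simp

lemma p_pow_less: "i < j \<Longrightarrow> p ^ i < p ^ j"
  using p_gt_1 by simp

lemma p_pos [simp]: "p > 0" "p \<ge> 0" "p \<noteq> 0"
  using p_gt_1 by auto

lemma p_pow_pos [simp]: "p ^ n > 0" "p ^ n \<ge> 0"
  by simp_all

lemma co_w_pow_t:
  assumes "nm a \<le> 1" shows "co (w [^] n \<otimes> t a) i = (if i = n then a else 0)"
proof (induction n arbitrary: i)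
  case 0
  then show ?case using assms co_t by simp
next
  case (Suc n)
  have "w [^] Suc n \<otimes> t a = w \<otimes> (w [^] n \<otimes> t a)" using assms by (simp add: m_ac)
  then show ?case using Suc assms by (cases i) (simp_all add: co_w_mult[simplified])
qed

text \<open>Coefficient n + m of the product receives exactly one contribution of full weight, from
  the two peak terms. All others, including carries from lower indices, lie in an open ball, so the
  ultrametric inequality determines the norm.\<close>

lemma peak_mult:
  assumes x: "peak n M x" and y: "peak m N y"
  shows "peak (n + m) (M * N) (x \<otimes> y)"
proof -
  note X = peakD[OF x] and Y = peakD[OF y]
  have MN: "M * N > 0" using X Y by simp
  have bound: "nm (co x i) * nm (co y j) \<le> p ^ (i + j) * (M * N)" for i j
    using mult_mono[OF X(4)[of i] Y(4)[of j]] X(2) by (simp add: power_add mult_ac)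
  \<comment> \<open>For i + j < k the strictness comes from p > 1; for i + j = k one of the two
    indices lies beyond its peak.\<close>
  have strict: "nm (co x i) * nm (co y j) < p ^ k * (M * N)"
    if ijk: "i + j \<le> k" "n + m \<le> k" "\<not> (i = n \<and> j = m \<and> k = n + m)" for i j k
  proof (cases "i + j < k")
    case True
    then have "p ^ (i + j) * (M * N) < p ^ k * (M * N)"
      using MN by (intro mult_strict_right_mono p_pow_less)
    with bound[of i j] show ?thesis by linarith
  next
    case False
    then consider "i > n" | "j > m" using ijk by linarith
    then have "nm (co x i) * nm (co y j) < (p ^ i * M) * (p ^ j * N)"
    proof cases
      case 1
      have "nm (co x i) * nm (co y j) \<le> nm (co x i) * (p ^ j * N)"
        using Y(4) by (intro mult_left_mono) simp_all
      also have "\<dots> < (p ^ i * M) * (p ^ j * N)"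
        using X(5)[OF 1] Y(2) by (intro mult_strict_right_mono) simp_all
      finally show ?thesis .
    next
      case 2
      have "nm (co x i) * nm (co y j) \<le> (p ^ i * M) * nm (co y j)"
        using X(4) by (intro mult_right_mono) simp_all
      also have "\<dots> < (p ^ i * M) * (p ^ j * N)"
        using Y(5)[OF 2] X(2) by (intro mult_strict_left_mono) simp_all
      finally show ?thesis .
    qed
    moreover have "(p ^ i * M) * (p ^ j * N) = p ^ k * (M * N)"
      using False ijk(1) by (simp add: power_add[of p i j, symmetric] mult_ac)
    ultimately show ?thesis by simp
  qed
  have Jd: "down_closed {a. nm a < p ^ k * (M * N)}" "down_closed {a. nm a \<le> p ^ k * (M * N)}" for k
    using MN by (auto intro!: down_closedI)
  have above: "nm (co (x \<otimes> y) k) < p ^ k * (M * N)" if "k > n + m" for k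
  proof -
    have "x \<otimes> y \<in> coideal (Suc k) {a. nm a < p ^ k * (M * N)}"
      using strict[of _ _ k] that by (intro coideal_prod Jd X Y) auto
    then show ?thesis by (simp add: coideal_def)
  qed
  have below: "nm (co (x \<otimes> y) k) \<le> p ^ k * (M * N)" for k
  proof -
    have "nm (co x i) * nm (co y j) \<le> p ^ k * (M * N)" if "i + j < Suc k" for i j
    proof -
      have "p ^ (i + j) * (M * N) \<le> p ^ k * (M * N)"
        using MN that by (intro mult_right_mono p_pow_le) simp_all
      with bound[of i j] show ?thesis by linarith
    qed
    then have "x \<otimes> y \<in> coideal (Suc k) {a. nm a \<le> p ^ k * (M * N)}"
      by (intro coideal_prod Jd X Y) auto
    then show ?thesis by (simp add: coideal_def)
  qed
  let ?a = "co x n" and ?b = "co y m"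
  have ab: "nm ?a \<le> 1" "nm ?b \<le> 1" using co_le_1 X(1) Y(1) by auto
  obtain x' where x': "x' \<in> carrier R" "x = x' \<oplus> w [^] n \<otimes> t ?a" "\<And>i. co x' i = (if i = n then 0 else co x i)"
    using ex_remove_term[OF X(1)] by blast
  obtain y' where y': "y' \<in> carrier R" "y = y' \<oplus> w [^] m \<otimes> t ?b" "\<And>i. co y' i = (if i = m then 0 else co y i)"
    using ex_remove_term[OF Y(1)] by blast
  \<comment> \<open>The product without its leading term. Only one factor is split in each summand,
    so two applications of \<open>coideal_prod\<close> suffice.\<close>
  define z where "z = x' \<otimes> y \<oplus> (w [^] n \<otimes> t ?a) \<otimes> y'"
  have c: "t ?a \<in> carrier R" "t ?b \<in> carrier R" "w [^] n \<in> carrier R" "w [^] m \<in> carrier R" using ab by auto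
  have zc: "z \<in> carrier R" using c x'(1) y'(1) Y(1) by (simp add: z_def)
  have "x \<otimes> y = (x' \<oplus> w [^] n \<otimes> t ?a) \<otimes> y" using x'(2) by simp
  also have "\<dots> = x' \<otimes> y \<oplus> (w [^] n \<otimes> t ?a) \<otimes> y" using c x'(1) Y(1) by (simp add: l_distr)
  also have "(w [^] n \<otimes> t ?a) \<otimes> y = (w [^] n \<otimes> t ?a) \<otimes> (y' \<oplus> w [^] m \<otimes> t ?b)" using y'(2) by simp
  also have "\<dots> = (w [^] n \<otimes> t ?a) \<otimes> y' \<oplus> (w [^] n \<otimes> w [^] m) \<otimes> (t ?a \<otimes> t ?b)"
    using c y'(1) by algebra
  finally have eq: "x \<otimes> y = z \<oplus> w [^] (n + m) \<otimes> t (?a * ?b)"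
    using c x'(1) y'(1) Y(1) ab by (simp add: z_def nat_pow_mult t_mult a_assoc)
  have "x' \<otimes> y \<in> coideal (Suc (n + m)) {a. nm a < p ^ (n + m) * (M * N)}"
    using strict[of _ _ "n + m"] MN x' Y by (intro coideal_prod Jd) auto
  moreover have "(w [^] n \<otimes> t ?a) \<otimes> y' \<in> coideal (Suc (n + m)) {a. nm a < p ^ (n + m) * (M * N)}"
    using strict[of _ _ "n + m"] MN y' c by (intro coideal_prod Jd) (auto simp: co_w_pow_t[OF ab(1)])
  ultimately have "z \<in> coideal (Suc (n + m)) {a. nm a < p ^ (n + m) * (M * N)}"
    unfolding z_def by (intro coideal_add Jd)
  then have "nm (co z (n + m)) < p ^ (n + m) * (M * N)" by (simp add: coideal_def)
  moreover have "nm (?a * ?b) = p ^ (n + m) * (M * N)"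
    using X(3) Y(3) by (simp add: power_add mult_ac)
  moreover have "co (x \<otimes> y) (n + m) = ?a * ?b + co z (n + m)"
    unfolding eq using co_add_w_pow_t[OF zc, of "?a * ?b" "n + m"] ab by (simp add: mult_le_one add.commute)
  ultimately have "nm (co (x \<otimes> y) (n + m)) = p ^ (n + m) * (M * N)"
    using nm_add_eq[of "co z (n + m)" "?a * ?b"] by simp
  then show ?thesis unfolding peak_def using X(1) Y(1) MN above below by simp
qed

section \<open>The norm as the height of the peak\<close>

definition gnorm :: "'a \<Rightarrow> real" where
  "gnorm x = (SUP i. nm (co x i) / p ^ i)"

lemma gnorm_term_le_1: "x \<in> carrier R \<Longrightarrow> nm (co x i) / p ^ i \<le> 1"
  using co_le_1[of x i] p_pow_le[of 0 i] by (simp add: divide_le_eq_1)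

lemma gnorm_upper: "x \<in> carrier R \<Longrightarrow> nm (co x i) \<le> p ^ i * gnorm x"
proof -
  assume "x \<in> carrier R"
  then have "nm (co x i) / p ^ i \<le> gnorm x"
    unfolding gnorm_def by (intro cSUP_upper bdd_aboveI[of _ 1]) (auto intro: gnorm_term_le_1)
  then show ?thesis by (simp add: field_simps)
qed

lemma gnorm_least: "(\<And>i. nm (co x i) \<le> p ^ i * M) \<Longrightarrow> gnorm x \<le> M"
  unfolding gnorm_def by (intro cSUP_least) (auto simp: field_simps)

lemma gnorm_nonneg: "x \<in> carrier R \<Longrightarrow> gnorm x \<ge> 0"
  using order_trans[OF nm_simps(1) gnorm_upper[of x 0]] by simp

lemma gnorm_le_1: "x \<in> carrier R \<Longrightarrow> gnorm x \<le> 1"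
  using co_le_1[of x] p_pow_le[of 0] by (intro gnorm_least) (smt (verit) mult.right_neutral power_0 zero_le)

lemma peak_gnorm: "peak n M x \<Longrightarrow> gnorm x = M"
proof (rule antisym)
  assume a: "peak n M x"
  show "gnorm x \<le> M" by (rule gnorm_least) (rule peakD[OF a])
  show "M \<le> gnorm x" using gnorm_upper[of x n] peakD[OF a] by simp
qed

lemma peak_unique: "peak n M x \<Longrightarrow> peak m N x \<Longrightarrow> n = m"
proof -
  assume a: "peak n M x" "peak m N x"
  have "M = N" using peak_gnorm[OF a(1)] peak_gnorm[OF a(2)] by simp
  then show "n = m" using peakD(3)[OF a(1)] peakD(5)[OF a(1), of m] peakD(3)[OF a(2)] peakD(5)[OF a(2), of n]
    by (cases n m rule: linorder_cases) auto
qed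

text \<open>Coefficients have norm at most 1, so the weighted norms tend to 0 and a positive maximum
  is attained at finitely many indices only, among which there is a last one.\<close>

lemma ex_peak:
  assumes x: "x \<in> carrier R" "x \<noteq> \<zero>" shows "\<exists>n. peak n (gnorm x) x"
proof -
  obtain i0 where "co x i0 \<noteq> 0" using co_eq_zero[OF x(1)] x(2) by blast
  then have pos: "nm (co x i0) / p ^ i0 > 0"
    by (simp add: nm_pos)
  define f where "f i = nm (co x i) / p ^ i" for i
  \<comment> \<open>From \<open>N\<close> on all weighted norms lie below that of one nonzero
    coefficient, which confines the search for the maximum to finitely many indices.\<close>
  obtain N where N: "(1 / p) ^ N < f i0"
    using real_arch_pow_inv[of "f i0" "1 / p"] pos p_gt_1 by (auto simp: f_def)
  have small: "f i < f i0" if "i \<ge> N" for i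
  proof -
    have "f i \<le> 1 / p ^ i" using co_le_1[OF x(1)] by (simp add: f_def divide_right_mono)
    also have "\<dots> \<le> 1 / p ^ N" using p_pow_le[OF that] by (simp add: frac_le)
    finally show ?thesis using N by (simp add: power_one_over)
  qed
  define F where "F = f ` {..N + i0}"
  have F: "finite F" "F \<noteq> {}" by (auto simp: F_def)
  have max: "f i \<le> Max F" for i
  proof (cases "i \<le> N + i0")
    case False
    then have "f i \<le> f i0" using small[of i] by simp
    also have "\<dots> \<le> Max F" using F by (auto simp: F_def)
    finally show ?thesis .
  qed (use F in \<open>auto simp: F_def\<close>)
  define A where "A = {i. f i = Max F}"
  have "A \<subseteq> {..N}"
  proof
    fix i assume "i \<in> A"
    then have "f i \<ge> f i0" using max by (auto simp: A_def)
    then show "i \<in> {..N}" using small[of i] by (cases "i \<le> N") auto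
  qed
  then have finA: "finite A" by (rule finite_subset) simp
  obtain j where "f j = Max F" using Max_in[OF F] unfolding F_def by fastforce
  then have neA: "A \<noteq> {}" by (auto simp: A_def)
  define n where "n = Max A"
  have n: "f n = Max F" using Max_in[OF finA neA] by (simp add: n_def A_def)
  have above: "f i < Max F" if "i > n" for i
    using max[of i] Max_ge[OF finA, of i] that by (force simp: n_def A_def)
  have nmf: "nm (co x i) = p ^ i * f i" for i by (simp add: f_def)
  have "Max F > 0" using max[of i0] pos by (simp add: f_def)
  then have pk: "peak n (Max F) x"
    unfolding peak_def nmf using x max above n by simp
  then show ?thesis using peak_gnorm by metis
qed

lemma gnorm_zero [simp]: "gnorm \<zero> = 0"
  using gnorm_least[of "\<zero>" 0] gnorm_nonneg[of "\<zero>"] by simp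

lemma gnorm_pos: "x \<in> carrier R \<Longrightarrow> x \<noteq> \<zero> \<Longrightarrow> gnorm x > 0"
  using ex_peak peakD(2) by blast

lemma gnorm_mult:
  assumes "x \<in> carrier R" "y \<in> carrier R" shows "gnorm (x \<otimes> y) = gnorm x * gnorm y"
proof (cases "x = \<zero> \<or> y = \<zero>")
  case False
  then show ?thesis using ex_peak assms peak_mult peak_gnorm by metis
qed (use assms in auto)

lemma gnorm_add:
  assumes "x \<in> carrier R" "y \<in> carrier R" shows "gnorm (x \<oplus> y) \<le> max (gnorm x) (gnorm y)"
proof (rule gnorm_least)
  fix i
  let ?M = "max (gnorm x) (gnorm y)"
  let ?J = "{a. nm a \<le> p ^ i * ?M}"
  have M: "?M \<ge> 0" using gnorm_nonneg assms by (simp add: le_max_iff_disj)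
  have "z \<in> coideal (Suc i) ?J" if z: "z \<in> carrier R" "gnorm z \<le> ?M" for z
    unfolding coideal_def
  proof (intro CollectI conjI allI impI z)
    fix j assume "j < Suc i"
    have "nm (co z j) \<le> p ^ j * gnorm z" by (rule gnorm_upper[OF z(1)])
    also have "\<dots> \<le> p ^ i * ?M"
      using p_pow_le[of j i] \<open>j < Suc i\<close> z M gnorm_nonneg by (intro mult_mono) auto
    finally show "nm (co z j) \<le> p ^ i * ?M" .
  qed
  then have "x \<oplus> y \<in> coideal (Suc i) ?J"
    using assms M by (intro coideal_add down_closedI) auto
  then show "nm (co (x \<oplus> y) i) \<le> p ^ i * ?M" by (simp add: coideal_def)
qed

lemma gnorm_one [simp]: "gnorm \<one> = 1"
proof -
  have "gnorm \<one> = gnorm \<one> * gnorm \<one>" using gnorm_mult[of \<one> \<one>] by simp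
  moreover have "\<one> \<noteq> \<zero>"
  proof
    assume "\<one> = \<zero>"
    then have "co \<one> 0 = co \<zero> 0" by (rule arg_cong)
    then show False using co_t[of 1 0] co_zero[of 0] by (simp del: co.simps)
  qed
  ultimately show ?thesis using gnorm_pos[of \<one>] by simp
qed

lemma gnorm_uminus [simp]:
  assumes "x \<in> carrier R" shows "gnorm (\<ominus> x) = gnorm x"
proof -
  have "gnorm (\<ominus> \<one>) * gnorm (\<ominus> \<one>) = 1" using gnorm_mult[of "\<ominus> \<one>" "\<ominus> \<one>"] by (simp add: l_minus r_minus)
  then have "gnorm (\<ominus> \<one>) = 1" using gnorm_nonneg[of "\<ominus> \<one>"] by (simp add: square_eq_1_iff)
  moreover have "gnorm (\<ominus> x) = gnorm (\<ominus> \<one> \<otimes> x)" using assms by (simp add: l_minus)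
  ultimately show ?thesis using gnorm_mult[of "\<ominus> \<one>" x] assms by (simp only: one_closed a_inv_closed mult_1)
qed

lemma gnorm_pow: "x \<in> carrier R \<Longrightarrow> gnorm (x [^] (n::nat)) = gnorm x ^ n"
  by (induction n) (simp_all add: gnorm_mult)

lemma gnorm_t: "nm a \<le> 1 \<Longrightarrow> gnorm (t a) = nm a"
proof (rule antisym)
  assume a: "nm a \<le> 1"
  show "gnorm (t a) \<le> nm a" by (rule gnorm_least) (simp add: co_t[OF a])
  show "nm a \<le> gnorm (t a)" using gnorm_upper[OF t_closed[OF a], of 0] co_t[OF a, of 0] by simp
qed

text \<open>At index 0 the ultrametric inequality preserves the norm; at k > 0 carries from lower
  indices are harmless because their bounds p^i * M lie strictly below p^k * M.\<close>

lemma peak_add_small: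
  assumes x: "peak 0 M x" and y: "y \<in> carrier R" "gnorm y < M"
  shows "peak 0 M (x \<oplus> y)"
proof -
  note X = peakD[OF x]
  have "nm (co y 0) < nm (co x 0)" using gnorm_upper[OF y(1), of 0] X(3) y(2) by simp
  then have "nm (co (x \<oplus> y) 0) = M" using hd_add[OF X(1) y(1)] nm_add_eq X(3) by simp
  moreover have "nm (co (x \<oplus> y) k) < p ^ k * M" if "k > 0" for k
  proof -
    let ?J = "{a. nm a < p ^ k * M}"
    have "nm (co x i) < p ^ k * M" if "i < Suc k" for i
    proof (cases "i = k")
      case False
      then have "p ^ i * M < p ^ k * M" using p_pow_less[of i k] that X(2) by simp
      then show ?thesis using X(4)[of i] by linarith
    qed (use X(5) \<open>k > 0\<close> in auto)
    moreover have "nm (co y i) < p ^ k * M" if "i < Suc k" for i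
    proof -
      have "p ^ i * gnorm y < p ^ i * M" using y by simp
      moreover have "p ^ i * M \<le> p ^ k * M" using p_pow_le[of i k] that X(2) by simp
      ultimately show ?thesis using gnorm_upper[OF y(1), of i] by linarith
    qed
    ultimately have "x \<oplus> y \<in> coideal (Suc k) ?J"
      using X y by (intro coideal_add down_closedI) (auto simp: coideal_def)
    then show ?thesis by (simp add: coideal_def)
  qed
  ultimately show ?thesis using X y by (simp add: peak_def)
qed

end

section \<open>The quotient seminorm\<close>

text \<open>\<open>\<rho>\<close> is r/p, so the second condition on it expresses r <= 1.\<close>

locale untilt_ring = expansion_ring R w t nm p
  for R (structure) and w :: 'a and t :: "'l::field \<Rightarrow> 'a" and nm p +
  fixes u :: 'l and \<rho> :: real
  assumes nm_u: "nm u \<le> 1 / p"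
    and \<rho>: "0 \<le> \<rho>" "\<rho> * p \<le> 1"
begin

lemma u_le_1: "nm u \<le> 1"
  using nm_u p_gt_1 by (smt (verit) divide_le_eq_1)

definition pii :: 'a where "pii = w \<ominus> t u"

lemma pii_closed [simp, intro]: "pii \<in> carrier R"
  using u_le_1 by (simp add: pii_def)

text \<open>For |u| = 1/p the maximum is attained at the indices 0 and 1; the last of them is
  1.\<close>

lemma peak_pii: "peak 1 (1 / p) pii"
proof -
  \<comment> \<open>The negative of [u] need not be a Teichmueller element; written as [u] times -1
    its coefficients are u times those of -1, hence small.\<close>
  define z where "z = t u \<otimes> \<ominus> \<one>"
  have tu: "t u \<in> carrier R" using u_le_1 by simp
  have zc: "z \<in> carrier R" using tu by (simp add: z_def)
  have eq: "pii = z \<oplus> w [^] (1::nat) \<otimes> t 1"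
    using tu by (simp add: pii_def z_def minus_eq r_minus a_comm)
  have coz: "nm (co z i) \<le> 1 / p" for i
  proof -
    have "nm (co z i) = nm u * nm (co (\<ominus> \<one>) i)" using co_t_mult[OF u_le_1, of "\<ominus> \<one>" i] by (simp add: z_def)
    also have "\<dots> \<le> nm u * 1" by (intro mult_left_mono co_le_1) simp_all
    finally show ?thesis using nm_u by simp
  qed
  have "nm (co pii 1) = 1"
  proof -
    have "co pii 1 = 1 + co z 1" unfolding eq using co_add_w_pow_t[OF zc, of 1 1] by simp
    moreover have "nm (co z 1) < nm 1" using coz[of 1] p_gt_1 by (smt (verit) divide_less_eq_1 nm_simps(4))
    ultimately show ?thesis using nm_add_eq[of "co z 1" 1] by simp
  qed
  moreover have "nm (co pii 0) \<le> 1 / p"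
    unfolding eq using co_add_w_pow[OF zc t_closed, of 1 0 1] coz[of 0] by simp
  moreover have "nm (co pii i) < p ^ i * (1 / p)" if "i > 1" for i
  proof -
    have "p ^ 1 < p ^ i" using that by (rule p_pow_less)
    then have "1 < p ^ i * (1 / p)" by (simp add: field_simps)
    then show ?thesis using co_le_1[OF pii_closed, of i] by linarith
  qed
  ultimately show ?thesis unfolding peak_def by simp
qed

lemma gnorm_pii: "gnorm pii = 1 / p"
  using peak_gnorm[OF peak_pii] .

definition stab :: "'a \<Rightarrow> bool" where
  "stab x \<longleftrightarrow> x = \<zero> \<or> (\<exists>M. peak 0 M x)"

lemma stab_mult: "stab x \<Longrightarrow> stab y \<Longrightarrow> x \<in> carrier R \<Longrightarrow> y \<in> carrier R \<Longrightarrow> stab (x \<otimes> y)"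
  unfolding stab_def using peak_mult[of 0 _ x 0 _ y] by fastforce

text \<open>Multiplication by \<open>pii\<close> moves the peak, so no stable element other than zero is divisible by it.\<close>

lemma stable_minimal:
  assumes x: "x \<in> carrier R" "stab x" and a: "a \<in> carrier R" and z: "z \<in> carrier R"
    and eq: "x \<ominus> a = pii \<otimes> z"
  shows "gnorm x \<le> gnorm a"
proof (rule ccontr)
  assume "\<not> gnorm x \<le> gnorm a"
  then have less: "gnorm a < gnorm x" by simp
  then have "x \<noteq> \<zero>" using gnorm_nonneg[OF a] by auto
  then obtain M where M: "peak 0 M x" using x by (auto simp: stab_def)
  then have "gnorm x = M" by (rule peak_gnorm)
  then have pk: "peak 0 M (x \<ominus> a)" unfolding minus_eq
    using peak_add_small[OF M, of "\<ominus> a"] less a by simp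
  have "z \<noteq> \<zero>"
  proof
    assume "z = \<zero>"
    then have "peak 0 M \<zero>" using pk eq by simp
    then show False using peakD(2,3)[of 0 M \<zero>] by (simp del: co.simps)
  qed
  then obtain n where "peak n (gnorm z) z" using ex_peak z by blast
  then have "peak (1 + n) (1 / p * gnorm z) (x \<ominus> a)" unfolding eq by (rule peak_mult[OF peak_pii])
  then show False using peak_unique[OF pk] by fastforce
qed

subsection \<open>Reduction to stable elements\<close>

text \<open>The factor 1/p is the gain of one round of reduction. At n = 0 every coefficient but the
  first is below the bound M/p: either the first one exceeds it and the element is stable, or the
  whole norm has dropped to M/p.\<close>

definition tail_small :: "nat \<Rightarrow> real \<Rightarrow> 'a \<Rightarrow> bool" where
  "tail_small n M x \<longleftrightarrow> x \<in> carrier R \<and> (\<forall>i. nm (co x i) \<le> p ^ i * M) \<and> (\<forall>i>n. nm (co x i) \<le> p ^ i * (M / p))"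

text \<open>Replacing $\varpi$ by $[u]$ in $x = [x_0] + \varpi x_1$ changes \<open>x\<close> by a multiple of \<open>pii\<close> and shifts
  the tail one place to the left.\<close>

lemma tail_small_step:
  assumes x: "tail_small (Suc n) M x" and M: "M \<ge> 0"
  shows "\<exists>y z. tail_small n M y \<and> z \<in> carrier R \<and> x = y \<oplus> pii \<otimes> z"
proof -
  have xc: "x \<in> carrier R" and b: "\<And>i. nm (co x i) \<le> p ^ i * M"
    and s: "\<And>i. i > Suc n \<Longrightarrow> nm (co x i) \<le> p ^ i * (M / p)"
    using x by (auto simp: tail_small_def)
  note h = hd_tl[OF xc]
  define y where "y = t (hd x) \<oplus> t u \<otimes> tl x"
  have c: "t (hd x) \<in> carrier R" "t u \<in> carrier R" "tl x \<in> carrier R" using h u_le_1 by auto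
  have yc: "y \<in> carrier R" using c by (simp add: y_def)
  have "y \<oplus> pii \<otimes> tl x = t (hd x) \<oplus> w \<otimes> tl x" unfolding y_def pii_def using c w_closed by algebra
  then have eq: "x = y \<oplus> pii \<otimes> tl x" using h(3) by simp
  have u_le: "nm u * v \<le> v / p" if "v \<ge> 0" for v
    using mult_right_mono[OF nm_u that] by simp
  \<comment> \<open>The factor |u| <= 1/p compensates exactly for the lower weight of the shifted
    index.\<close>
  have cou: "nm (co (t u \<otimes> tl x) i) \<le> nm (co x (Suc i)) / p" for i
    using co_t_mult[OF u_le_1 h(2), of i] u_le[of "nm (co (tl x) i)"] by simp
  have coh: "nm (co (t (hd x)) i) \<le> M" for i
    using b[of 0] M co_t[OF h(1), of i] by simp
  \<comment> \<open>Carries let every index up to k influence coefficient k of \<open>y\<close>, so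
    one bound \<open>B\<close> is required for all of them.\<close>
  have key: "nm (co y k) \<le> B"
    if B: "M \<le> B" "\<And>i. i \<le> k \<Longrightarrow> nm (co x (Suc i)) \<le> p * B" for k B
  proof -
    have "t (hd x) \<in> coideal (Suc k) {a. nm a \<le> B}"
      using c coh B by (auto simp: coideal_def intro: order_trans)
    moreover have "t u \<otimes> tl x \<in> coideal (Suc k) {a. nm a \<le> B}"
      unfolding coideal_def
    proof (intro CollectI conjI allI impI)
      fix i assume "i < Suc k"
      then have "nm (co x (Suc i)) / p \<le> B" using B(2)[of i] by (simp add: field_simps)
      then show "nm (co (t u \<otimes> tl x) i) \<le> B" using cou[of i] by linarith
    qed (use c in simp)
    ultimately have "y \<in> coideal (Suc k) {a. nm a \<le> B}"
      unfolding y_def using M B by (intro coideal_add down_closedI) auto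
    then show ?thesis by (simp add: coideal_def)
  qed
  have "tail_small n M y"
    unfolding tail_small_def
  proof (intro conjI allI impI yc)
    fix k
    show "nm (co y k) \<le> p ^ k * M"
    proof (rule key)
      show "M \<le> p ^ k * M" using mult_right_mono[OF p_pow_le[of 0 k] M] by simp
      fix i assume "i \<le> k"
      then have "p ^ i * M \<le> p ^ k * M" by (intro mult_right_mono p_pow_le M)
      then show "nm (co x (Suc i)) \<le> p * (p ^ k * M)"
        using b[of "Suc i"] by (smt (verit) mult_left_mono p_pos(2) power_Suc mult.assoc)
    qed
  next
    fix k assume k: "n < k"
    show "nm (co y k) \<le> p ^ k * (M / p)"
    proof (rule key)
      \<comment> \<open>The first coefficient may still have weight M; since k > 0, its carry into
        index k is within the smaller bound.\<close>
      have "p ^ 1 * M \<le> p ^ k * M" using k by (intro mult_right_mono p_pow_le M) simp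
      then show "M \<le> p ^ k * (M / p)" by (simp add: field_simps)
      fix i assume i: "i \<le> k"
      show "nm (co x (Suc i)) \<le> p * (p ^ k * (M / p))"
      proof (cases "i = k")
        case True
        then show ?thesis using s[of "Suc k"] k by simp
      next
        case False
        then have "p ^ Suc i * M \<le> p ^ k * M" using i by (intro mult_right_mono p_pow_le M) simp
        then show ?thesis using b[of "Suc i"] by simp
      qed
    qed
  qed
  with eq h(2) show ?thesis by blast
qed

lemma tail_small_reduce:
  assumes "tail_small n M x" "M \<ge> 0"
  shows "\<exists>y z. tail_small 0 M y \<and> z \<in> carrier R \<and> x = y \<oplus> pii \<otimes> z"
  using assms(1)
proof (induction n arbitrary: x)
  case 0
  then show ?case by (intro exI[of _ x] exI[of _ "\<zero>"]) (simp add: tail_small_def)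
next
  case (Suc n)
  obtain y z where y: "tail_small n M y" "z \<in> carrier R" "x = y \<oplus> pii \<otimes> z"
    using tail_small_step[OF Suc.prems assms(2)] by blast
  obtain y' z' where y': "tail_small 0 M y'" "z' \<in> carrier R" "y = y' \<oplus> pii \<otimes> z'"
    using Suc.IH[OF y(1)] by blast
  have c: "y' \<in> carrier R" using y'(1) by (simp add: tail_small_def)
  have "x = y' \<oplus> pii \<otimes> (z' \<oplus> z)" unfolding y(3) y'(3) using c y(2) y'(2) pii_closed by algebra
  then show ?case using y y' by blast
qed

lemma ex_stable_or_smaller:
  assumes x: "x \<in> carrier R" "gnorm x \<le> M" and M: "M > 0"
  shows "\<exists>y\<in>carrier R. \<exists>z\<in>carrier R. x = y \<oplus> pii \<otimes> z \<and> (stab y \<or> gnorm y \<le> M / p)"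
proof -
  \<comment> \<open>Beyond \<open>N\<close> the trivial bound 1 on coefficients is already below p^i
    * (M / p), so finitely many shifts suffice.\<close>
  obtain N where N: "1 / (M / p) < p ^ N" using real_arch_pow[OF p_gt_1] by blast
  then have N': "1 < p ^ N * (M / p)" using M by (simp add: field_simps)
  have "tail_small N M x"
    unfolding tail_small_def
  proof (intro conjI allI impI x)
    fix i
    show "nm (co x i) \<le> p ^ i * M" using gnorm_upper[OF x(1), of i] x(2)
      by (smt (verit) mult_left_mono p_pow_pos(2))
  next
    fix i assume "N < i"
    then have "p ^ N * (M / p) \<le> p ^ i * (M / p)" using M by (intro mult_right_mono p_pow_le) simp_all
    then show "nm (co x i) \<le> p ^ i * (M / p)" using N' co_le_1[OF x(1), of i] by linarith
  qed
  then obtain y z where y: "tail_small 0 M y" "z \<in> carrier R" "x = y \<oplus> pii \<otimes> z"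
    using tail_small_reduce M by fastforce
  have yc: "y \<in> carrier R" and s: "\<And>i. i > 0 \<Longrightarrow> nm (co y i) \<le> p ^ i * (M / p)"
    using y(1) by (auto simp: tail_small_def)
  have "stab y \<or> gnorm y \<le> M / p"
  proof (cases "nm (co y 0) \<le> M / p")
    case True
    have "nm (co y i) \<le> p ^ i * (M / p)" for i
      using True s[of i] by (cases "i = 0") auto
    then show ?thesis using gnorm_least by blast
  next
    case False
    then have gt: "nm (co y 0) > M / p" by simp
    moreover have "M / p > 0" using M by simp
    moreover have "nm (co y i) < p ^ i * nm (co y 0)" if "i > 0" for i
      using s[OF that] gt by (smt (verit) mult_strict_left_mono p_pow_pos(1))
    ultimately have "peak 0 (nm (co y 0)) y" unfolding peak_def using yc by (simp del: co.simps)
    then show ?thesis by (auto simp: stab_def)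
  qed
  then show ?thesis using y yc by blast
qed

text \<open>The alternative of \<open>ex_stable_or_smaller\<close> is iterated: as long as no stable
  representative appears, the bound on the norm drops by a factor p each time.\<close>

lemma ex_stable_or_small:
  assumes x: "x \<in> carrier R" and e: "e > 0"
  shows "\<exists>y\<in>carrier R. \<exists>z\<in>carrier R. x = y \<oplus> pii \<otimes> z \<and> (stab y \<or> gnorm y < e)"
proof -
  have "\<exists>y\<in>carrier R. \<exists>z\<in>carrier R. x = y \<oplus> pii \<otimes> z \<and> (stab y \<or> gnorm y \<le> (1 / p) ^ k)" for k
  proof (induction k)
    case 0
    show ?case using x gnorm_le_1[OF x] by (intro bexI[of _ x] bexI[of _ "\<zero>"]) simp_all
  next
    case (Suc k)
    then obtain y z where y: "y \<in> carrier R" "z \<in> carrier R" "x = y \<oplus> pii \<otimes> z" "stab y \<or> gnorm y \<le> (1 / p) ^ k"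
      by blast
    show ?case
    proof (cases "stab y")
      case False
      then obtain y' z' where y': "y' \<in> carrier R" "z' \<in> carrier R" "y = y' \<oplus> pii \<otimes> z'"
        "stab y' \<or> gnorm y' \<le> (1 / p) ^ k / p"
        using ex_stable_or_smaller[OF y(1), of "(1 / p) ^ k"] y(4) by auto
      have "x = y' \<oplus> pii \<otimes> (z' \<oplus> z)" unfolding y(3) y'(3) using y(1,2) y'(1,2) pii_closed by algebra
      then show ?thesis using y y' by (intro bexI[of _ y'] bexI[of _ "z' \<oplus> z"]) auto
    qed (use y in blast)
  qed
  moreover obtain k where "(1 / p) ^ k < e" using real_arch_pow_inv[OF e, of "1 / p"] p_gt_1 by auto
  ultimately show ?thesis by (meson order.strict_trans1)
qed

subsection \<open>Gauss extension\<close>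

definition poly_norm :: "(nat \<Rightarrow> 'a) \<Rightarrow> real" where
  "poly_norm a = (SUP i. \<rho> ^ i * gnorm (a i))"

definition at_pii :: "(nat \<Rightarrow> 'a) \<Rightarrow> 'a" where
  "at_pii a = (\<Oplus>i\<in>{..deg R a}. a i \<otimes> (pii [^] i))"

definition qnorm :: "'a \<Rightarrow> real" where
  "qnorm x = Inf {poly_norm a | a. a \<in> carrier (UP R) \<and> at_pii a = x}"

lemma \<rho>_le_1: "\<rho> \<le> 1"
  using \<rho> p_gt_1 by (smt (verit) mult_left_le mult_less_cancel_left2)

lemma \<rho>_pow: "0 \<le> \<rho> ^ i" "\<rho> ^ i \<le> 1"
  using \<rho> \<rho>_le_1 by (simp_all add: power_le_one)

lemma UP_closed: "a \<in> carrier (UP R) \<Longrightarrow> a i \<in> carrier R"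
  by (auto simp: UP_def up_def)

lemma UP_props: "UP_pre_univ_prop R R id"
  by (intro UP_pre_univ_prop.intro ring_hom_cringI ring_hom_ringI2 is_cring ring_axioms UP_cring.intro)
    (auto simp: ring_hom_def)

text \<open>Identifies the sum in the definition of the seminorm with evaluation of polynomials,
  which is known to be a ring homomorphism.\<close>

lemma at_pii_eval: "a \<in> carrier (UP R) \<Longrightarrow> at_pii a = eval R R id pii a"
  by (simp add: at_pii_def eval_def) (simp add: UP_def)

lemma at_pii_hom: "eval R R id pii \<in> ring_hom (UP R) R"
  by (rule UP_pre_univ_prop.eval_ring_hom[OF UP_props pii_closed])

lemma UP_ring: "ring (UP R)"
  by (rule UP_ring.UP_ring) (simp add: UP_ring.intro ring_axioms)

lemma at_pii_add:
  assumes "a \<in> carrier (UP R)" "b \<in> carrier (UP R)"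
  shows "at_pii (a \<oplus>\<^bsub>UP R\<^esub> b) = at_pii a \<oplus> at_pii b"
  using assms ring_hom_add[OF at_pii_hom assms] at_pii_eval ring.ring_simprules(1)[OF UP_ring assms] by simp

lemma at_pii_mult:
  assumes "a \<in> carrier (UP R)" "b \<in> carrier (UP R)"
  shows "at_pii (a \<otimes>\<^bsub>UP R\<^esub> b) = at_pii a \<otimes> at_pii b"
  using assms ring_hom_mult[OF at_pii_hom assms] at_pii_eval ring.ring_simprules(5)[OF UP_ring assms] by simp

lemma at_pii_monom:
  assumes "c \<in> carrier R"
  shows "monom (UP R) c n \<in> carrier (UP R)" "at_pii (monom (UP R) c n) = c \<otimes> pii [^] n"
proof -
  show 1: "monom (UP R) c n \<in> carrier (UP R)"
    by (rule UP_ring.monom_closed) (use assms in \<open>simp_all add: UP_ring.intro ring_axioms\<close>)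
  show "at_pii (monom (UP R) c n) = c \<otimes> pii [^] n"
    using at_pii_eval[OF 1] UP_pre_univ_prop.eval_monom[OF UP_props assms pii_closed, of n] by simp
qed

section \<open>Estimates for the Gauss extension\<close>

lemma poly_norm_upper:
  assumes "a \<in> carrier (UP R)" shows "\<rho> ^ i * gnorm (a i) \<le> poly_norm a"
  unfolding poly_norm_def
proof (rule cSUP_upper)
  show "bdd_above (range (\<lambda>i. \<rho> ^ i * gnorm (a i)))"
    using \<rho>_pow gnorm_le_1 gnorm_nonneg UP_closed[OF assms] by (intro bdd_aboveI[of _ 1]) (auto intro!: mult_le_one)
qed simp

lemma poly_norm_least: "(\<And>i. \<rho> ^ i * gnorm (a i) \<le> B) \<Longrightarrow> poly_norm a \<le> B"
  unfolding poly_norm_def by (intro cSUP_least) auto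

lemma poly_norm_nonneg: "a \<in> carrier (UP R) \<Longrightarrow> poly_norm a \<ge> 0"
  using poly_norm_upper[of a 0] gnorm_nonneg[OF UP_closed, of a 0] by simp

lemma poly_norm_add:
  assumes "a \<in> carrier (UP R)" "b \<in> carrier (UP R)"
  shows "poly_norm (a \<oplus>\<^bsub>UP R\<^esub> b) \<le> max (poly_norm a) (poly_norm b)"
proof (rule poly_norm_least)
  fix i
  have "(a \<oplus>\<^bsub>UP R\<^esub> b) i = a i \<oplus> b i" using assms by (simp add: UP_def)
  moreover have "\<rho> ^ i * gnorm (a i \<oplus> b i) \<le> max (\<rho> ^ i * gnorm (a i)) (\<rho> ^ i * gnorm (b i))"
    using mult_left_mono[OF gnorm_add[OF UP_closed[OF assms(1)] UP_closed[OF assms(2)], of i i] \<rho>_pow(1)[of i]]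
    by (simp add: max_mult_distrib_left \<rho>_pow)
  ultimately show "\<rho> ^ i * gnorm ((a \<oplus>\<^bsub>UP R\<^esub> b) i) \<le> max (poly_norm a) (poly_norm b)"
    using poly_norm_upper[OF assms(1), of i] poly_norm_upper[OF assms(2), of i] by simp
qed

lemma gnorm_finsum:
  assumes "finite S" "\<And>i. i \<in> S \<Longrightarrow> f i \<in> carrier R" "\<And>i. i \<in> S \<Longrightarrow> c * gnorm (f i) \<le> B" "c \<ge> 0" "B \<ge> 0"
  shows "c * gnorm (finsum R f S) \<le> B"
  using assms(1-3)
proof (induction S rule: finite_induct)
  case empty
  then show ?case using assms by simp
next
  case (insert x F)
  have f: "f \<in> F \<rightarrow> carrier R" using insert.prems by auto
  have "c * gnorm (f x \<oplus> finsum R f F) \<le> c * max (gnorm (f x)) (gnorm (finsum R f F))"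
    using insert.prems f by (intro mult_left_mono gnorm_add finsum_closed) (auto simp: assms)
  also have "\<dots> \<le> B" using insert assms by (auto simp: max_def)
  finally show ?case using insert f by simp
qed

lemma poly_norm_mult:
  assumes "a \<in> carrier (UP R)" "b \<in> carrier (UP R)"
  shows "poly_norm (a \<otimes>\<^bsub>UP R\<^esub> b) \<le> poly_norm a * poly_norm b"
proof (rule poly_norm_least)
  fix k
  have "(a \<otimes>\<^bsub>UP R\<^esub> b) k = (\<Oplus>i\<in>{..k}. a i \<otimes> b (k - i))" using assms by (simp add: UP_def)
  moreover have "\<rho> ^ k * gnorm (\<Oplus>i\<in>{..k}. a i \<otimes> b (k - i)) \<le> poly_norm a * poly_norm b"
  proof (rule gnorm_finsum)
    fix i assume i: "i \<in> {..k}"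
    have "\<rho> ^ k * gnorm (a i \<otimes> b (k - i)) = (\<rho> ^ i * gnorm (a i)) * (\<rho> ^ (k - i) * gnorm (b (k - i)))"
      using i UP_closed[OF assms(1)] UP_closed[OF assms(2)] by (simp add: gnorm_mult power_add[symmetric])
    also have "\<dots> \<le> poly_norm a * poly_norm b"
      using poly_norm_upper assms poly_norm_nonneg \<rho>_pow gnorm_nonneg UP_closed
      by (intro mult_mono) auto
    finally show "\<rho> ^ k * gnorm (a i \<otimes> b (k - i)) \<le> poly_norm a * poly_norm b" .
  qed (use assms UP_closed poly_norm_nonneg \<rho>_pow in auto)
  ultimately show "\<rho> ^ k * gnorm ((a \<otimes>\<^bsub>UP R\<^esub> b) k) \<le> poly_norm a * poly_norm b" by simp
qed

section \<open>The infimum over polynomial representations\<close>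

lemma qnorm_set:
  assumes "x \<in> carrier R"
  shows "{poly_norm a | a. a \<in> carrier (UP R) \<and> at_pii a = x} \<noteq> {}"
    "bdd_below {poly_norm a | a. a \<in> carrier (UP R) \<and> at_pii a = x}"
proof -
  have "at_pii (monom (UP R) x 0) = x" using at_pii_monom[OF assms, of 0] assms by simp
  then show "{poly_norm a | a. a \<in> carrier (UP R) \<and> at_pii a = x} \<noteq> {}"
    using at_pii_monom(1)[OF assms, of 0] by blast
  show "bdd_below {poly_norm a | a. a \<in> carrier (UP R) \<and> at_pii a = x}"
    by (rule bdd_belowI[of _ 0]) (auto intro: poly_norm_nonneg)
qed

lemma qnorm_le: "a \<in> carrier (UP R) \<Longrightarrow> at_pii a = x \<Longrightarrow> x \<in> carrier R \<Longrightarrow> qnorm x \<le> poly_norm a"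
  unfolding qnorm_def by (rule cInf_lower[OF _ qnorm_set(2)]) auto

lemma qnorm_less_iff:
  assumes "x \<in> carrier R"
  shows "qnorm x < c \<longleftrightarrow> (\<exists>a\<in>carrier (UP R). at_pii a = x \<and> poly_norm a < c)"
  unfolding qnorm_def cInf_less_iff[OF qnorm_set[OF assms]] by blast

lemma qnorm_greatest:
  assumes "x \<in> carrier R" "\<And>a. a \<in> carrier (UP R) \<Longrightarrow> at_pii a = x \<Longrightarrow> B \<le> poly_norm a"
  shows "B \<le> qnorm x"
  unfolding qnorm_def using assms by (intro cInf_greatest qnorm_set) auto

lemma qnorm_nonneg: "x \<in> carrier R \<Longrightarrow> qnorm x \<ge> 0"
  by (rule qnorm_greatest) (auto intro: poly_norm_nonneg)

lemma qnorm_monom: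
  assumes "c \<in> carrier R" shows "qnorm (c \<otimes> pii [^] n) \<le> \<rho> ^ n * gnorm c"
proof -
  have "qnorm (c \<otimes> pii [^] n) \<le> poly_norm (monom (UP R) c n)"
    using at_pii_monom[OF assms, of n] assms by (intro qnorm_le) auto
  also have "\<dots> \<le> \<rho> ^ n * gnorm c"
    using assms \<rho>_pow gnorm_nonneg by (intro poly_norm_least) (simp add: UP_def)
  finally show ?thesis .
qed

lemma qnorm_le_gnorm: "x \<in> carrier R \<Longrightarrow> qnorm x \<le> gnorm x"
  using qnorm_monom[of x 0] by simp

lemma qnorm_add:
  assumes "x \<in> carrier R" "y \<in> carrier R" shows "qnorm (x \<oplus> y) \<le> max (qnorm x) (qnorm y)"
proof (rule dense_ge)
  fix c assume "max (qnorm x) (qnorm y) < c"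
  then obtain a b where a: "a \<in> carrier (UP R)" "at_pii a = x" "poly_norm a < c"
    and b: "b \<in> carrier (UP R)" "at_pii b = y" "poly_norm b < c"
    using qnorm_less_iff[OF assms(1), of c] qnorm_less_iff[OF assms(2), of c] by auto
  have "qnorm (x \<oplus> y) \<le> poly_norm (a \<oplus>\<^bsub>UP R\<^esub> b)"
    using a b assms at_pii_add ring.ring_simprules(1)[OF UP_ring] by (intro qnorm_le) auto
  also have "\<dots> \<le> c" using poly_norm_add[OF a(1) b(1)] a b by simp
  finally show "qnorm (x \<oplus> y) \<le> c" .
qed

lemma qnorm_mult_le:
  assumes "x \<in> carrier R" "y \<in> carrier R" shows "qnorm (x \<otimes> y) \<le> qnorm x * qnorm y"
proof -
  have le: "qnorm (x \<otimes> y) \<le> c * d" if cd: "qnorm x < c" "qnorm y < d" for c d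
  proof -
    obtain a b where a: "a \<in> carrier (UP R)" "at_pii a = x" "poly_norm a < c"
      and b: "b \<in> carrier (UP R)" "at_pii b = y" "poly_norm b < d"
      using qnorm_less_iff[OF assms(1), of c] qnorm_less_iff[OF assms(2), of d] cd by auto
    have "qnorm (x \<otimes> y) \<le> poly_norm (a \<otimes>\<^bsub>UP R\<^esub> b)"
      using a b assms at_pii_mult ring.ring_simprules(5)[OF UP_ring] by (intro qnorm_le) auto
    also have "\<dots> \<le> poly_norm a * poly_norm b" by (rule poly_norm_mult[OF a(1) b(1)])
    also have "\<dots> \<le> c * d" using a b poly_norm_nonneg[OF a(1)] poly_norm_nonneg[OF b(1)]
      by (intro mult_mono) auto
    finally show ?thesis .
  qed
  \<comment> \<open>The infima need not be attained, so the product bound is reached as a limit of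
    bounds with slack e.\<close>
  have "((\<lambda>e. (qnorm x + e) * (qnorm y + e)) \<longlongrightarrow> (qnorm x + 0) * (qnorm y + 0)) (at_right 0)"
    by (intro tendsto_intros)
  moreover have "eventually (\<lambda>e. qnorm (x \<otimes> y) \<le> (qnorm x + e) * (qnorm y + e)) (at_right 0)"
    using eventually_at_right_less by (rule eventually_mono) (auto intro: le)
  ultimately show ?thesis using tendsto_lowerbound by fastforce
qed

lemma qnorm_uminus_le: "x \<in> carrier R \<Longrightarrow> qnorm (\<ominus> x) \<le> qnorm x"
proof -
  assume x: "x \<in> carrier R"
  have "qnorm (\<ominus> x) = qnorm (\<ominus> \<one> \<otimes> x)" using x by (simp add: l_minus)
  also have "\<dots> \<le> qnorm (\<ominus> \<one>) * qnorm x" using x by (intro qnorm_mult_le) simp_all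
  also have "\<dots> \<le> 1 * qnorm x"
    using qnorm_le_gnorm[of "\<ominus> \<one>"] qnorm_nonneg[OF x] by (intro mult_right_mono) simp_all
  finally show ?thesis by simp
qed

lemma qnorm_minus:
  assumes "x \<in> carrier R" "y \<in> carrier R" shows "qnorm (x \<ominus> y) \<le> max (qnorm x) (qnorm y)"
  using qnorm_add[of x "\<ominus> y"] qnorm_uminus_le[of y] assms by (simp add: minus_eq)

subsection \<open>The lower bound\<close>

text \<open>Nested form of the polynomial value, in which the constant term and one factor
  \<open>pii\<close> can be split off in an induction.\<close>

primrec horner :: "nat \<Rightarrow> (nat \<Rightarrow> 'a) \<Rightarrow> 'a" where
  "horner 0 a = a 0" |
  "horner (Suc n) a = a 0 \<oplus> pii \<otimes> horner n (\<lambda>i. a (Suc i))"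

lemma horner_closed: "(\<And>i. a i \<in> carrier R) \<Longrightarrow> horner n a \<in> carrier R"
  by (induction n arbitrary: a) auto

lemma horner_eq: "(\<And>i. a i \<in> carrier R) \<Longrightarrow> (\<Oplus>i\<in>{..n}. a i \<otimes> pii [^] i) = horner n a"
proof (induction n arbitrary: a)
  case (Suc n)
  have "(\<Oplus>i\<in>{..Suc n}. a i \<otimes> pii [^] i) = (\<Oplus>i\<in>{..n}. a (Suc i) \<otimes> pii [^] Suc i) \<oplus> a 0"
    using Suc.prems finsum_Suc2[of "\<lambda>i. a i \<otimes> pii [^] i" n] by simp
  also have "(\<Oplus>i\<in>{..n}. a (Suc i) \<otimes> pii [^] Suc i) = (\<Oplus>i\<in>{..n}. pii \<otimes> (a (Suc i) \<otimes> pii [^] i))"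
    using Suc.prems by (intro finsum_cong) (auto simp: m_ac)
  also have "\<dots> = pii \<otimes> (\<Oplus>i\<in>{..n}. a (Suc i) \<otimes> pii [^] i)"
    using Suc.prems by (intro finsum_rdistr[symmetric]) auto
  also have "\<dots> = pii \<otimes> horner n (\<lambda>i. a (Suc i))" using Suc by simp
  finally show ?case using Suc.prems horner_closed by (simp add: a_comm)
qed simp

lemma horner_add_const:
  assumes "\<And>i. a i \<in> carrier R" "b \<in> carrier R"
  shows "horner n (a(0 := a 0 \<oplus> b)) = horner n a \<oplus> b"
proof (cases n)
  case (Suc m)
  have "horner m (\<lambda>i. a (Suc i)) \<in> carrier R" using assms by (intro horner_closed) auto
  then show ?thesis using Suc assms by (simp add: a_ac)
qed simp

text \<open>Induction on n. For n = 0 the constant term differs from the stable \<open>y\<close> by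
  a multiple of \<open>pii\<close>, so minimality applies. For larger n the constant term is itself
  a multiple of \<open>pii\<close>; its quotient is added to the next coefficient, giving a
  representation with one factor \<open>pii\<close> less.\<close>

lemma horner_lower_bound:
  assumes y: "y \<in> carrier R" "stab y" and q: "q \<in> carrier R"
    and a: "\<And>i. a i \<in> carrier R" "\<And>i. \<rho> ^ i * gnorm (a i) \<le> B"
    and eq: "horner N a = pii [^] n \<otimes> (y \<oplus> pii \<otimes> q)"
  shows "\<rho> ^ n * gnorm y \<le> B"
  using a eq
proof (induction n arbitrary: a N B)
  \<comment> \<open>For a constant polynomial the remaining part is the zero polynomial, so both
    induction cases can assume a next coefficient.\<close>
  have split: "\<exists>c M h. (\<forall>i. c i \<in> carrier R) \<and> (\<forall>i. \<rho> ^ Suc i * gnorm (c i) \<le> B) \<and> h = horner M c \<and>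
    h \<in> carrier R \<and> horner N a = a 0 \<oplus> pii \<otimes> h"
    if a: "\<And>i. a i \<in> carrier R" "\<And>i. \<rho> ^ i * gnorm (a i) \<le> B" for a N B
  proof (cases N)
    case 0
    have "0 \<le> \<rho> ^ 0 * gnorm (a 0)" using gnorm_nonneg a by simp
    also have "\<dots> \<le> B" by (rule a)
    finally show ?thesis using 0 a by (intro exI[of _ "\<lambda>_. \<zero>"] exI[of _ "0::nat"] exI[of _ "\<zero>"]) simp
  next
    case (Suc M)
    then show ?thesis using a a(2)[of "Suc _"] horner_closed[of "\<lambda>i. a (Suc i)" M]
      by (intro exI[of _ "\<lambda>i. a (Suc i)"] exI[of _ M] exI[of _ "horner M (\<lambda>i. a (Suc i))"]) simp
  qed
  {
    case 0
    obtain h where h: "h \<in> carrier R" "horner N a = a 0 \<oplus> pii \<otimes> h"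
      using split[OF 0(1,2), of N] by blast
    have "y = (y \<oplus> pii \<otimes> q) \<ominus> pii \<otimes> q" using y(1) q pii_closed by algebra
    also have "y \<oplus> pii \<otimes> q = a 0 \<oplus> pii \<otimes> h" using 0(3) h y q by simp
    finally have "y \<ominus> a 0 = (a 0 \<oplus> pii \<otimes> h) \<ominus> pii \<otimes> q \<ominus> a 0" by simp
    also have "\<dots> = pii \<otimes> (h \<ominus> q)" using 0(1)[of 0] h(1) q pii_closed by algebra
    finally have "y \<ominus> a 0 = pii \<otimes> (h \<ominus> q)" .
    then have "gnorm y \<le> gnorm (a 0)" using stable_minimal[OF y 0(1)[of 0], of "h \<ominus> q"] h(1) q by simp
    then show ?case using 0(2)[of 0] by simp
  next
    case (Suc n)
    obtain c M h where c: "\<And>i. c i \<in> carrier R" "\<And>i. \<rho> ^ Suc i * gnorm (c i) \<le> B"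
      and h: "h = horner M c" "h \<in> carrier R" "horner N a = a 0 \<oplus> pii \<otimes> h"
      using split[OF Suc.prems(1,2), of N] by blast
    have a0: "a 0 \<in> carrier R" "gnorm (a 0) \<le> B" using Suc.prems(1) Suc.prems(2)[of 0] by auto
    define v where "v = pii [^] n \<otimes> (y \<oplus> pii \<otimes> q)"
    have vc: "v \<in> carrier R" using y q by (simp add: v_def)
    have pv: "a 0 \<oplus> pii \<otimes> h = pii \<otimes> v"
      using Suc.prems(3) h(3) y(1) q by (simp add: v_def m_ac)
    define b where "b = v \<ominus> h"
    have bc: "b \<in> carrier R" using vc h(2) by (simp add: b_def)
    have "a 0 = (a 0 \<oplus> pii \<otimes> h) \<ominus> pii \<otimes> h" using a0(1) h(2) pii_closed by algebra
    also have "\<dots> = pii \<otimes> b" unfolding pv b_def using vc h(2) pii_closed by algebra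
    finally have gb: "gnorm b = p * gnorm (a 0)" using gnorm_mult[of pii b] gnorm_pii bc by simp
    show ?case
    \<comment> \<open>The bound is divided by \<open>\<rho>\<close> for the induction hypothesis;
      for \<open>\<rho>\<close> = 0 the left-hand side vanishes, as its exponent is
      positive.\<close>
    proof (cases "\<rho> = 0")
      case True
      then show ?thesis using a0 gnorm_nonneg[OF a0(1)] by simp
    next
      case False
      then have pos: "\<rho> > 0" using \<rho>(1) by simp
      \<comment> \<open>Since \<open>b\<close> is \<open>v \<ominus> h\<close>, the modified
        polynomial takes the value \<open>v\<close>. Division by \<open>pii\<close> multiplied the
        norm of \<open>a 0\<close> by p, and the weight \<open>\<rho>\<close> of the new place
        absorbs that factor.\<close>
      define c' where "c' = c(0 := c 0 \<oplus> b)"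
      have c'c: "c' i \<in> carrier R" for i using c bc by (simp add: c'_def)
      have "\<rho> ^ i * gnorm (c' i) \<le> B / \<rho>" for i
      proof -
        have "\<rho> * gnorm (c 0 \<oplus> b) \<le> \<rho> * max (gnorm (c 0)) (gnorm b)"
          using gnorm_add c bc \<rho> by (intro mult_left_mono) auto
        also have "\<dots> \<le> B"
        proof -
          have "(\<rho> * p) * gnorm (a 0) \<le> gnorm (a 0)"
            using \<rho> gnorm_nonneg[OF a0(1)] p_pos by (intro mult_left_le_one_le) simp_all
          then have "\<rho> * gnorm b \<le> B" using a0 gb by (simp add: mult.assoc)
          then show ?thesis using c(2)[of 0] by (simp add: max_def)
        qed
        finally have "\<rho> ^ Suc i * gnorm (c' i) \<le> B" using c(2)[of i] by (cases i) (simp_all add: c'_def)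
        then show ?thesis using pos by (simp add: field_simps)
      qed
      moreover have "horner M c' = h \<oplus> b"
        unfolding c'_def h(1) by (rule horner_add_const) (use c(1) bc in auto)
      moreover have "h \<oplus> b = v" unfolding b_def using h(2) vc by algebra
      ultimately have "\<rho> ^ n * gnorm y \<le> B / \<rho>"
        using Suc.IH[of c' "B / \<rho>" M] c'c by (simp add: v_def)
      then show ?thesis using pos by (simp add: field_simps)
    qed
  }
qed

lemma qnorm_lower_bound:
  assumes y: "y \<in> carrier R" "stab y" and q: "q \<in> carrier R"
  shows "\<rho> ^ n * gnorm y \<le> qnorm (pii [^] n \<otimes> (y \<oplus> pii \<otimes> q))"
proof (rule qnorm_greatest)
  show "pii [^] n \<otimes> (y \<oplus> pii \<otimes> q) \<in> carrier R" using y q by simp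
  fix a assume a: "a \<in> carrier (UP R)" "at_pii a = pii [^] n \<otimes> (y \<oplus> pii \<otimes> q)"
  have "horner (deg R a) a = pii [^] n \<otimes> (y \<oplus> pii \<otimes> q)"
    using a(2) horner_eq[of a "deg R a"] UP_closed[OF a(1)] by (simp add: at_pii_def)
  then show "\<rho> ^ n * gnorm y \<le> poly_norm a"
    using horner_lower_bound[OF y q, of a "poly_norm a"] UP_closed[OF a(1)] poly_norm_upper[OF a(1)] by blast
qed

text \<open>If there were no such term, every term pii^n * y split off from \<open>x\<close> would
  have weight below \<open>qnorm x\<close> and could be absorbed into \<open>e\<close>. The
  remainder is divisible by ever higher powers of \<open>pii\<close> and finally also small, which
  contradicts the size of \<open>x\<close>.\<close>

lemma ex_leading_term:
  assumes x: "x \<in> carrier R" and pos: "qnorm x > 0"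
  shows "\<exists>n e y q. e \<in> carrier R \<and> y \<in> carrier R \<and> q \<in> carrier R \<and> stab y \<and>
    x = e \<oplus> pii [^] n \<otimes> (y \<oplus> pii \<otimes> q) \<and> qnorm e < qnorm x \<and> qnorm x \<le> \<rho> ^ n * gnorm y"
proof (rule ccontr)
  assume no: "\<not> ?thesis"
  define h where "h = qnorm x"
  have "\<exists>e z. e \<in> carrier R \<and> z \<in> carrier R \<and> x = e \<oplus> pii [^] n \<otimes> z \<and> qnorm e < h" for n :: nat
  proof (induction n)
    case 0
    show ?case using x pos qnorm_le_gnorm[of \<zero>] by (intro exI[of _ \<zero>] exI[of _ x]) (simp add: h_def)
  next
    case (Suc n)
    then obtain e z where e: "e \<in> carrier R" "z \<in> carrier R" "x = e \<oplus> pii [^] n \<otimes> z" "qnorm e < h" by blast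
    obtain y q where y: "y \<in> carrier R" "q \<in> carrier R" "z = y \<oplus> pii \<otimes> q" "stab y \<or> gnorm y < h"
      using ex_stable_or_small[OF e(2), of h] pos h_def by blast
    have "\<rho> ^ n * gnorm y < h"
    proof (cases "stab y")
      case True
      have "x = e \<oplus> pii [^] n \<otimes> (y \<oplus> pii \<otimes> q)" using e(3) y(3) by simp
      then have "\<not> h \<le> \<rho> ^ n * gnorm y"
        using no e(1,4) y(1,2) True unfolding h_def by blast
      then show ?thesis by simp
    next
      case False
      then show ?thesis using y mult_left_le_one_le[OF gnorm_nonneg[OF y(1)] \<rho>_pow, of n] by simp
    qed
    then have "qnorm (y \<otimes> pii [^] n) < h" using qnorm_monom[OF y(1), of n] by linarith
    then have "qnorm (e \<oplus> y \<otimes> pii [^] n) < h" using qnorm_add[of e "y \<otimes> pii [^] n"] e y by simp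
    moreover have "x = (e \<oplus> y \<otimes> pii [^] n) \<oplus> pii [^] Suc n \<otimes> q"
    proof -
      have c: "pii [^] n \<in> carrier R" by simp
      have "e \<oplus> pii [^] n \<otimes> (y \<oplus> pii \<otimes> q) = (e \<oplus> y \<otimes> pii [^] n) \<oplus> (pii [^] n \<otimes> pii) \<otimes> q"
        using c e(1) y(1,2) pii_closed by algebra
      then show ?thesis using e(3) y(3) by simp
    qed
    ultimately show ?case using e y by (intro exI[of _ "e \<oplus> y \<otimes> pii [^] n"] exI[of _ q]) simp
  qed
  moreover obtain n where n: "(1 / p) ^ n < h" using real_arch_pow_inv[of h "1 / p"] pos p_gt_1 h_def by auto
  ultimately obtain e z where e: "e \<in> carrier R" "z \<in> carrier R" "x = e \<oplus> pii [^] n \<otimes> z" "qnorm e < h" by blast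
  \<comment> \<open>The power of \<open>pii\<close> alone has norm p^-n, so the remainder is small
    for every \<open>\<rho>\<close>, even when \<open>\<rho>\<close> is as large as 1/p.\<close>
  have "qnorm (pii [^] n \<otimes> z) \<le> gnorm (pii [^] n \<otimes> z)" using e by (intro qnorm_le_gnorm) simp
  also have "\<dots> \<le> (1 / p) ^ n * 1"
    using e gnorm_le_1[OF e(2)] by (simp add: gnorm_mult gnorm_pow gnorm_pii mult_left_le)
  finally have "qnorm (pii [^] n \<otimes> z) < h" using n by simp
  then have "qnorm x < h" using qnorm_add[of e "pii [^] n \<otimes> z"] e by simp
  then show False by (simp add: h_def)
qed

text \<open>Only the inequality from below is at stake. The leading parts multiply to pii^(n+m)
  times a stable element modulo \<open>pii\<close>, to which the lower bound applies, and the errors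
  are strictly smaller than the product of the seminorms.\<close>

lemma qnorm_mult:
  assumes x: "x \<in> carrier R" and y: "y \<in> carrier R" shows "qnorm (x \<otimes> y) = qnorm x * qnorm y"
proof (cases "qnorm x > 0 \<and> qnorm y > 0")
  case False
  then have z: "qnorm x * qnorm y = 0" using qnorm_nonneg[OF x] qnorm_nonneg[OF y] by auto
  have "qnorm (x \<otimes> y) \<ge> 0" using x y by (intro qnorm_nonneg) simp
  then show ?thesis using z qnorm_mult_le[OF x y] by linarith
next
  case True
  let ?h = "qnorm x * qnorm y"
  obtain n e a q where a: "e \<in> carrier R" "a \<in> carrier R" "q \<in> carrier R" "stab a"
    "x = e \<oplus> pii [^] (n::nat) \<otimes> (a \<oplus> pii \<otimes> q)" "qnorm e < qnorm x" "qnorm x \<le> \<rho> ^ n * gnorm a"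
    using ex_leading_term[OF x] True by blast
  obtain m f b r where b: "f \<in> carrier R" "b \<in> carrier R" "r \<in> carrier R" "stab b"
    "y = f \<oplus> pii [^] (m::nat) \<otimes> (b \<oplus> pii \<otimes> r)" "qnorm f < qnorm y" "qnorm y \<le> \<rho> ^ m * gnorm b"
    using ex_leading_term[OF y] True by blast
  define X where "X = pii [^] n \<otimes> (a \<oplus> pii \<otimes> q)"
  define Y where "Y = pii [^] m \<otimes> (b \<oplus> pii \<otimes> r)"
  have XY: "X \<in> carrier R" "Y \<in> carrier R" using a b by (simp_all add: X_def Y_def)
  have xX: "x = e \<oplus> X" and yY: "y = f \<oplus> Y" using a b by (simp_all add: X_def Y_def)
  have "Y = y \<ominus> f" unfolding yY using XY b(1) by algebra
  then have qY: "qnorm Y \<le> qnorm y" using qnorm_minus[OF y b(1)] b by simp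
  define Q where "Q = a \<otimes> r \<oplus> q \<otimes> b \<oplus> pii \<otimes> (q \<otimes> r)"
  have Qc: "Q \<in> carrier R" using a b by (simp add: Q_def)
  have c: "pii [^] n \<in> carrier R" "pii [^] m \<in> carrier R" by auto
  have "X \<otimes> Y = (pii [^] n \<otimes> pii [^] m) \<otimes> (a \<otimes> b \<oplus> pii \<otimes> Q)"
    unfolding X_def Y_def Q_def using c a(2,3) b(2,3) pii_closed by algebra
  then have XYQ: "X \<otimes> Y = pii [^] (n + m) \<otimes> (a \<otimes> b \<oplus> pii \<otimes> Q)" by (simp add: nat_pow_mult)
  have "?h \<le> (\<rho> ^ n * gnorm a) * (\<rho> ^ m * gnorm b)"
    using a b True by (intro mult_mono) auto
  also have "\<dots> = \<rho> ^ (n + m) * gnorm (a \<otimes> b)" using a b by (simp add: gnorm_mult power_add)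
  also have "\<dots> \<le> qnorm (X \<otimes> Y)"
    unfolding XYQ using a b Qc stab_mult by (intro qnorm_lower_bound) auto
  finally have 1: "?h \<le> qnorm (X \<otimes> Y)" .
  \<comment> \<open>Grouping the error as e * Y + x * f uses the leading part in one term and the
    full factor in the other, so each term has one strictly small factor.\<close>
  have "X \<otimes> Y = x \<otimes> y \<ominus> (e \<otimes> Y \<oplus> x \<otimes> f)"
    unfolding xX yY using XY a(1) b(1) by algebra
  then have "qnorm (X \<otimes> Y) \<le> max (qnorm (x \<otimes> y)) (max (qnorm (e \<otimes> Y)) (qnorm (x \<otimes> f)))"
    using qnorm_minus[of "x \<otimes> y" "e \<otimes> Y \<oplus> x \<otimes> f"] qnorm_add[of "e \<otimes> Y" "x \<otimes> f"] x y a(1) b(1) XY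
    by simp
  moreover have "qnorm (e \<otimes> Y) < ?h"
  proof -
    have "qnorm (e \<otimes> Y) \<le> qnorm e * qnorm Y" using a XY by (intro qnorm_mult_le)
    also have "\<dots> \<le> qnorm e * qnorm y" using qY qnorm_nonneg a by (intro mult_left_mono) auto
    also have "\<dots> < ?h" using a True by (intro mult_strict_right_mono) auto
    finally show ?thesis .
  qed
  moreover have "qnorm (x \<otimes> f) < ?h"
  proof -
    have "qnorm (x \<otimes> f) \<le> qnorm x * qnorm f" using x b by (intro qnorm_mult_le)
    also have "\<dots> < ?h" using b True by (intro mult_strict_left_mono) auto
    finally show ?thesis .
  qed
  ultimately have "?h \<le> qnorm (x \<otimes> y)" using 1 by linarith
  with qnorm_mult_le[OF x y] show ?thesis by simp
qed

lemma qnorm_zero: "qnorm \<zero> = 0"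
  using qnorm_le_gnorm[of \<zero>] qnorm_nonneg[of \<zero>] by simp

lemma qnorm_one: "qnorm \<one> = 1"
proof -
  have "peak 0 1 \<one>"
    using co_t[of 1] by (simp add: peak_def del: co.simps)
  then have "\<rho> ^ 0 * gnorm \<one> \<le> qnorm (pii [^] (0::nat) \<otimes> (\<one> \<oplus> pii \<otimes> \<zero>))"
    by (intro qnorm_lower_bound) (auto simp: stab_def)
  then show ?thesis using qnorm_le_gnorm[of \<one>] by simp
qed

subsection \<open>Stable presentations\<close>

definition psum :: "(nat \<Rightarrow> 'a) \<Rightarrow> nat \<Rightarrow> 'a" where
  "psum xs n = (\<Oplus>i\<in>{..<n}. xs i \<otimes> pii [^] i)"

lemma psum_Suc: "(\<And>i. xs i \<in> carrier R) \<Longrightarrow> psum xs (Suc n) = psum xs n \<oplus> xs n \<otimes> pii [^] n"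
  by (simp add: psum_def lessThan_Suc finsum_insert a_comm)

lemma psum_closed: "(\<And>i. xs i \<in> carrier R) \<Longrightarrow> psum xs n \<in> carrier R"
  by (simp add: psum_def)

lemma qnorm_psum_le:
  assumes "\<And>i. xs i \<in> carrier R" "\<And>i. i < n \<Longrightarrow> \<rho> ^ i * gnorm (xs i) \<le> B" "B \<ge> 0"
  shows "qnorm (psum xs n) \<le> B"
  using assms(2)
proof (induction n)
  case 0
  then show ?case using assms qnorm_zero by (simp add: psum_def)
next
  case (Suc n)
  have "qnorm (psum xs n \<oplus> xs n \<otimes> pii [^] n) \<le> max (qnorm (psum xs n)) (qnorm (xs n \<otimes> pii [^] n))"
    using psum_closed assms by (intro qnorm_add) auto
  also have "\<dots> \<le> B" using Suc qnorm_monom[OF assms(1)[of n], of n] Suc.prems[of n] by fastforce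
  finally show ?case using psum_Suc assms by simp
qed

text \<open>Puts every later partial sum in the form to which \<open>qnorm_lower_bound\<close>
  applies, with \<open>xs k\<close> in the role of the stable element.\<close>

lemma psum_split:
  assumes xs: "\<And>i. xs i \<in> carrier R"
  shows "\<exists>q\<in>carrier R. psum xs (Suc (k + n)) = psum xs k \<oplus> pii [^] k \<otimes> (xs k \<oplus> pii \<otimes> q)"
proof (induction n)
  case 0
  show ?case using xs psum_Suc by (intro bexI[of _ \<zero>]) (simp_all add: m_comm)
next
  case (Suc n)
  then obtain q where q: "q \<in> carrier R" "psum xs (Suc (k + n)) = psum xs k \<oplus> pii [^] k \<otimes> (xs k \<oplus> pii \<otimes> q)" by blast
  let ?z = "xs (Suc (k + n))"
  have c: "pii [^] k \<in> carrier R" "pii [^] n \<in> carrier R" "psum xs k \<in> carrier R" "xs k \<in> carrier R" "?z \<in> carrier R"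
    using xs psum_closed by auto
  have "psum xs (Suc (k + Suc n)) = psum xs (Suc (k + n)) \<oplus> ?z \<otimes> pii [^] Suc (k + n)"
    using psum_Suc[OF xs] by simp
  also have "pii [^] Suc (k + n) = pii [^] k \<otimes> pii [^] n \<otimes> pii" by (simp add: nat_pow_mult)
  also have "psum xs (Suc (k + n)) \<oplus> ?z \<otimes> (pii [^] k \<otimes> pii [^] n \<otimes> pii) =
    psum xs k \<oplus> pii [^] k \<otimes> (xs k \<oplus> pii \<otimes> (q \<oplus> ?z \<otimes> pii [^] n))"
    unfolding q(2) using c q(1) pii_closed by algebra
  finally show ?case using q c by blast
qed

text \<open>Convergence in norm suffices, because \<open>qnorm\<close> is bounded by
  \<open>gnorm\<close>: far enough out, an infinite presentation behaves like a finite one.\<close>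

lemma qnorm_presentation:
  assumes x: "x \<in> carrier R" and xs: "\<And>i. xs i \<in> carrier R" "\<And>i. stab (xs i)"
    and lim: "\<And>e. e > 0 \<Longrightarrow> \<exists>N. \<forall>n\<ge>N. gnorm (x \<ominus> psum xs n) < e"
  shows "\<rho> ^ i * gnorm (xs i) \<le> qnorm x" "\<exists>i. qnorm x = \<rho> ^ i * gnorm (xs i)"
proof -
  define m where "m i = \<rho> ^ i * gnorm (xs i)" for i
  have m0: "m i \<ge> 0" for i using \<rho>_pow gnorm_nonneg xs by (simp add: m_def)
  have upper: "m i \<le> qnorm x" for i
  proof (rule ccontr)
    assume "\<not> m i \<le> qnorm x"
    then have ex: "m i > qnorm x" by simp
    \<comment> \<open>All earlier terms have weight at most \<open>qnorm x\<close>, so the part of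
      the sum from index k on would also be bounded by max (qnorm x) (qnorm e), which is less than
      the weight of its stable leading term.\<close>
    define k where "k = (LEAST i. m i > qnorm x)"
    have k: "m k > qnorm x" unfolding k_def using ex by (rule LeastI)
    have below: "m j \<le> qnorm x" if "j < k" for j
      using not_less_Least[of j "\<lambda>i. m i > qnorm x"] that k_def by auto
    have mk: "m k > 0" using k qnorm_nonneg[OF x] by linarith
    obtain N where N: "\<And>n. n \<ge> N \<Longrightarrow> gnorm (x \<ominus> psum xs n) < m k" using lim[OF mk] by auto
    obtain q where q: "q \<in> carrier R" "psum xs (Suc (k + N)) = psum xs k \<oplus> pii [^] k \<otimes> (xs k \<oplus> pii \<otimes> q)"
      using psum_split[of xs k N, OF xs(1)] by auto
    define e where "e = x \<ominus> psum xs (Suc (k + N))"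
    have e: "e \<in> carrier R" "gnorm e < m k"
      using N[of "Suc (k + N)"] x psum_closed[OF xs(1)] by (simp_all add: e_def)
    have c: "psum xs k \<in> carrier R" "pii [^] k \<otimes> (xs k \<oplus> pii \<otimes> q) \<in> carrier R"
      using psum_closed xs q by auto
    have "pii [^] k \<otimes> (xs k \<oplus> pii \<otimes> q) = x \<ominus> (psum xs k \<oplus> e)"
      unfolding e_def q(2) using c x by algebra
    then have "qnorm (pii [^] k \<otimes> (xs k \<oplus> pii \<otimes> q)) \<le> max (qnorm x) (max (qnorm (psum xs k)) (qnorm e))"
      using qnorm_minus[of x "psum xs k \<oplus> e"] qnorm_add[of "psum xs k" e] x c e by simp
    moreover have "qnorm (psum xs k) \<le> qnorm x"
      using below qnorm_nonneg[OF x] xs by (intro qnorm_psum_le) (auto simp: m_def)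
    moreover have "m k \<le> qnorm (pii [^] k \<otimes> (xs k \<oplus> pii \<otimes> q))"
      unfolding m_def using xs q by (intro qnorm_lower_bound)
    ultimately show False using k e qnorm_le_gnorm[OF e(1)] by linarith
  qed
  then show "\<rho> ^ i * gnorm (xs i) \<le> qnorm x" by (simp add: m_def)
  show "\<exists>i. qnorm x = \<rho> ^ i * gnorm (xs i)"
  proof (rule ccontr)
    assume "\<not> ?thesis"
    then have less: "m i < qnorm x" for i using upper[of i] unfolding m_def by (metis order_less_le)
    have pos: "qnorm x > 0" using less[of 0] m0[of 0] by (meson order.strict_trans1)
    obtain n where n: "gnorm (x \<ominus> psum xs n) < qnorm x" using lim[OF pos] by (meson order_refl)
    \<comment> \<open>A maximum over finitely many terms stays strictly below
      \<open>qnorm x\<close>, whereas the supremum of all weights might not. Inserting 0 covers n =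
      0.\<close>
    define B where "B = Max (insert 0 (m ` {..<n}))"
    have "B < qnorm x" unfolding B_def using pos less by (subst Max_less_iff) auto
    moreover have "qnorm (psum xs n) \<le> B"
      using xs by (intro qnorm_psum_le) (auto simp: B_def m_def[symmetric])
    moreover have "x = psum xs n \<oplus> (x \<ominus> psum xs n)" using x psum_closed[of xs n, OF xs(1)] by algebra
    then have "qnorm x \<le> max (qnorm (psum xs n)) (qnorm (x \<ominus> psum xs n))"
      using qnorm_add[of "psum xs n" "x \<ominus> psum xs n"] x psum_closed[of xs n, OF xs(1)] by simp
    ultimately show False using n qnorm_le_gnorm[of "x \<ominus> psum xs n"] x psum_closed[of xs n, OF xs(1)] by simp
  qed
qed

end

section \<open>The coefficient rings\<close>

lemma subring_val_ring: "nonarch_norm nm \<Longrightarrow> is_subring (val_ring nm)"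
  using nonarch_normD[of nm]
  by (auto simp: is_subring_def val_ring_def mult_le_one intro: order_trans[OF nonarch_normD(8)])

lemma subring_rec_simps [simp]:
  "carrier (subring_rec A) = A" "mult (subring_rec A) = (*)" "one (subring_rec A) = 1"
  "zero (subring_rec A) = 0" "add (subring_rec A) = (+)"
  by (simp_all add: subring_rec_def)

lemma cring_subring_rec:
  assumes "is_subring A" shows "cring (subring_rec A)"
proof (rule cringI)
  note S = is_subringD[OF assms]
  show "abelian_group (subring_rec A)"
    by (rule abelian_groupI) (use S in \<open>auto simp: add_ac intro!: bexI[of _ "- _"]\<close>)
  show "comm_monoid (subring_rec A)"
    by (rule comm_monoidI) (use S in \<open>auto simp: mult_ac\<close>)
qed (auto simp: distrib_right)

lemma frobenius_add:
  fixes x y :: "'a::comm_ring_1"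
  assumes "prime p" "of_nat p = (0::'a)"
  shows "(x + y) ^ (p ^ k) = x ^ (p ^ k) + y ^ (p ^ k)"
proof (induction k)
  case (Suc k)
  have 1: "(x + y) ^ p = x ^ p + y ^ p" for x y :: 'a
    using prime_dvd_add_power[OF assms(1), of x y] assms(2) by simp
  have "(x + y) ^ (p ^ Suc k) = ((x + y) ^ (p ^ k)) ^ p" by (simp add: power_mult[symmetric] mult.commute)
  also have "\<dots> = x ^ (p ^ Suc k) + y ^ (p ^ Suc k)"
    unfolding Suc 1 by (simp add: power_mult[symmetric] mult.commute)
  finally show ?case .
qed simp

locale witt_setting =
  fixes D :: "('l::field, 'e::field) witt_data"
  assumes D: "witt_setup D"
begin

abbreviation "p \<equiv> charp D"
abbreviation "nE \<equiv> absE D"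
abbreviation "nL \<equiv> absL D"
text \<open>This is the norm of the uniformizer of E, not the order of the finite field, which is
  \<open>cardq D\<close>.\<close>

abbreviation "q \<equiv> nE (unif D)"
abbreviation "s \<equiv> structE D"

lemma p: "prime p"
  and char: "of_nat p = (0::'l)"
  and root: "\<exists>b::'l. b ^ p = a"
  and nL: "nonarch_norm nL" and nE: "nonarch_norm nE"
  and unif: "uniformizer nE (unif D)"
  and s_hom: "s \<in> ring_hom (witt_ring p (Fq D)) (OE D)"
proof -
  show "prime p" "nonarch_norm nL" "nonarch_norm nE" "uniformizer nE (unif D)"
    "s \<in> ring_hom (witt_ring p (Fq D)) (OE D)"
    using D by (auto simp: witt_setup_def)
  show "of_nat p = (0::'l)" using D of_nat_CHAR[where 'a = 'l] by (simp add: witt_setup_def)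
  show "\<exists>b::'l. b ^ p = a" using D unfolding witt_setup_def surj_def by metis
qed

lemmas nL_simps = nonarch_normD[OF nL] and nE_simps = nonarch_normD[OF nE]

lemma OL_iff: "a \<in> OL D \<longleftrightarrow> nL a \<le> 1"
  by (simp add: OL_def val_ring_def)

lemma perfect_OL: "perfect_subring p (OL D)"
  unfolding perfect_subring_def
proof (intro conjI ballI)
  show "is_subring (OL D)" unfolding OL_def by (rule subring_val_ring[OF nL])
  fix a assume a: "a \<in> OL D"
  obtain b where b: "b ^ p = a" using root by blast
  have "nL b \<le> 1"
  proof (rule ccontr)
    assume "\<not> nL b \<le> 1"
    then have "nL b ^ p > 1" using prime_gt_0_nat[OF p] by (intro one_less_power) auto
    then show False using a b nL_simps(9)[of b p] by (simp add: OL_iff)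
  qed
  then show "\<exists>b\<in>OL D. b ^ p = a" using b by (auto simp: OL_iff)
qed

lemma q_pow: "\<exists>k>0. cardq D = p ^ k"
  using D by (auto simp: witt_setup_def)

lemma perfect_Fq: "perfect_subring p (Fq D)"
proof -
  obtain k where k: "k > 0" "cardq D = p ^ k" using q_pow by blast
  have F: "a \<in> Fq D \<longleftrightarrow> a ^ (p ^ k) = a" for a :: 'l by (simp add: Fq_def k)
  have diff: "(x - y) ^ (p ^ k) = x ^ (p ^ k) - y ^ (p ^ k)" for x y :: 'l
    using frobenius_add[OF p char, of "x - y" y k] by simp
  show ?thesis
    unfolding perfect_subring_def
  proof (intro conjI ballI)
    show "is_subring (Fq D)" by (simp add: is_subring_def F diff power_mult_distrib)
    fix a assume a: "a \<in> Fq D"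
    \<comment> \<open>On the finite field the inverse of Frobenius is its (k-1)-st iterate.\<close>
    have "(a ^ (p ^ (k - 1))) ^ p = a ^ (p ^ k)"
      using k by (simp add: power_mult[symmetric] power_Suc2[symmetric] del: power_Suc)
    moreover have "a ^ (p ^ (k - 1)) \<in> Fq D"
      using a by (simp add: F power_mult[symmetric] mult.commute) (simp add: power_mult)
    ultimately show "\<exists>b\<in>Fq D. b ^ p = a" using a by (auto simp: F)
  qed
qed

lemma Fq_subset: "Fq D \<subseteq> OL D"
proof
  fix a assume a: "a \<in> Fq D"
  obtain k where k: "k > 0" "cardq D = p ^ k" using q_pow by blast
  have "1 < p ^ k" using prime_gt_1_nat[OF p] k by (intro one_less_power)
  show "a \<in> OL D"
  proof (rule ccontr)
    assume "a \<notin> OL D"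
    then have "nL a ^ 1 < nL a ^ (p ^ k)"
      using \<open>1 < p ^ k\<close> by (intro power_strict_increasing) (auto simp: OL_iff)
    then show False using a k nL_simps(9)[of a "p ^ k"] by (simp add: Fq_def)
  qed
qed

lemma Fq_inverse: "a \<in> Fq D \<Longrightarrow> inverse a \<in> Fq D"
  by (simp add: Fq_def power_inverse)

abbreviation "K \<equiv> witt_ring p (OL D)"

sublocale wp: witt_pair p "OL D" "Fq D" K
  by unfold_locales (use p char perfect_OL perfect_Fq Fq_subset Fq_inverse in auto)

lemma OE_simps:
  "carrier (OE D) = {x. nE x \<le> 1}" "mult (OE D) = (*)" "one (OE D) = 1" "zero (OE D) = 0" "add (OE D) = (+)"
  by (simp_all add: OE_def val_ring_def)

lemma OE_cring: "cring (OE D)"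
  unfolding OE_def by (intro cring_subring_rec subring_val_ring[OF nE])

sublocale tn: tensor "witt_ring p (Fq D)" K "OE D" "\<lambda>a. a" s
proof (intro tensor.intro tensor_axioms.intro wp.WB_cring wp.K.is_cring OE_cring s_hom)
  show "(\<lambda>a. a) \<in> ring_hom (witt_ring p (Fq D)) K"
    using subsetD[OF Fq_subset] by (auto intro!: ring_hom_memI simp: witt_ring_simps)
qed

subsection \<open>The structure map\<close>

lemma s_closed: "x \<in> wp.WB \<Longrightarrow> nE (s x) \<le> 1"
  using ring_hom_closed[OF s_hom, of x] by (simp add: witt_ring_simps OE_simps)

lemma s_add: "x \<in> wp.WB \<Longrightarrow> y \<in> wp.WB \<Longrightarrow> s (x \<oplus>\<^bsub>K\<^esub> y) = s x + s y"
  using ring_hom_add[OF s_hom, of x y] by (simp add: witt_ring_simps OE_simps)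

lemma s_mult: "x \<in> wp.WB \<Longrightarrow> y \<in> wp.WB \<Longrightarrow> s (x \<otimes>\<^bsub>K\<^esub> y) = s x * s y"
  using ring_hom_mult[OF s_hom, of x y] by (simp add: witt_ring_simps OE_simps)

lemma s_one: "s \<one>\<^bsub>K\<^esub> = 1"
  using ring_hom_one[OF s_hom] by (simp add: witt_ring_simps OE_simps)

lemma s_zero: "s \<zero>\<^bsub>K\<^esub> = 0"
proof -
  have "s \<zero>\<^bsub>K\<^esub> + 0 = s \<zero>\<^bsub>K\<^esub> + s \<zero>\<^bsub>K\<^esub>"
    using s_add[OF wp.zero_WB wp.zero_WB] by (simp only: wp.K.l_zero[OF wp.K.zero_closed] add_0_right)
  then show ?thesis by (simp only: add_left_cancel)
qed

lemma residue_coset: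
  obtains j where "bij_betw j (Fq D) (carrier (residue_field nE))"
    "\<And>a. a \<in> wp.WB \<Longrightarrow> max_ideal nE +>\<^bsub>OE D\<^esub> s a = j (a 0)"
  using D that by (auto simp: witt_setup_def ring_iso_def witt_ring_simps)

lemma coset_OE: "x \<in> max_ideal nE +>\<^bsub>OE D\<^esub> y \<longleftrightarrow> nE (x - y) < 1"
  by (auto simp: a_r_coset_def' OE_simps max_ideal_def intro!: exI[of _ "x - y"])

text \<open>The residue isomorphism speaks only of cosets, so \<open>s a\<close> is compared with
  the image of zero, which has the same first component.\<close>

lemma s_small: assumes "a \<in> wp.WB" "a 0 = 0" shows "nE (s a) < 1"
proof -
  obtain j where j: "\<And>a. a \<in> wp.WB \<Longrightarrow> max_ideal nE +>\<^bsub>OE D\<^esub> s a = j (a 0)"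
    using residue_coset by blast
  have "s a \<in> max_ideal nE +>\<^bsub>OE D\<^esub> s a" by (simp add: coset_OE nE_simps)
  also have "max_ideal nE +>\<^bsub>OE D\<^esub> s a = max_ideal nE +>\<^bsub>OE D\<^esub> s \<zero>\<^bsub>K\<^esub>"
    using j[OF assms(1)] j[OF wp.zero_WB] assms(2) by (simp add: wp.zero_K)
  finally show ?thesis by (simp add: coset_OE s_zero)
qed

lemma s_surj: assumes "nE e \<le> 1" shows "\<exists>a\<in>wp.WB. nE (e - s a) < 1"
proof -
  obtain j where j: "bij_betw j (Fq D) (carrier (residue_field nE))"
    "\<And>a. a \<in> wp.WB \<Longrightarrow> max_ideal nE +>\<^bsub>OE D\<^esub> s a = j (a 0)"
    using residue_coset by blast
  have "max_ideal nE +>\<^bsub>OE D\<^esub> e \<in> carrier (residue_field nE)"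
    using assms by (auto simp: residue_field_def FactRing_def A_RCOSETS_def' OE_def val_ring_def)
  then obtain b where b: "b \<in> Fq D" "max_ideal nE +>\<^bsub>OE D\<^esub> e = j b"
    using j(1) by (auto simp: bij_betw_def)
  have t: "teichmueller b \<in> wp.WB" "teichmueller b 0 = b"
    using wp.t_WB[OF b(1)] by (auto simp: teichmueller_def)
  have "e \<in> max_ideal nE +>\<^bsub>OE D\<^esub> e" by (simp add: coset_OE nE_simps)
  also have "max_ideal nE +>\<^bsub>OE D\<^esub> e = max_ideal nE +>\<^bsub>OE D\<^esub> s (teichmueller b)"
    using j(2)[OF t(1)] b(2) t(2) by simp
  finally show ?thesis using t(1) by (auto simp: coset_OE)
qed

lemma q01: "0 < q" "q < 1"
  using unif by (auto simp: uniformizer_def)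

lemma small_divisible: assumes "nE x < 1" shows "\<exists>y. nE y \<le> 1 \<and> x = unif D * y"
proof (cases "x = 0")
  case True
  then show ?thesis using nE_simps(3) by (intro exI[of _ 0]) simp
next
  case False
  then obtain k where k: "nE x = q powi k" using unif by (auto simp: uniformizer_def)
  have "k \<ge> 1"
  proof (rule ccontr)
    assume "\<not> k \<ge> 1"
    then have "q powi k = inverse q ^ nat (- k)" by (cases "k = 0") (auto simp: power_int_def)
    moreover have "inverse q ^ nat (- k) \<ge> 1" using q01 by (intro one_le_power) (simp add: one_le_inverse)
    ultimately show False using assms k by simp
  qed
  then have "q powi k = q ^ nat k" by (simp add: power_int_def)
  also have "\<dots> \<le> q ^ 1" using \<open>k \<ge> 1\<close> q01 by (intro power_decreasing) auto
  finally have "nE x \<le> q" using k by simp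
  then have "nE (x / unif D) \<le> 1" using q01 by (simp add: nE_simps)
  moreover have "unif D \<noteq> 0" using q01 nE_simps(2)[of "unif D"] by simp
  ultimately show ?thesis by (intro exI[of _ "x / unif D"]) simp
qed

text \<open>The image of p lies in the maximal ideal. Only an inequality holds in general: the image
  is 0 in characteristic p and may be more divisible under ramification.\<close>

lemma s_witt_p_pow:
  "y \<in> wp.WB \<Longrightarrow> wp.pw [^]\<^bsub>K\<^esub> (n::nat) \<otimes>\<^bsub>K\<^esub> y \<in> wp.WB \<and> nE (s (wp.pw [^]\<^bsub>K\<^esub> n \<otimes>\<^bsub>K\<^esub> y)) \<le> q ^ n"
proof (induction n)
  case 0
  then show ?case using s_closed[OF 0] wp.WB_sub[OF 0] by simp
next
  case (Suc n)
  let ?v = "wp.pw [^]\<^bsub>K\<^esub> n \<otimes>\<^bsub>K\<^esub> y"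
  have v: "?v \<in> wp.WB" "nE (s ?v) \<le> q ^ n" using Suc by auto
  have eq: "wp.pw [^]\<^bsub>K\<^esub> Suc n \<otimes>\<^bsub>K\<^esub> y = wp.pw \<otimes>\<^bsub>K\<^esub> ?v"
    using wp.WB_sub[OF Suc.prems] wp.K.nat_pow_closed[OF wp.pw_closed, of n] by (simp add: wp.K.m_ac)
  obtain z where z: "nE z \<le> 1" "s wp.pw = unif D * z"
    using small_divisible[OF s_small[OF wp.pw_WB]] witt_p_0 by auto
  have "nE (s wp.pw) \<le> q" using z q01 by (simp add: nE_simps mult_left_le)
  then have "nE (s wp.pw) * nE (s ?v) \<le> q * q ^ n"
    using v q01 nE_simps(1) by (intro mult_mono) auto
  then show ?case unfolding eq s_mult[OF wp.pw_WB v(1)] nE_simps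
    using wp.WB_closed(2)[OF wp.pw_WB v(1)] by simp
qed

subsection \<open>The tensor product modulo the uniformizer\<close>

abbreviation "T \<equiv> tensorLE D"
abbreviation "wT \<equiv> tensLE D \<one>\<^bsub>K\<^esub> (unif D)"
abbreviation "tT \<equiv> \<lambda>a. tensLE D (teichmueller a) \<one>\<^bsub>OE D\<^esub>"

lemma T_eq: "T = tn.TT" and tens_eq: "tensLE D = tn.ten"
  by (simp_all add: tensorLE_def tensLE_def)

sublocale T: cring T
  unfolding T_eq by (rule tn.TT_cring)

lemma unif_OE: "unif D \<in> carrier (OE D)"
  using q01 by (simp add: OE_simps)

lemma one_OE: "1 \<in> carrier (OE D)"
  by (simp add: OE_simps nE_simps)

lemma wT_closed [simp, intro]: "wT \<in> carrier T"
  unfolding T_eq tens_eq using unif_OE by (intro tn.ten_closed wp.K.one_closed)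

lemma tT_closed [simp, intro]: "a \<in> OL D \<Longrightarrow> tT a \<in> carrier T"
  unfolding T_eq tens_eq OE_simps using one_OE wp.t_closed by (intro tn.ten_closed) auto

lemma ten_small:
  assumes b: "b \<in> carrier K" and e: "nE e < 1"
  shows "\<exists>y\<in>carrier T. tensLE D b e = wT \<otimes>\<^bsub>T\<^esub> y"
proof -
  obtain y where y: "nE y \<le> 1" "e = unif D * y" using small_divisible[OF e] by blast
  have "wT \<otimes>\<^bsub>T\<^esub> tensLE D b y = tensLE D b e"
    unfolding T_eq tens_eq using tn.ten_mult[OF wp.K.one_closed unif_OE b, of y] b y by (simp add: OE_simps)
  moreover have "tensLE D b y \<in> carrier T"
    unfolding T_eq tens_eq using b y by (intro tn.ten_closed) (simp_all add: OE_simps)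
  ultimately show ?thesis by (intro bexI[of _ "tensLE D b y"]) auto
qed

text \<open>The factor p lies in W(F_q) and can cross the tensor sign, where its image is divisible
  by the uniformizer.\<close>

lemma ten_witt_p:
  assumes v: "v \<in> carrier K" shows "\<exists>y\<in>carrier T. tensLE D (wp.pw \<otimes>\<^bsub>K\<^esub> v) 1 = wT \<otimes>\<^bsub>T\<^esub> y"
proof -
  have "tensLE D (wp.pw \<otimes>\<^bsub>K\<^esub> v) 1 = tensLE D v (s wp.pw)"
    unfolding tens_eq using tn.ten_balance[of wp.pw v 1] wp.pw_WB v one_OE
    by (simp add: OE_simps witt_ring_simps(1))
  then show ?thesis using ten_small[OF v s_small[OF wp.pw_WB]] witt_p_0 by simp
qed

lemma ten_decomp_one:
  assumes v: "v \<in> carrier K" shows "v 0 \<in> OL D" "\<exists>y\<in>carrier T. tensLE D v 1 = tT (v 0) \<oplus>\<^bsub>T\<^esub> wT \<otimes>\<^bsub>T\<^esub> y"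
proof -
  show v0: "v 0 \<in> OL D" using v by (simp add: wp.carr)
  obtain y where y: "y \<in> carrier K" "v = teichmueller (v 0) \<oplus>\<^bsub>K\<^esub> wp.pw \<otimes>\<^bsub>K\<^esub> y"
    using wp.K_decomp[OF v] by blast
  obtain z where z: "z \<in> carrier T" "tensLE D (wp.pw \<otimes>\<^bsub>K\<^esub> y) 1 = wT \<otimes>\<^bsub>T\<^esub> z"
    using ten_witt_p[OF y(1)] by blast
  have "tensLE D (teichmueller (v 0) \<oplus>\<^bsub>K\<^esub> wp.pw \<otimes>\<^bsub>K\<^esub> y) 1 =
    tT (v 0) \<oplus>\<^bsub>T\<^esub> tensLE D (wp.pw \<otimes>\<^bsub>K\<^esub> y) 1"
    unfolding T_eq tens_eq OE_simps
    using y(1) v0 one_OE by (intro tn.ten_add_left wp.t_closed wp.K.m_closed wp.pw_closed)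
  then have "tensLE D v 1 = tT (v 0) \<oplus>\<^bsub>T\<^esub> wT \<otimes>\<^bsub>T\<^esub> z" using y(2) z(2) by metis
  then show "\<exists>y\<in>carrier T. tensLE D v 1 = tT (v 0) \<oplus>\<^bsub>T\<^esub> wT \<otimes>\<^bsub>T\<^esub> y" using z(1) by blast
qed

lemma tT_add:
  assumes "a \<in> OL D" "b \<in> OL D"
  shows "\<exists>y\<in>carrier T. tT a \<oplus>\<^bsub>T\<^esub> tT b = tT (a + b) \<oplus>\<^bsub>T\<^esub> wT \<otimes>\<^bsub>T\<^esub> y"
proof -
  let ?v = "teichmueller a \<oplus>\<^bsub>K\<^esub> teichmueller b"
  have v: "?v \<in> carrier K" "?v 0 = a + b"
    using assms wp.t_closed by (auto simp: wp.add_0) (simp_all add: teichmueller_def)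
  have "tensLE D ?v 1 = tT a \<oplus>\<^bsub>T\<^esub> tT b"
    unfolding T_eq tens_eq OE_simps using assms one_OE by (intro tn.ten_add_left wp.t_closed)
  then show ?thesis using ten_decomp_one(2)[OF v(1)] v(2) by simp
qed

lemma tT_diff:
  assumes "a \<in> OL D" "b \<in> OL D"
  shows "a - b \<in> OL D" "\<exists>y\<in>carrier T. tT a \<ominus>\<^bsub>T\<^esub> tT b = tT (a - b) \<oplus>\<^bsub>T\<^esub> wT \<otimes>\<^bsub>T\<^esub> y"
proof -
  show ab: "a - b \<in> OL D" using assms wp.subrings by (auto intro: is_subringD)
  obtain y where y: "y \<in> carrier T" "tT (a - b) \<oplus>\<^bsub>T\<^esub> tT b = tT a \<oplus>\<^bsub>T\<^esub> wT \<otimes>\<^bsub>T\<^esub> y"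
    using tT_add[OF ab assms(2)] by auto
  have c: "tT a \<in> carrier T" "tT b \<in> carrier T" "tT (a - b) \<in> carrier T" "wT \<in> carrier T" using assms ab by auto
  have "tT a \<ominus>\<^bsub>T\<^esub> tT b = (tT a \<oplus>\<^bsub>T\<^esub> wT \<otimes>\<^bsub>T\<^esub> y) \<oplus>\<^bsub>T\<^esub> wT \<otimes>\<^bsub>T\<^esub> (\<ominus>\<^bsub>T\<^esub> y) \<ominus>\<^bsub>T\<^esub> tT b"
    using c y(1) by algebra
  also have "tT a \<oplus>\<^bsub>T\<^esub> wT \<otimes>\<^bsub>T\<^esub> y = tT (a - b) \<oplus>\<^bsub>T\<^esub> tT b" by (rule y(2)[symmetric])
  also have "(tT (a - b) \<oplus>\<^bsub>T\<^esub> tT b) \<oplus>\<^bsub>T\<^esub> wT \<otimes>\<^bsub>T\<^esub> (\<ominus>\<^bsub>T\<^esub> y) \<ominus>\<^bsub>T\<^esub> tT b =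
    tT (a - b) \<oplus>\<^bsub>T\<^esub> wT \<otimes>\<^bsub>T\<^esub> (\<ominus>\<^bsub>T\<^esub> y)" using c y(1) by algebra
  finally show "\<exists>y\<in>carrier T. tT a \<ominus>\<^bsub>T\<^esub> tT b = tT (a - b) \<oplus>\<^bsub>T\<^esub> wT \<otimes>\<^bsub>T\<^esub> y"
    using y(1) by blast
qed

text \<open>In a pure tensor, the second entry is congruent to some \<open>s a\<close> because the
  residue field is the finite field; moving \<open>a\<close> to the left leaves a tensor with second
  entry 1, whose class is given by the first Witt component.\<close>

lemma T_decomp:
  assumes "x \<in> carrier T"
  shows "\<exists>a\<in>OL D. \<exists>y\<in>carrier T. x = tT a \<oplus>\<^bsub>T\<^esub> wT \<otimes>\<^bsub>T\<^esub> y"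
proof -
  have "x \<in> carrier tn.TT" using assms by (simp add: T_eq)
  then show ?thesis
  proof (induction x rule: tn.ten_induct)
    case (ten b e)
    then have e: "nE e \<le> 1" by (simp add: OE_simps)
    obtain a where a: "a \<in> wp.WB" "nE (e - s a) < 1" using s_surj[OF e] by blast
    have ac: "nE (s a) \<le> 1" "a \<in> carrier (witt_ring p (Fq D))"
      using s_closed[OF a(1)] a(1) by (simp_all add: witt_ring_simps)
    have vc: "a \<otimes>\<^bsub>K\<^esub> b \<in> carrier K" using ten(1) wp.WB_sub[OF a(1)] by simp
    obtain y where y: "y \<in> carrier T" "tensLE D b (e - s a) = wT \<otimes>\<^bsub>T\<^esub> y"
      using ten_small[OF ten(1) a(2)] by blast
    obtain z where z: "z \<in> carrier T"
      "tensLE D (a \<otimes>\<^bsub>K\<^esub> b) 1 = tT ((a \<otimes>\<^bsub>K\<^esub> b) 0) \<oplus>\<^bsub>T\<^esub> wT \<otimes>\<^bsub>T\<^esub> z"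
      using ten_decomp_one(2)[OF vc] by blast
    note v0 = ten_decomp_one(1)[OF vc]
    have "tensLE D b e = tensLE D b (s a) \<oplus>\<^bsub>T\<^esub> tensLE D b (e - s a)"
      unfolding T_eq tens_eq using tn.ten_add_right[OF ten(1), of "e - s a" "s a"] ac a(2) by (simp add: OE_simps)
    also have "tensLE D b (s a) = tensLE D (a \<otimes>\<^bsub>K\<^esub> b) 1"
      unfolding tens_eq using tn.ten_balance[OF ac(2) ten(1) one_OE] by (simp add: OE_simps)
    finally have "tensLE D b e = (tT ((a \<otimes>\<^bsub>K\<^esub> b) 0) \<oplus>\<^bsub>T\<^esub> wT \<otimes>\<^bsub>T\<^esub> z) \<oplus>\<^bsub>T\<^esub> wT \<otimes>\<^bsub>T\<^esub> y"
      unfolding y(2) z(2) .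
    also have "\<dots> = tT ((a \<otimes>\<^bsub>K\<^esub> b) 0) \<oplus>\<^bsub>T\<^esub> wT \<otimes>\<^bsub>T\<^esub> (z \<oplus>\<^bsub>T\<^esub> y)"
      using tT_closed[OF v0] wT_closed y(1) z(1) by algebra
    finally show ?case using v0 T.a_closed[OF z(1) y(1)] unfolding tens_eq by blast
  next
    case (diff x y)
    obtain a v where a: "a \<in> OL D" "v \<in> carrier T" "x = tT a \<oplus>\<^bsub>T\<^esub> wT \<otimes>\<^bsub>T\<^esub> v" using diff by blast
    obtain b z where b: "b \<in> OL D" "z \<in> carrier T" "y = tT b \<oplus>\<^bsub>T\<^esub> wT \<otimes>\<^bsub>T\<^esub> z" using diff by blast
    obtain d where d: "d \<in> carrier T" "tT a \<ominus>\<^bsub>T\<^esub> tT b = tT (a - b) \<oplus>\<^bsub>T\<^esub> wT \<otimes>\<^bsub>T\<^esub> d"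
      using tT_diff(2)[OF a(1) b(1)] by blast
    note ab = tT_diff(1)[OF a(1) b(1)]
    have c: "tT a \<in> carrier T" "tT b \<in> carrier T" "tT (a - b) \<in> carrier T" "wT \<in> carrier T" using a b ab by auto
    have "x \<ominus>\<^bsub>T\<^esub> y = (tT a \<ominus>\<^bsub>T\<^esub> tT b) \<oplus>\<^bsub>T\<^esub> wT \<otimes>\<^bsub>T\<^esub> (v \<ominus>\<^bsub>T\<^esub> z)"
      unfolding a(3) b(3) using c a(2) b(2) by algebra
    also have "\<dots> = tT (a - b) \<oplus>\<^bsub>T\<^esub> wT \<otimes>\<^bsub>T\<^esub> (d \<oplus>\<^bsub>T\<^esub> (v \<ominus>\<^bsub>T\<^esub> z))"
      unfolding d(2) using c a(2) b(2) d(1) by algebra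
    finally show ?case unfolding T_eq[symmetric] using ab a(2) b(2) d(1) by blast
  qed
qed

lemma wT_pow: "wT [^]\<^bsub>T\<^esub> (n::nat) = tensLE D \<one>\<^bsub>K\<^esub> (unif D ^ n) \<and> nE (unif D ^ n) = q ^ n"
proof (induction n)
  case 0
  then show ?case unfolding T_eq tens_eq using tn.ten_one by (simp add: OE_simps nE_simps)
next
  case (Suc n)
  have "nE (unif D ^ n) \<le> 1" using Suc q01 by (simp add: power_le_one)
  then have "tensLE D \<one>\<^bsub>K\<^esub> (unif D ^ n) \<otimes>\<^bsub>T\<^esub> wT = tensLE D \<one>\<^bsub>K\<^esub> (unif D ^ Suc n)"
    unfolding T_eq tens_eq using tn.ten_mult[OF wp.K.one_closed _ wp.K.one_closed unif_OE, of "unif D ^ n"]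
    by (simp add: OE_simps mult.commute)
  then show ?case using Suc by (simp add: nE_simps)
qed

text \<open>The coordinate functional at \<open>c\<close> extends to the tensor product and sends $[c]$ to a unit of
  $\mathcal{O}_E$; this replaces the flatness of $W(\mathcal{O}_L)$ over $W(\mathbb{F}_q)$ and treats both
  characteristics of $E$ at once.\<close>

lemma order_bound:
  assumes c: "c \<in> OL D" "c \<noteq> 0" and y: "y \<in> carrier T" and z: "z \<in> carrier T"
    and eq: "wT [^]\<^bsub>T\<^esub> (i::nat) \<otimes>\<^bsub>T\<^esub> (tT c \<oplus>\<^bsub>T\<^esub> wT \<otimes>\<^bsub>T\<^esub> y) = wT [^]\<^bsub>T\<^esub> (m::nat) \<otimes>\<^bsub>T\<^esub> z"
  shows "m \<le> i"
proof (rule ccontr)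
  assume "\<not> m \<le> i"
  then have im: "i < m" by simp
  from wp.ex_coordinate[OF c, of m] obtain \<phi> where \<phi>: "\<And>x. x \<in> carrier K \<Longrightarrow> \<phi> x \<in> wp.WB"
    and \<phi>_add: "\<And>x y. x \<in> carrier K \<Longrightarrow> y \<in> carrier K \<Longrightarrow>
      \<exists>z\<in>wp.WB. \<phi> (x \<oplus>\<^bsub>K\<^esub> y) = (\<phi> x \<oplus>\<^bsub>K\<^esub> \<phi> y) \<oplus>\<^bsub>K\<^esub> wp.pw [^]\<^bsub>K\<^esub> m \<otimes>\<^bsub>K\<^esub> z"
    and \<phi>_mult: "\<And>b x. b \<in> wp.WB \<Longrightarrow> x \<in> carrier K \<Longrightarrow>
      \<exists>z\<in>wp.WB. \<phi> (b \<otimes>\<^bsub>K\<^esub> x) = (b \<otimes>\<^bsub>K\<^esub> \<phi> x) \<oplus>\<^bsub>K\<^esub> wp.pw [^]\<^bsub>K\<^esub> m \<otimes>\<^bsub>K\<^esub> z"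
    and \<phi>_c: "\<exists>z\<in>wp.WB. \<phi> (teichmueller c) = \<one>\<^bsub>K\<^esub> \<oplus>\<^bsub>K\<^esub> wp.pw [^]\<^bsub>K\<^esub> m \<otimes>\<^bsub>K\<^esub> z"
    by (elim exE conjE) blast
  \<comment> \<open>The coordinate modulo p^m is composed with the structure map and extended by
    scalars of the valuation ring of E; its failure to be additive and balanced lies in
    \<open>N\<close>.\<close>
  define \<psi> where "\<psi> = (\<lambda>(b, e). s (\<phi> b) * e)"
  define N where "N = {x. nE x \<le> q ^ m}"
  have NI: "s (wp.pw [^]\<^bsub>K\<^esub> m \<otimes>\<^bsub>K\<^esub> z) * e \<in> N" if "z \<in> wp.WB" "nE e \<le> 1" for z e
    using s_witt_p_pow[OF that(1), of m] that(2) nE_simps(1)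
    by (auto simp: N_def nE_simps intro: order_trans[OF mult_left_le])
  have kill: "lin_ext \<psi> x \<in> N" if "x \<in> tn.JJ" for x
  proof (rule tn.additive_map_JJ[OF _ _ _ _ _ that])
    show "0 \<in> N" using q01 by (simp add: N_def nE_simps)
    show "x - y \<in> N" if "x \<in> N" "y \<in> N" for x y
      using that nE_simps(8)[of x y] by (simp add: N_def)
  next
    fix b b' e assume b: "b \<in> carrier K" "b' \<in> carrier K" "e \<in> carrier (OE D)"
    obtain z where z: "z \<in> wp.WB" "\<phi> (b \<oplus>\<^bsub>K\<^esub> b') = (\<phi> b \<oplus>\<^bsub>K\<^esub> \<phi> b') \<oplus>\<^bsub>K\<^esub> wp.pw [^]\<^bsub>K\<^esub> m \<otimes>\<^bsub>K\<^esub> z"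
      using \<phi>_add[OF b(1,2)] by blast
    note w = s_witt_p_pow[OF z(1), of m, THEN conjunct1]
    have "s (\<phi> (b \<oplus>\<^bsub>K\<^esub> b')) = s (\<phi> b) + s (\<phi> b') + s (wp.pw [^]\<^bsub>K\<^esub> m \<otimes>\<^bsub>K\<^esub> z)"
      unfolding z(2) s_add[OF wp.WB_closed(1)[OF \<phi>[OF b(1)] \<phi>[OF b(2)]] w] s_add[OF \<phi>[OF b(1)] \<phi>[OF b(2)]] ..
    then have "\<psi> (b \<oplus>\<^bsub>K\<^esub> b', e) - \<psi> (b, e) - \<psi> (b', e) = s (wp.pw [^]\<^bsub>K\<^esub> m \<otimes>\<^bsub>K\<^esub> z) * e"
      by (simp add: \<psi>_def algebra_simps)
    then show "\<psi> (b \<oplus>\<^bsub>K\<^esub> b', e) - \<psi> (b, e) - \<psi> (b', e) \<in> N"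
      using NI[OF z(1)] b(3) by (simp add: OE_simps)
  next
    fix b e e' assume "b \<in> carrier K" "e \<in> carrier (OE D)" "e' \<in> carrier (OE D)"
    show "\<psi> (b, e \<oplus>\<^bsub>OE D\<^esub> e') - \<psi> (b, e) - \<psi> (b, e') \<in> N"
      using q01 by (simp add: \<psi>_def OE_simps algebra_simps N_def nE_simps)
  next
    fix a b e assume a: "a \<in> carrier (witt_ring p (Fq D))" and b: "b \<in> carrier K" "e \<in> carrier (OE D)"
    have a': "a \<in> wp.WB" using a by (simp add: witt_ring_simps)
    obtain z where z: "z \<in> wp.WB" "\<phi> (a \<otimes>\<^bsub>K\<^esub> b) = (a \<otimes>\<^bsub>K\<^esub> \<phi> b) \<oplus>\<^bsub>K\<^esub> wp.pw [^]\<^bsub>K\<^esub> m \<otimes>\<^bsub>K\<^esub> z"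
      using \<phi>_mult[OF a' b(1)] by blast
    note w = s_witt_p_pow[OF z(1), of m, THEN conjunct1]
    have "s (\<phi> (a \<otimes>\<^bsub>K\<^esub> b)) = s a * s (\<phi> b) + s (wp.pw [^]\<^bsub>K\<^esub> m \<otimes>\<^bsub>K\<^esub> z)"
      unfolding z(2) s_add[OF wp.WB_closed(2)[OF a' \<phi>[OF b(1)]] w] s_mult[OF a' \<phi>[OF b(1)]] ..
    then have "\<psi> (a \<otimes>\<^bsub>K\<^esub> b, e) - \<psi> (b, s a \<otimes>\<^bsub>OE D\<^esub> e) = s (wp.pw [^]\<^bsub>K\<^esub> m \<otimes>\<^bsub>K\<^esub> z) * e"
      by (simp add: \<psi>_def OE_simps algebra_simps)
    then show "\<psi> (a \<otimes>\<^bsub>K\<^esub> b, e) - \<psi> (b, s a \<otimes>\<^bsub>OE D\<^esub> e) \<in> N"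
      using NI[OF z(1)] b(2) by (simp add: OE_simps)
  qed
  have bounded: "nE (lin_ext \<psi> h) \<le> 1" if "h \<in> carrier tn.RR" for h
  proof -
    have "Poly_Mapping.keys h \<subseteq> carrier tn.MM" using that by simp
    then show ?thesis
    proof (induction h rule: mr_induct)
      case (one x)
      then show ?case using s_closed[OF \<phi>] by (auto simp: \<psi>_def nE_simps OE_simps intro!: mult_le_one)
    next
      case (diff a b)
      then show ?case using nE_simps(8)[of "lin_ext \<psi> a" "lin_ext \<psi> b"] by simp
    qed (simp add: nE_simps)
  qed
  have linear: "lin_ext \<psi> (mr_mult tn.MM (frag_of (\<one>\<^bsub>K\<^esub>, e)) h) = e * lin_ext \<psi> h"
    if "h \<in> carrier tn.RR" for h e
  proof -
    have "Poly_Mapping.keys h \<subseteq> carrier tn.MM" using that by simp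
    then show ?thesis
    proof (induction h rule: mr_induct)
      case (one x)
      then show ?case by (auto simp: \<psi>_def OE_simps)
    qed (simp_all add: algebra_simps)
  qed
  have "y \<in> carrier tn.TT" "z \<in> carrier tn.TT" using y z by (simp_all add: T_eq)
  then obtain fy fz where fy: "fy \<in> carrier tn.RR" "y = tn.JJ +>\<^bsub>tn.RR\<^esub> fy"
    and fz: "fz \<in> carrier tn.RR" "z = tn.JJ +>\<^bsub>tn.RR\<^esub> fz"
    by (metis tn.ten_rep)
  have u: "unif D ^ n \<in> carrier (OE D)" for n using wT_pow[of n] q01 by (simp add: OE_simps power_le_one)
  let ?F = "\<lambda>b e. frag_of (b, e)"
  let ?h = "\<lambda>f. tn.JJ +>\<^bsub>tn.RR\<^esub> f"
  have F: "?F \<one>\<^bsub>K\<^esub> (unif D ^ n) \<in> carrier tn.RR" for n by (rule tn.frag_closed[OF wp.K.one_closed u])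
  have F1: "?F \<one>\<^bsub>K\<^esub> (unif D) \<in> carrier tn.RR" using F[of 1] by simp
  have Fc: "?F (teichmueller c) 1 \<in> carrier tn.RR" by (rule tn.frag_closed[OF wp.t_closed[OF c(1)] one_OE])
  \<comment> \<open>The equation is lifted to representatives in the monoid ring, since
    \<open>lin_ext \<psi>\<close> lives there and descends to the tensor product only modulo
    \<open>N\<close>.\<close>
  define G where "G = ?F (teichmueller c) 1 \<oplus>\<^bsub>tn.RR\<^esub> (?F \<one>\<^bsub>K\<^esub> (unif D) \<otimes>\<^bsub>tn.RR\<^esub> fy)"
  have Gc: "G \<in> carrier tn.RR" unfolding G_def by (intro tn.R.a_closed tn.R.m_closed Fc F1 fy)
  define P where "P = ?F \<one>\<^bsub>K\<^esub> (unif D ^ i) \<otimes>\<^bsub>tn.RR\<^esub> G"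
  define Q where "Q = ?F \<one>\<^bsub>K\<^esub> (unif D ^ m) \<otimes>\<^bsub>tn.RR\<^esub> fz"
  have PQ: "P \<in> carrier tn.RR" "Q \<in> carrier tn.RR" unfolding P_def Q_def by (intro tn.R.m_closed F Gc fz)+
  note hm = ring_hom_mult[OF tn.TT_hom] and ha = ring_hom_add[OF tn.TT_hom]
  have hG: "?h G = tT c \<oplus>\<^bsub>T\<^esub> wT \<otimes>\<^bsub>T\<^esub> y"
    unfolding G_def ha[OF Fc tn.R.m_closed[OF F1 fy(1)]] hm[OF F1 fy(1)] fy(2)
    by (simp add: T_eq tens_eq tn.ten_eq OE_simps)
  have "?h P = wT [^]\<^bsub>T\<^esub> i \<otimes>\<^bsub>T\<^esub> (tT c \<oplus>\<^bsub>T\<^esub> wT \<otimes>\<^bsub>T\<^esub> y)"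
    unfolding P_def hm[OF F Gc] hG using wT_pow[of i] by (simp add: T_eq tens_eq tn.ten_eq)
  moreover have "?h Q = wT [^]\<^bsub>T\<^esub> m \<otimes>\<^bsub>T\<^esub> z"
    unfolding Q_def hm[OF F fz(1)] fz(2) using wT_pow[of m] by (simp add: T_eq tens_eq tn.ten_eq)
  ultimately have "?h P = ?h Q" using eq by simp
  then have "P - Q \<in> tn.JJ" by (rule tn.coset_eqD[OF PQ])
  then have "lin_ext \<psi> P - lin_ext \<psi> Q \<in> N" using kill by fastforce
  moreover have "lin_ext \<psi> Q = unif D ^ m * lin_ext \<psi> fz"
    using linear[OF fz(1)] by (simp add: Q_def)
  then have "lin_ext \<psi> Q \<in> N" using bounded[OF fz(1)] q01 wT_pow[of m] by (simp add: N_def nE_simps mult_left_le)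
  ultimately have PN: "lin_ext \<psi> P \<in> N"
    using nE_simps(7)[of "lin_ext \<psi> P - lin_ext \<psi> Q" "lin_ext \<psi> Q"] by (simp add: N_def)
  define a where "a = s (\<phi> (teichmueller c))"
  have Peq: "lin_ext \<psi> P = unif D ^ i * (a + unif D * lin_ext \<psi> fy)"
    using linear[OF Gc] linear[OF fy(1)] by (simp add: P_def G_def \<psi>_def a_def)
  obtain v where v: "v \<in> wp.WB" "\<phi> (teichmueller c) = \<one>\<^bsub>K\<^esub> \<oplus>\<^bsub>K\<^esub> wp.pw [^]\<^bsub>K\<^esub> m \<otimes>\<^bsub>K\<^esub> v"
    using \<phi>_c by blast
  have sv: "wp.pw [^]\<^bsub>K\<^esub> m \<otimes>\<^bsub>K\<^esub> v \<in> wp.WB" "nE (s (wp.pw [^]\<^bsub>K\<^esub> m \<otimes>\<^bsub>K\<^esub> v)) \<le> q ^ m"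
    using s_witt_p_pow[OF v(1), of m] by auto
  have a: "a = 1 + s (wp.pw [^]\<^bsub>K\<^esub> m \<otimes>\<^bsub>K\<^esub> v)"
    unfolding a_def v(2) s_add[OF wp.one_WB sv(1)] s_one ..
  define d where "d = s (wp.pw [^]\<^bsub>K\<^esub> m \<otimes>\<^bsub>K\<^esub> v) + unif D * lin_ext \<psi> fy"
  have "q ^ m < 1" using im q01 by (simp add: power_less_one_iff)
  moreover have "nE (unif D * lin_ext \<psi> fy) < 1"
    using bounded[OF fy(1)] q01 nE_simps(1)[of "lin_ext \<psi> fy"] by (simp add: nE_simps) (smt (verit) mult_left_le)
  ultimately have "nE d < 1"
    using nE_simps(7)[of "s (wp.pw [^]\<^bsub>K\<^esub> m \<otimes>\<^bsub>K\<^esub> v)" "unif D * lin_ext \<psi> fy"] sv(2) unfolding d_def by linarith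
  \<comment> \<open>\<open>d\<close> collects the error of the coordinate at [c], small because m >
    0, and the multiple of the uniformizer. So 1 + d has norm at least 1, and \<open>P\<close> has
    norm at least q^i, too large to lie in \<open>N\<close>.\<close>
  moreover have "1 = (1 + d) + (- d)" by simp
  then have "1 \<le> max (nE (1 + d)) (nE d)" using nE_simps(7)[of "1 + d" "- d"] by (simp add: nE_simps)
  ultimately have "nE (1 + d) \<ge> 1" by linarith
  then have "q ^ i \<le> nE (lin_ext \<psi> P)"
    using q01 wT_pow[of i] by (simp add: Peq a d_def[symmetric] add.assoc nE_simps)
  also have "\<dots> \<le> q ^ m" using PN by (simp add: N_def)
  also have "\<dots> < q ^ i" using im q01 by (intro power_strict_decreasing) auto
  finally show False by simp
qed

end

section \<open>Expansions as adic sums\<close>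

context expansion_ring
begin

definition esum :: "nat \<Rightarrow> (nat \<Rightarrow> 'l) \<Rightarrow> 'a" where
  "esum n c = (\<Oplus>i\<in>{..<n}. w [^] i \<otimes> t (c i))"

lemma esum_0: "esum 0 c = \<zero>"
  by (simp add: esum_def)

lemma esum_Suc: "(\<And>i. nm (c i) \<le> 1) \<Longrightarrow> esum (Suc n) c = esum n c \<oplus> w [^] n \<otimes> t (c n)"
  by (simp add: esum_def lessThan_Suc finsum_insert a_comm)

lemma esum_closed: "(\<And>i. nm (c i) \<le> 1) \<Longrightarrow> esum n c \<in> carrier R"
  unfolding esum_def by (intro finsum_closed funcsetI m_closed w_pow_closed t_closed)

text \<open>Splits off the first term, to match the recursion of \<open>co\<close>;
  \<open>esum_Suc\<close> splits off the last.\<close>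

lemma esum_shift:
  assumes c: "\<And>i. nm (c i) \<le> 1"
  shows "esum (Suc n) c = t (c 0) \<oplus> w \<otimes> esum n (\<lambda>i. c (Suc i))"
proof (induction n)
  case 0
  show ?case using c by (simp add: esum_Suc esum_0)
next
  case (Suc n)
  define d where "d = (\<lambda>i. c (Suc i))"
  have k: "t (c 0) \<in> carrier R" "t (c (Suc n)) \<in> carrier R" "w [^] n \<in> carrier R" "esum n d \<in> carrier R"
    using c esum_closed[of d] by (auto simp: d_def)
  have "esum (Suc (Suc n)) c = (t (c 0) \<oplus> w \<otimes> esum n d) \<oplus> (w [^] n \<otimes> w) \<otimes> t (c (Suc n))"
    using Suc esum_Suc[of c "Suc n"] c by (simp add: d_def)
  also have "\<dots> = t (c 0) \<oplus> w \<otimes> (esum n d \<oplus> w [^] n \<otimes> t (c (Suc n)))"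
    using k w_closed by algebra
  also have "esum n d \<oplus> w [^] n \<otimes> t (c (Suc n)) = esum (Suc n) d"
    using esum_Suc[of d n] c by (simp add: d_def)
  finally show ?case by (simp add: d_def)
qed

lemma co_esum:
  assumes "\<And>i. nm (c i) \<le> 1" "i < n" shows "co (esum n c) i = c i"
  using assms
proof (induction n arbitrary: c i)
  case (Suc n)
  have "esum n (\<lambda>i. c (Suc i)) \<in> carrier R" using Suc.prems esum_closed by simp
  note st = co_step[OF Suc.prems(1)[of 0] this]
  show ?case
    unfolding esum_shift[of c n, OF Suc.prems(1)] using st Suc by (cases i) simp_all
qed simp

lemma funpow_tl_closed: "x \<in> carrier R \<Longrightarrow> (tl ^^ n) x \<in> carrier R"
  by (induction n) (auto simp: hd_tl)

lemma co_funpow: "co x n = hd ((tl ^^ n) x)"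
  by (induction n arbitrary: x) (simp_all add: funpow_swap1)

lemma esum_co:
  assumes x: "x \<in> carrier R" shows "x = esum n (co x) \<oplus> w [^] n \<otimes> (tl ^^ n) x"
proof (induction n)
  case 0
  show ?case using x by (simp add: esum_0)
next
  case (Suc n)
  let ?z = "(tl ^^ n) x"
  have z: "?z \<in> carrier R" by (rule funpow_tl_closed[OF x])
  note h = hd_tl[OF z]
  have k: "esum n (co x) \<in> carrier R" "w [^] n \<in> carrier R" "t (hd ?z) \<in> carrier R" "tl ?z \<in> carrier R"
    using esum_closed co_le_1[OF x] h(1,2) by auto
  have "x = esum n (co x) \<oplus> w [^] n \<otimes> (t (hd ?z) \<oplus> w \<otimes> tl ?z)"
    using Suc h(3) by simp
  also have "\<dots> = (esum n (co x) \<oplus> w [^] n \<otimes> t (hd ?z)) \<oplus> (w [^] n \<otimes> w) \<otimes> tl ?z"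
    using k w_closed by algebra
  also have "\<dots> = esum (Suc n) (co x) \<oplus> w [^] Suc n \<otimes> (tl ^^ Suc n) x"
    using esum_Suc[of "co x" n] co_le_1[OF x] by (simp add: co_funpow)
  finally show ?case .
qed

text \<open>Existence and uniqueness of expansions at once: the coefficients found by repeated
  division are the only ones whose series converges to \<open>x\<close>.\<close>

lemma adic_sums_iff:
  assumes x: "x \<in> carrier R" and c: "\<And>i. nm (c i) \<le> 1"
  shows "adic_sums R (PIdl w) (\<lambda>i. w [^] i \<otimes> t (c i)) x \<longleftrightarrow> c = co x"
proof
  assume "adic_sums R (PIdl w) (\<lambda>i. w [^] i \<otimes> t (c i)) x"
  then have lim: "\<exists>N. \<forall>n\<ge>N. x \<ominus> esum n c \<in> PIdl (w [^] k)" for k :: nat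
    by (simp add: adic_sums_def ideal_pow_cgenideal esum_def)
  show "c = co x"
  proof
    fix i
    \<comment> \<open>Coefficient i is determined by the class modulo w^(i+1), hence the
      exponent.\<close>
    obtain N where N: "\<And>n. n \<ge> N \<Longrightarrow> x \<ominus> esum n c \<in> PIdl (w [^] Suc i)" using lim[of "Suc i"] by blast
    define n where "n = max N (Suc i)"
    obtain y where y: "y \<in> carrier R" "x \<ominus> esum n c = y \<otimes> w [^] Suc i"
      using N[of n] by (auto simp: n_def mem_cgenideal simp del: nat_pow_Suc)
    have E: "esum n c \<in> carrier R" using c by (rule esum_closed)
    have "x = esum n c \<oplus> (x \<ominus> esum n c)" using x E by algebra
    also have "\<dots> = esum n c \<oplus> w [^] Suc i \<otimes> y" unfolding y(2) by (subst m_comm[OF y(1) w_pow_closed]) (rule refl)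
    finally have "co x i = co (esum n c) i" using co_add_w_pow[OF E y(1), of i "Suc i"] by simp
    then show "c i = co x i" using co_esum[of c i n] c by (simp add: n_def)
  qed
next
  assume c: "c = co x"
  have "x \<ominus> esum n c \<in> PIdl (w [^] k)" if "n \<ge> k" for n k :: nat
  proof -
    let ?z = "(tl ^^ n) x"
    have z: "?z \<in> carrier R" by (rule funpow_tl_closed[OF x])
    have E: "esum n c \<in> carrier R" unfolding c using co_le_1[OF x] by (rule esum_closed)
    have wn: "w [^] n \<in> carrier R" by simp
    have "x \<ominus> esum n c = (esum n c \<oplus> w [^] n \<otimes> ?z) \<ominus> esum n c" using esum_co[OF x, of n] c by simp
    also have "\<dots> = ?z \<otimes> w [^] n" using E z wn by algebra
    also have "w [^] n = w [^] (n - k) \<otimes> w [^] k" using that by (simp add: nat_pow_mult)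
    finally have "x \<ominus> esum n c = (?z \<otimes> w [^] (n - k)) \<otimes> w [^] k" using z by (simp add: m_assoc)
    then show ?thesis using z by (auto simp: mem_cgenideal)
  qed
  then show "adic_sums R (PIdl w) (\<lambda>i. w [^] i \<otimes> t (c i)) x"
    unfolding adic_sums_def ideal_pow_cgenideal[OF w_closed] esum_def[symmetric] by blast
qed

end

context untilt_ring
begin

text \<open>The ball of radius 1/p is an ideal that contains both generators, so convergence in the
  adic topology of the presentation implies convergence in norm.\<close>

lemma ideal_pow_gnorm:
  assumes "x \<in> ideal_pow R (Idl {w, t u}) k" shows "x \<in> carrier R \<and> gnorm x \<le> (1 / p) ^ k"
  using assms
proof (induction k arbitrary: x)
  case 0
  then show ?case using gnorm_le_1 by simp
next
  case (Suc k)
  define I where "I = {x \<in> carrier R. gnorm x \<le> 1 / p}"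
  have tu: "t u \<in> carrier R" "gnorm (t u) \<le> 1 / p" using u_le_1 nm_u gnorm_t by auto
  have gw: "gnorm w \<le> 1 / p"
  proof -
    have "co w i = (if i = 1 then 1 else 0)" for i using co_w_pow_t[of 1 1 i] by simp
    then show ?thesis by (intro gnorm_least) simp
  qed
  have "ideal I R"
  proof (rule idealI)
    show "subgroup I (add_monoid R)"
      by (rule add.subgroupI) (auto simp: I_def intro: order_trans[OF gnorm_add] intro!: exI[of _ \<zero>])
    show "x \<otimes> a \<in> I" "a \<otimes> x \<in> I" if "a \<in> I" "x \<in> carrier R" for a x
      using that gnorm_le_1[of x] gnorm_nonneg[of x] gnorm_nonneg[of a]
        mult_left_le_one_le[of "gnorm a" "gnorm x"] mult_left_le[of "gnorm x" "gnorm a"]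
      by (auto simp: I_def gnorm_mult)
  qed (rule ring_axioms)
  then have sub: "Idl {w, t u} \<subseteq> I"
    using tu gw by (intro genideal_minimal) (auto simp: I_def)
  from Suc.prems have "x \<in> ideal_prod R (Idl {w, t u}) (ideal_pow R (Idl {w, t u}) k)" by simp
  then show ?case
  proof induction
    case (prod i j)
    have i: "i \<in> carrier R" "gnorm i \<le> 1 / p" using prod(1) sub by (auto simp: I_def)
    have j: "j \<in> carrier R" "gnorm j \<le> (1 / p) ^ k" using Suc.IH[OF prod(2)] by auto
    have "gnorm i * gnorm j \<le> 1 / p * (1 / p) ^ k"
      using i j gnorm_nonneg by (intro mult_mono) auto
    then show ?case using i j by (simp add: gnorm_mult)
  next
    case (sum a b)
    then show ?case using gnorm_add[of a b] by auto
  qed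
qed

end

section \<open>The ring $W(\mathcal{O}_L)_E$\<close>

context witt_setting
begin

section \<open>Transfer from the tensor product to its completion\<close>

lemma zero_OL: "0 \<in> OL D" and one_OL: "1 \<in> OL D"
  using is_subringD[OF wp.subrings(1)] by auto

lemma tT_zero: "tT 0 = \<zero>\<^bsub>T\<^esub>"
proof -
  have "tT 0 = tT 0 \<oplus>\<^bsub>T\<^esub> tT 0"
    unfolding T_eq tens_eq OE_simps wp.t_zero
    using tn.ten_add_left[OF wp.K.zero_closed wp.K.zero_closed one_OE] by simp
  then show ?thesis using tT_closed[OF zero_OL] T.add.l_cancel_one[of "tT 0" "tT 0"] by simp
qed

lemma tT_mult: "a \<in> OL D \<Longrightarrow> b \<in> OL D \<Longrightarrow> tT (a * b) = tT a \<otimes>\<^bsub>T\<^esub> tT b"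
  unfolding T_eq tens_eq OE_simps
  using tn.ten_mult[OF wp.t_closed one_OE wp.t_closed one_OE, of a b] teichmueller_mult[OF p, of a b]
  by (simp add: OE_simps witt_ring_simps)

lemma tT_one: "tT 1 = \<one>\<^bsub>T\<^esub>"
  unfolding T_eq tens_eq tn.ten_one wp.one_K ..

text \<open>The search for a nonzero leading coefficient stops at n, because the uncompleted tensor
  product is not known to be separated.\<close>

lemma T_order:
  assumes x: "x \<in> carrier T"
  shows "(\<exists>y\<in>carrier T. x = wT [^]\<^bsub>T\<^esub> (n::nat) \<otimes>\<^bsub>T\<^esub> y) \<or>
    (\<exists>i<n. \<exists>a\<in>OL D. \<exists>y\<in>carrier T. a \<noteq> 0 \<and> x = wT [^]\<^bsub>T\<^esub> i \<otimes>\<^bsub>T\<^esub> (tT a \<oplus>\<^bsub>T\<^esub> wT \<otimes>\<^bsub>T\<^esub> y))"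
proof (induction n)
  case 0
  show ?case using x by auto
next
  case (Suc n)
  then show ?case
  proof
    assume "\<exists>y\<in>carrier T. x = wT [^]\<^bsub>T\<^esub> n \<otimes>\<^bsub>T\<^esub> y"
    then obtain y where y: "y \<in> carrier T" "x = wT [^]\<^bsub>T\<^esub> n \<otimes>\<^bsub>T\<^esub> y" by blast
    obtain a z where a: "a \<in> OL D" "z \<in> carrier T" "y = tT a \<oplus>\<^bsub>T\<^esub> wT \<otimes>\<^bsub>T\<^esub> z"
      using T_decomp[OF y(1)] by blast
    show ?thesis
    proof (cases "a = 0")
      case True
      then have "x = wT [^]\<^bsub>T\<^esub> Suc n \<otimes>\<^bsub>T\<^esub> z"
        using y a tT_zero by (simp add: T.m_assoc)
      then show ?thesis using a by blast
    next
      case False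
      then show ?thesis using y(2) a by blast
    qed
  next
    assume "\<exists>i<n. \<exists>a\<in>OL D. \<exists>y\<in>carrier T. a \<noteq> 0 \<and> x = wT [^]\<^bsub>T\<^esub> i \<otimes>\<^bsub>T\<^esub> (tT a \<oplus>\<^bsub>T\<^esub> wT \<otimes>\<^bsub>T\<^esub> y)"
    then show ?thesis using less_SucI by blast
  qed
qed

sublocale ad: adic_ring T wT
proof (intro adic_ring.intro adic_ring_axioms.intro T.is_cring wT_closed)
  fix x and n :: nat assume x: "x \<in> carrier T" and wx: "wT \<otimes>\<^bsub>T\<^esub> x \<in> PIdl\<^bsub>T\<^esub> (wT [^]\<^bsub>T\<^esub> Suc n)"
  obtain z where z: "z \<in> carrier T" "wT \<otimes>\<^bsub>T\<^esub> x = z \<otimes>\<^bsub>T\<^esub> wT [^]\<^bsub>T\<^esub> Suc n"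
    using wx unfolding T.mem_cgenideal by blast
  have wn: "wT [^]\<^bsub>T\<^esub> k \<in> carrier T" for k :: nat by simp
  from T_order[OF x, of n] show "x \<in> PIdl\<^bsub>T\<^esub> (wT [^]\<^bsub>T\<^esub> n)"
  proof (elim disjE bexE exE conjE)
    fix y assume "y \<in> carrier T" "x = wT [^]\<^bsub>T\<^esub> n \<otimes>\<^bsub>T\<^esub> y"
    then show ?thesis using T.m_comm[OF wn] by (auto simp: T.mem_cgenideal)
  next
    fix i a y
    \<comment> \<open>An element of exact order i < n would make its product with the uniformizer
      have order i + 1, but that product is divisible by the power n + 1; \<open>order_bound\<close>
      rules this out.\<close>
    assume i: "i < n" and a: "a \<in> OL D" "a \<noteq> 0" "y \<in> carrier T"
      and xeq: "x = wT [^]\<^bsub>T\<^esub> i \<otimes>\<^bsub>T\<^esub> (tT a \<oplus>\<^bsub>T\<^esub> wT \<otimes>\<^bsub>T\<^esub> y)"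
    have "wT [^]\<^bsub>T\<^esub> Suc i \<otimes>\<^bsub>T\<^esub> (tT a \<oplus>\<^bsub>T\<^esub> wT \<otimes>\<^bsub>T\<^esub> y) = wT \<otimes>\<^bsub>T\<^esub> x"
      unfolding xeq using a wn[of i] tT_closed[OF a(1)] wT_closed by (simp add: T.m_ac)
    also have "\<dots> = wT [^]\<^bsub>T\<^esub> Suc n \<otimes>\<^bsub>T\<^esub> z" unfolding z(2) by (rule T.m_comm[OF z(1) wn])
    finally have "Suc n \<le> Suc i" by (rule order_bound[OF a(1,2,3) z(1)])
    then show ?thesis using i by simp
  qed
qed

lemma WLE_eq: "WLE D = ad.C" "unifW D = ad.of_R wT" "teichW D = (\<lambda>a. ad.of_R (tT a))"
  by (simp_all add: WLE_def unifW_def teichW_def unif_ideal_def fun_eq_iff)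

sublocale h: ring_hom_cring T ad.C ad.of_R
  by (rule ad.of_R_hom_cring)

text \<open>Read at level 1, the equation makes the lift of a - b divisible by the uniformizer in
  the tensor product; for a - b nonzero, \<open>order_bound\<close> forbids this.\<close>

lemma of_R_eqD:
  assumes "a \<in> OL D" "b \<in> OL D" "y \<in> carrier ad.C"
    and eq: "ad.of_R (tT a) = ad.of_R (tT b) \<oplus>\<^bsub>ad.C\<^esub> ad.of_R wT \<otimes>\<^bsub>ad.C\<^esub> y"
  shows "a = b"
proof (rule ccontr)
  assume ne: "a \<noteq> b"
  obtain v where v: "v \<in> carrier T" "y 1 = ad.I 1 +>\<^bsub>T\<^esub> v"
    by (rule ad.C_rep[OF assms(3), of 1]) blast
  have c: "tT a \<in> carrier T" "tT b \<in> carrier T" using assms by auto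
  have "ad.I 1 +>\<^bsub>T\<^esub> tT a = ad.I 1 +>\<^bsub>T\<^esub> (tT b \<oplus>\<^bsub>T\<^esub> wT \<otimes>\<^bsub>T\<^esub> v)"
    using fun_cong[OF eq, of 1] c v by (simp add: ad.C_simps ad.Q_simps)
  then have "tT a \<ominus>\<^bsub>T\<^esub> (tT b \<oplus>\<^bsub>T\<^esub> wT \<otimes>\<^bsub>T\<^esub> v) \<in> ad.I 1"
    using ad.coset_eq_iff c v by simp
  then obtain z where z: "z \<in> carrier T" "tT a \<ominus>\<^bsub>T\<^esub> (tT b \<oplus>\<^bsub>T\<^esub> wT \<otimes>\<^bsub>T\<^esub> v) = z \<otimes>\<^bsub>T\<^esub> wT"
    by (auto simp: ad.mem_I)
  obtain d where d: "d \<in> carrier T" "tT a \<ominus>\<^bsub>T\<^esub> tT b = tT (a - b) \<oplus>\<^bsub>T\<^esub> wT \<otimes>\<^bsub>T\<^esub> d"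
    using tT_diff(2)[OF assms(1,2)] by blast
  note ab = tT_diff(1)[OF assms(1,2)]
  have abc: "tT (a - b) \<in> carrier T" "wT \<in> carrier T" using ab by auto
  have "tT a \<ominus>\<^bsub>T\<^esub> tT b = (tT a \<ominus>\<^bsub>T\<^esub> (tT b \<oplus>\<^bsub>T\<^esub> wT \<otimes>\<^bsub>T\<^esub> v)) \<oplus>\<^bsub>T\<^esub> wT \<otimes>\<^bsub>T\<^esub> v"
    using c v(1) abc by algebra
  then have "tT (a - b) \<oplus>\<^bsub>T\<^esub> wT \<otimes>\<^bsub>T\<^esub> d = z \<otimes>\<^bsub>T\<^esub> wT \<oplus>\<^bsub>T\<^esub> wT \<otimes>\<^bsub>T\<^esub> v"
    using d(2) z(2) by simp
  also have "\<dots> = wT \<otimes>\<^bsub>T\<^esub> (z \<oplus>\<^bsub>T\<^esub> v)" using z(1) v(1) abc by algebra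
  finally have "wT [^]\<^bsub>T\<^esub> (0::nat) \<otimes>\<^bsub>T\<^esub> (tT (a - b) \<oplus>\<^bsub>T\<^esub> wT \<otimes>\<^bsub>T\<^esub> d) = wT [^]\<^bsub>T\<^esub> (1::nat) \<otimes>\<^bsub>T\<^esub> (z \<oplus>\<^bsub>T\<^esub> v)"
    using abc d(1) z(1) v(1) by simp
  then have "(1::nat) \<le> 0"
    using ne z(1) v(1) by (intro order_bound[OF ab _ d(1)]) auto
  then show False by simp
qed

sublocale ex: expansion_ring "WLE D" "unifW D" "teichW D" nL "real p"
  unfolding WLE_eq
proof (intro expansion_ring.intro expansion_ring_axioms.intro ad.C_cring nL)
  show "1 < real p" using prime_gt_1_nat[OF p] by simp
  show "ad.of_R wT \<in> carrier ad.C" by (rule ad.of_R_closed[OF wT_closed])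
  show "ad.of_R (tT a) \<in> carrier ad.C" if "nL a \<le> 1" for a
    using that by (intro ad.of_R_closed tT_closed) (simp add: OL_iff)
  show "ad.of_R (tT (a * b)) = ad.of_R (tT a) \<otimes>\<^bsub>ad.C\<^esub> ad.of_R (tT b)" if "nL a \<le> 1" "nL b \<le> 1" for a b
    using that by (simp add: OL_iff tT_mult)
  show "ad.of_R (tT 1) = \<one>\<^bsub>ad.C\<^esub>" unfolding tT_one by (rule h.hom_one)
  show "ad.of_R (tT 0) = \<zero>\<^bsub>ad.C\<^esub>" unfolding tT_zero by (rule h.hom_zero)
  show "\<exists>y\<in>carrier ad.C. ad.of_R (tT a) \<oplus>\<^bsub>ad.C\<^esub> ad.of_R (tT b) =
      ad.of_R (tT (a + b)) \<oplus>\<^bsub>ad.C\<^esub> ad.of_R wT \<otimes>\<^bsub>ad.C\<^esub> y" if "nL a \<le> 1" "nL b \<le> 1" for a b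
  proof -
    have ab: "a \<in> OL D" "b \<in> OL D" "a + b \<in> OL D"
      using that is_subringD(5)[OF wp.subrings(1)] by (auto simp: OL_iff)
    obtain y where y: "y \<in> carrier T" "tT a \<oplus>\<^bsub>T\<^esub> tT b = tT (a + b) \<oplus>\<^bsub>T\<^esub> wT \<otimes>\<^bsub>T\<^esub> y"
      using tT_add[OF ab(1,2)] by blast
    then have "ad.of_R (tT a \<oplus>\<^bsub>T\<^esub> tT b) = ad.of_R (tT (a + b) \<oplus>\<^bsub>T\<^esub> wT \<otimes>\<^bsub>T\<^esub> y)" by simp
    then show ?thesis using ab y(1) ad.of_R_closed[OF y(1)] tT_closed wT_closed
      by (intro bexI[of _ "ad.of_R y"]) simp_all
  qed
  show "\<exists>a y. nL a \<le> 1 \<and> y \<in> carrier ad.C \<and> x = ad.of_R (tT a) \<oplus>\<^bsub>ad.C\<^esub> ad.of_R wT \<otimes>\<^bsub>ad.C\<^esub> y"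
    if x: "x \<in> carrier ad.C" for x
  proof -
    interpret C: cring ad.C by (rule ad.C_cring)
    obtain v where v: "v \<in> carrier T" "x 1 = ad.I 1 +>\<^bsub>T\<^esub> v"
      by (rule ad.C_rep[OF x, of 1]) blast
    obtain a z where a: "a \<in> OL D" "z \<in> carrier T" "v = tT a \<oplus>\<^bsub>T\<^esub> wT \<otimes>\<^bsub>T\<^esub> z"
      using T_decomp[OF v(1)] by blast
    have tc: "ad.of_R (tT a) \<in> carrier ad.C" using a by (intro ad.of_R_closed) simp
    \<comment> \<open>With a the leading coefficient of a representative at level 1, the difference
      vanishes there and is divisible by the uniformizer in the completion.\<close>
    define y where "y = x \<oplus>\<^bsub>ad.C\<^esub> ad.of_R (\<ominus>\<^bsub>T\<^esub> tT a)"
    have nt: "\<ominus>\<^bsub>T\<^esub> tT a \<in> carrier T" using a by simp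
    have y: "y \<in> carrier ad.C" using x ad.of_R_closed[OF nt] by (simp add: y_def)
    have "y 1 = ad.I 1 +>\<^bsub>T\<^esub> (v \<oplus>\<^bsub>T\<^esub> \<ominus>\<^bsub>T\<^esub> tT a)"
      using v nt by (simp add: y_def ad.C_simps ad.Q_simps)
    also have "v \<oplus>\<^bsub>T\<^esub> \<ominus>\<^bsub>T\<^esub> tT a = z \<otimes>\<^bsub>T\<^esub> wT"
      unfolding a(3) using tT_closed[OF a(1)] a(2) wT_closed by algebra
    also have "ad.I 1 +>\<^bsub>T\<^esub> (z \<otimes>\<^bsub>T\<^esub> wT) = ad.I 1 +>\<^bsub>T\<^esub> \<zero>\<^bsub>T\<^esub>"
    proof -
      have "z \<otimes>\<^bsub>T\<^esub> wT \<in> ad.I 1" unfolding ad.mem_I using a(2) wT_closed by (intro bexI[of _ z]) simp_all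
      then show ?thesis using ad.coset_zero_iff a(2) by simp
    qed
    finally obtain q where q: "q \<in> carrier ad.C" "y = ad.of_R wT \<otimes>\<^bsub>ad.C\<^esub> q"
      using ad.C_divisible[OF y] by blast
    have "x = ad.of_R (tT a) \<oplus>\<^bsub>ad.C\<^esub> (x \<oplus>\<^bsub>ad.C\<^esub> \<ominus>\<^bsub>ad.C\<^esub> ad.of_R (tT a))" using x tc by algebra
    also have "x \<oplus>\<^bsub>ad.C\<^esub> \<ominus>\<^bsub>ad.C\<^esub> ad.of_R (tT a) = y" using a by (simp add: y_def)
    finally show ?thesis using q a(1) by (auto simp: OL_iff)
  qed
  show "a = b" if "nL a \<le> 1" "nL b \<le> 1" "y \<in> carrier ad.C"
    "ad.of_R (tT a) = ad.of_R (tT b) \<oplus>\<^bsub>ad.C\<^esub> ad.of_R wT \<otimes>\<^bsub>ad.C\<^esub> y" for a b y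
    using that by (intro of_R_eqD) (auto simp: OL_iff)
  show "x = \<zero>\<^bsub>ad.C\<^esub>" if "x \<in> carrier ad.C" "ad.of_R wT \<otimes>\<^bsub>ad.C\<^esub> x = \<zero>\<^bsub>ad.C\<^esub>" for x
    using that by (rule ad.C_w_cancel)
  show "x = \<zero>\<^bsub>ad.C\<^esub>" if "\<And>n::nat. \<exists>y\<in>carrier ad.C. x = ad.of_R wT [^]\<^bsub>ad.C\<^esub> n \<otimes>\<^bsub>ad.C\<^esub> y" for x
    using that by (rule ad.C_separated)
qed

section \<open>Identification with the defined coefficients and norm\<close>

lemma coeffs_eq: assumes x: "x \<in> carrier (WLE D)" shows "coeffs D x = ex.co x"
proof -
  have "is_expansion D c x \<longleftrightarrow> c = ex.co x" for c
  proof
    assume "is_expansion D c x"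
    then have "\<And>i. nL (c i) \<le> 1"
      "adic_sums (WLE D) (PIdl\<^bsub>WLE D\<^esub> (unifW D)) (\<lambda>i. unifW D [^]\<^bsub>WLE D\<^esub> i \<otimes>\<^bsub>WLE D\<^esub> teichW D (c i)) x"
      by (simp_all add: is_expansion_def OL_iff)
    then show "c = ex.co x" using ex.adic_sums_iff[OF x] by blast
  next
    assume c: "c = ex.co x"
    then show "is_expansion D c x"
      using ex.adic_sums_iff[OF x, of c] ex.co_le_1[OF x] by (simp add: is_expansion_def OL_iff)
  qed
  then show ?thesis unfolding coeffs_def by simp
qed

lemma lam_eq: "x \<in> carrier (WLE D) \<Longrightarrow> lam D x = ex.gnorm x"
  by (simp add: lam_def ex.gnorm_def coeffs_eq)

end

theorem theorem3p6:
  fixes D :: "('l::field, 'e::field) witt_data" and u :: 'l and r :: real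
  assumes D: "witt_setup D"
    and u: "u \<in> OL D" "absL D u \<le> 1 / real (charp D)"
    and r: "0 \<le> r" "r \<le> 1"
  shows "multiplicative_seminorm (WLE D) (H D u r)
    \<and> (\<forall>x \<in> carrier (WLE D). H D u r x \<le> lam D x)
    \<and> (\<forall>x \<in> carrier (WLE D). \<forall>xs. stable_presentation D u x xs \<longrightarrow>
         (\<forall>i. (r / real (charp D)) ^ i * lam D (xs i) \<le> H D u r x) \<and>
         (\<exists>i. H D u r x = (r / real (charp D)) ^ i * lam D (xs i)))"
proof -
  interpret witt_setting D by (rule witt_setting.intro[OF D])
  have p0: "real p > 0" using prime_gt_0_nat[OF p] by simp
  interpret un: untilt_ring "WLE D" "unifW D" "teichW D" nL "real p" u "r / real p"
    by (intro untilt_ring.intro untilt_ring_axioms.intro ex.expansion_ring_axioms)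
      (use u r p0 in \<open>simp_all add: field_simps\<close>)
  have pi: "piW D u = un.pii" by (simp add: piW_def un.pii_def)
  have gauss: "gauss_norm D (r / real p) a = un.poly_norm a" if "a \<in> carrier (UP (WLE D))" for a
    using un.UP_closed[OF that] by (simp add: gauss_norm_def un.poly_norm_def lam_eq)
  have H_eq: "H D u r x = un.qnorm x" for x
    unfolding H_def un.qnorm_def un.at_pii_def pi by (intro arg_cong[of _ _ Inf] Collect_cong ex_cong1) (use gauss in auto)
  have semi: "multiplicative_seminorm (WLE D) (H D u r)"
    unfolding multiplicative_seminorm_def H_eq
    using un.qnorm_nonneg un.qnorm_zero un.qnorm_one un.qnorm_minus un.qnorm_mult by blast
  have stab: "un.stab x" if "x \<in> carrier (WLE D)" "stable D x" for x
  proof (cases "\<forall>i. ex.co x i = 0")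
    case True
    then show ?thesis using ex.co_eq_zero[OF that(1)] by (simp add: un.stab_def)
  next
    case False
    then have gt: "nL (ex.co x i) / real p ^ i < nL (ex.co x 0)" if "i > 0" for i
      using \<open>stable D x\<close> that coeffs_eq[OF \<open>x \<in> carrier (WLE D)\<close>] by (auto simp: stable_def simp del: ex.co.simps)
    \<comment> \<open>A peak has positive height, and strict domination of the coefficient at index
      1 shows that the first coefficient is nonzero.\<close>
    have "0 \<le> nL (ex.co x 1) / real p ^ 1" using nL_simps(1) by (simp del: ex.co.simps)
    then have "nL (ex.co x 0) > 0" using gt[of 1] by linarith
    moreover have "nL (ex.co x i) < real p ^ i * nL (ex.co x 0)" if "i > 0" for i
      using gt[OF that] p0 by (simp add: divide_less_eq mult.commute del: ex.co.simps)
    ultimately have "ex.peak 0 (nL (ex.co x 0)) x"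
      using that(1) by (simp add: ex.peak_def del: ex.co.simps)
    then show ?thesis by (auto simp: un.stab_def)
  qed
  have pres: "(r / real p) ^ i * lam D (xs i) \<le> H D u r x"
    "\<exists>i. H D u r x = (r / real p) ^ i * lam D (xs i)"
    if x: "x \<in> carrier (WLE D)" and st: "stable_presentation D u x xs" for x xs i
  proof -
    have xs: "xs i \<in> carrier (WLE D)" for i
      using st by (simp add: stable_presentation_def presentation_def)
    have xst: "un.stab (xs i)" for i using st xs stab by (simp add: stable_presentation_def)
    have lim: "\<exists>N. \<forall>n\<ge>N. ex.gnorm (x \<ominus>\<^bsub>WLE D\<^esub> un.psum xs n) < e" if e: "e > 0" for e
    proof -
      obtain k where k: "(1 / real p) ^ k < e"
        using real_arch_pow_inv[OF e, of "1 / real p"] prime_gt_1_nat[OF p] by auto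
      have "adic_sums (WLE D) (Idl\<^bsub>WLE D\<^esub> {unifW D, teichW D u})
          (\<lambda>i. xs i \<otimes>\<^bsub>WLE D\<^esub> un.pii [^]\<^bsub>WLE D\<^esub> i) x"
        using st by (simp add: stable_presentation_def presentation_def pi)
      then obtain N where "\<And>n. n \<ge> N \<Longrightarrow>
          x \<ominus>\<^bsub>WLE D\<^esub> un.psum xs n \<in> ideal_pow (WLE D) (Idl\<^bsub>WLE D\<^esub> {unifW D, teichW D u}) k"
        unfolding adic_sums_def un.psum_def by blast
      then show ?thesis using un.ideal_pow_gnorm k by (meson order.strict_trans1)
    qed
    show "(r / real p) ^ i * lam D (xs i) \<le> H D u r x"
      using un.qnorm_presentation(1)[OF x xs xst lim] by (simp add: H_eq lam_eq[OF xs])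
    show "\<exists>i. H D u r x = (r / real p) ^ i * lam D (xs i)"
      using un.qnorm_presentation(2)[OF x xs xst lim] by (simp add: H_eq lam_eq[OF xs])
  qed
  show ?thesis
    using semi pres un.qnorm_le_gnorm by (auto simp: H_eq lam_eq)
qed

end
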